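(* Let $e_t=\sum_{j=-\infty}^{\infty}\psi_j\xi_{t-j}$, where $\{\xi_j\}$ are i.i.d. with $E[\xi_1]=0$, $E[\xi_1^2]=1$, $E[\xi_1^6]<\infty$, $\gamma(0)=\sum_j\psi_j^2<\infty$, and $\gamma(k)=E[e_te_{t+k}]=\sum_j\psi_j\psi_{j+k}\sim\eta|k|^{-\alpha}$ as $k\to\infty$, with $\lambda=(\alpha,\eta)$, $0<\alpha<1$, $0<\eta<\infty$. Let $\{X_t\}$ be i.i.d., independent of $\{e_s\}$, with bounded uniformly continuous density $f$. Assume there exist estimators $\widetilde\lambda$ with $\|\widetilde\lambda-\lambda\|=O_P(w_n^{-1})$ for positive $w_n$ with $w_n/\log n\to\infty$. Let $K$ be a bounded symmetric probability density on $\mathbb{R}$ such that, given $\tfrac12<\alpha<1$, there exists $0<\beta<\alpha-\tfrac12$ with $K(x)=O(1/(1+|x|^{1-\beta}))$. Let $a_n(x,y)=K\big(\frac{x-y}{h}\big)$. (i) If $n^{2(1-\alpha)}h\to0$ and $nh\to\infty$, then $\sum_{t=1}^n\sum_{s=1,s\ne t}^ne_sa_n(X_s,X_t)e_t/\sigma_{1n}(h)\to_D N(0,1)$, where $\sigma_{1n}^2(h)=n^2hA_{1\alpha}^2$ and $A_{1\alpha}^2=2\gamma^2(0)\int K^2(x)\,dx\int f^2(y)\,dy$. (ii) If $h\to0$ and $n^{2(1-\alpha)}h\to\infty$, then $\sum_{t=1}^n\sum_{s=1,s\ne t}^ne_sa_n(X_s,X_t)e_t/\sigma_{2n}(h)\to_D\chi^2(1)$,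 where $\sigma_{2n}(h)=n^{2-\alpha}hA_{2\alpha}$ and $A_{2\alpha}=\frac{2\eta}{(1-\alpha)(2-\alpha)}\int f^2(y)\,dy$.
   Context: $h=h_n>0$ is a bandwidth, limits are as $n\to\infty$, $a_n\sim b_n$ means $a_n/b_n\to1$, and $\chi^2(1)$ is the chi-squared distribution with one degree of freedom. *)

theory Defs
  imports "HOL-Probability.Probability" "HOL-Library.Landau_Symbols"
begin

definition lp_gamma :: "(int \<Rightarrow> real) \<Rightarrow> int \<Rightarrow> real" where
  "lp_gamma \<psi> k = (\<Sum>\<^sub>\<infinity>j. \<psi> j * \<psi> (j + k))"

definition bigO_P :: "'a measure \<Rightarrow> (nat \<Rightarrow> 'a \<Rightarrow> real) \<Rightarrow> (nat \<Rightarrow> real) \<Rightarrow> bool" where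
  "bigO_P M Y a \<longleftrightarrow> (\<forall>\<epsilon>>0. \<exists>C. eventually
      (\<lambda>n. measure M {\<omega> \<in> space M. \<bar>Y n \<omega>\<bar> > C * a n} < \<epsilon>) sequentially)"

definition std_normal :: "real measure" where
  "std_normal = density lborel std_normal_density"

definition chi2_1 :: "real measure" where
  "chi2_1 = distr std_normal borel (\<lambda>z. z ^ 2)"

end

theory Submission
  imports Defs "HOL-Real_Asymp.Real_Asymp"
begin

text \<open>
Write the kernel by its Hoeffding decomposition as
\<open>K((x - y)/h) = H(x, y) + (g(x) - \<mu>) + (g(y) - \<mu>) + \<mu>\<close>, where \<open>H\<close> is degenerate
under the design law. Then \<open>T = 2 Q + \<mu> S\<^sup>2 + R\<close> with \<open>Q\<close> the degenerate quadratic form in the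
errors, \<open>S\<close> the sum of the errors, and \<open>R\<close> negligible in \<open>L\<^sup>1\<close> under either normalisation.
The form \<open>Q\<close> has size \<open>n \<surd>h\<close> and \<open>\<mu> S\<^sup>2\<close> has size \<open>n\<^bsup>2-\<alpha>\<^esup> h\<close>, so the limit of
\<open>n\<^bsup>2(1-\<alpha>)\<^esup> h\<close>, zero or infinity, decides which of the two dominates.

Conditionally on the errors, \<open>Q\<close> is a martingale in the number of design points. Exchanging its
increments one by one for Gaussian ones gives a quantitative bound for its characteristic function;
this needs only that \<open>H\<close> is bounded and \<open>\<integral>|H(x, y)| dF(y) = O(h)\<close>. The sum \<open>S\<close> is a
linear form in the innovations whose coefficients are at most \<open>\<surd>n\<close> up to a constant while its
standard deviation is of order \<open>n\<^bsup>1-\<alpha>/2\<^esup>\<close>, so the Lindeberg condition holds.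
\<close>

section \<open>Moments of sums of independent variables\<close>

text \<open>Orders in h explain why the exchange succeeds. The conditional variances of the
  increments of \<open>Q\<close> have mean of order n h. Their fluctuation is a diagonal sum of
  independent terms, of order h sqrt(n), plus a degenerate form with kernel \<open>gram\<close>, of
  order n h^(3/2), because the L1 norm of \<open>gram\<close> gains a second factor h. Relative to
  the mean these are n^(-1/2) and h^(1/2), so the exchange errors vanish even after summation over n
  steps. The weights are random and controlled through fourth moments: the conditional bound is used
  where the sum of fourth powers is at most m n, and a Markov term of order 1/m pays for the rest.
  The level m and the weight \<delta> of the Taylor remainder are fixed before n tends to infinity.
  What is left of the conditional Gaussian depends on the mean of the squared errors, which
  converges in L1 because truncating the linear process makes the squares finitely dependent. In
  \<open>R\<close> the dominant product has size h sqrt(n) times n^(1-\<alpha>/2): the design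
  average of the errors is blind to long memory.\<close>

lemma abs_power_le_one_plus_power4:
  fixes x :: real
  assumes "k \<le> 4"
  shows "\<bar>x\<bar> ^ k \<le> 1 + x ^ 4"
proof (cases "\<bar>x\<bar> \<le> 1")
  case True
  then have "\<bar>x\<bar> ^ k \<le> 1" by (simp add: power_le_one)
  then show ?thesis by (smt (verit) zero_le_even_power even_numeral)
next
  case False
  then have "\<bar>x\<bar> ^ k \<le> \<bar>x\<bar> ^ 4" using assms by (intro power_increasing) auto
  then show ?thesis by (simp add: power_even_abs)
qed

lemma (in finite_measure) integrable_power_of_power4:
  fixes Y :: "'a \<Rightarrow> real"
  assumes [measurable]: "Y \<in> borel_measurable M"
    and "integrable M (\<lambda>x. Y x ^ 4)" and "k \<le> 4"
  shows "integrable M (\<lambda>x. Y x ^ k)"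
proof (rule Bochner_Integration.integrable_bound)
  show "integrable M (\<lambda>x. 1 + Y x ^ 4)" using assms by auto
  show "AE x in M. norm (Y x ^ k) \<le> norm (1 + Y x ^ 4)"
    using abs_power_le_one_plus_power4[OF \<open>k \<le> 4\<close>] by (auto simp: power_abs intro: order_trans[OF _ abs_ge_self])
qed measurable

lemma (in finite_measure) integrable_prod_of_power4:
  fixes Y Z :: "'a \<Rightarrow> real"
  assumes [measurable]: "Y \<in> borel_measurable M" "Z \<in> borel_measurable M"
    and "integrable M (\<lambda>x. Y x ^ 4)" "integrable M (\<lambda>x. Z x ^ 4)" and "i + j \<le> 4"
  shows "integrable M (\<lambda>x. Y x ^ i * Z x ^ j)"
proof (rule Bochner_Integration.integrable_bound)
  show "integrable M (\<lambda>x. 1 + (Y x ^ 4 + Z x ^ 4))" using assms by auto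
  have "\<bar>y ^ i * z ^ j\<bar> \<le> 1 + (y ^ 4 + z ^ 4)" for y z :: real
  proof -
    \<comment> \<open>Bounding both factors by the larger absolute value turns the mixed monomial
      into one power of degree \<open>i + j\<close>.\<close>
    define m where "m = max \<bar>y\<bar> \<bar>z\<bar>"
    have "\<bar>y ^ i * z ^ j\<bar> = \<bar>y\<bar> ^ i * \<bar>z\<bar> ^ j" by (simp add: abs_mult power_abs)
    also have "\<dots> \<le> m ^ i * m ^ j" by (intro mult_mono power_mono) (auto simp: m_def)
    also have "\<dots> = \<bar>m\<bar> ^ (i + j)" by (simp add: power_add m_def)
    also have "\<dots> \<le> 1 + m ^ 4" by (rule abs_power_le_one_plus_power4) fact
    also have "\<dots> \<le> 1 + (y ^ 4 + z ^ 4)" by (auto simp: m_def max_def)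
    finally show ?thesis .
  qed
  then show "AE x in M. norm (Y x ^ i * Z x ^ j) \<le> norm (1 + (Y x ^ 4 + Z x ^ 4))"
    by (auto intro: order_trans[OF _ abs_ge_self])
qed measurable

text \<open>Squaring the bound (x + y)^2 <= 2 (x^2 + y^2) and applying it once more produces 2^2 * 2
  = 8, the convexity constant of the fourth power.\<close>

lemma power4_add_le: "(a + b :: real) ^ 4 \<le> 8 * (a ^ 4 + b ^ 4)"
proof -
  have "(a + b) ^ 4 = ((a + b)\<^sup>2)\<^sup>2" by simp
  also have "\<dots> \<le> (2 * (a\<^sup>2 + b\<^sup>2))\<^sup>2"
    using zero_le_power2[of "a - b"] by (intro power_mono zero_le_power2) (auto simp: power2_diff power2_sum)
  also have "\<dots> \<le> 8 * (a ^ 4 + b ^ 4)"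
    using zero_le_power2[of "a\<^sup>2 - b\<^sup>2"] by (simp add: power2_eq_square power4_eq_xxxx algebra_simps)
  finally show ?thesis .
qed

lemma (in finite_measure) integrable_power4_add:
  fixes Y Z :: "'a \<Rightarrow> real"
  assumes [measurable]: "Y \<in> borel_measurable M" "Z \<in> borel_measurable M"
    and "integrable M (\<lambda>x. Y x ^ 4)" "integrable M (\<lambda>x. Z x ^ 4)"
  shows "integrable M (\<lambda>x. (Y x + Z x) ^ 4)"
proof (rule Bochner_Integration.integrable_bound)
  show "integrable M (\<lambda>x. 8 * (Y x ^ 4 + Z x ^ 4))" using assms by auto
  show "AE x in M. norm ((Y x + Z x) ^ 4) \<le> norm (8 * (Y x ^ 4 + Z x ^ 4))"
    using power4_add_le by (auto intro: order_trans[OF _ abs_ge_self])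
qed measurable

lemma (in finite_measure) integrable_power4_sum:
  fixes Y :: "'i \<Rightarrow> 'a \<Rightarrow> real"
  assumes "finite J" and "\<And>j. j \<in> J \<Longrightarrow> Y j \<in> borel_measurable M"
    and "\<And>j. j \<in> J \<Longrightarrow> integrable M (\<lambda>x. Y j x ^ 4)"
  shows "integrable M (\<lambda>x. (\<Sum>j\<in>J. Y j x) ^ 4)"
  using assms
proof (induction J rule: finite_induct)
  case (insert j J)
  then show ?case
    by (simp add: integrable_power4_add)
qed simp

lemma (in prob_space) indep_var_integral_powers:
  fixes Y Z :: "'a \<Rightarrow> real"
  assumes ind: "indep_var borel Y borel Z"
    and "integrable M (\<lambda>x. Y x ^ 4)" "integrable M (\<lambda>x. Z x ^ 4)" "i \<le> 4" "j \<le> 4"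
  shows "expectation (\<lambda>x. Y x ^ i * Z x ^ j) = expectation (\<lambda>x. Y x ^ i) * expectation (\<lambda>x. Z x ^ j)"
proof -
  have [measurable]: "Y \<in> borel_measurable M" "Z \<in> borel_measurable M"
    using ind indep_var_rv1 indep_var_rv2 by blast+
  have "indep_var borel ((\<lambda>y. y ^ i) \<circ> Y) borel ((\<lambda>y. y ^ j) \<circ> Z)"
    by (rule indep_var_compose[OF ind]) auto
  then show ?thesis
    using assms by (subst indep_var_lebesgue_integral) (auto simp: comp_def integrable_power_of_power4)
qed

text \<open>By induction on the index set. A new independent centred summand kills every cross term
  in which a factor has exponent one, so only 6 E[Y^2] E[S^2] remains between the two fourth
  moments. The 3 is the constant of the Gaussian fourth moment.\<close>

lemma (in prob_space) indep_sum_moments: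
  fixes Y :: "'i \<Rightarrow> 'a \<Rightarrow> real"
  assumes "finite J" and "indep_vars (\<lambda>_. borel) Y J"
    and "\<And>j. j \<in> J \<Longrightarrow> integrable M (\<lambda>x. Y j x ^ 4)"
    and "\<And>j. j \<in> J \<Longrightarrow> expectation (Y j) = 0"
  shows "expectation (\<lambda>x. \<Sum>j\<in>J. Y j x) = 0"
    and "expectation (\<lambda>x. (\<Sum>j\<in>J. Y j x)\<^sup>2) = (\<Sum>j\<in>J. expectation (\<lambda>x. (Y j x)\<^sup>2))" (is "?two J")
    and "expectation (\<lambda>x. (\<Sum>j\<in>J. Y j x) ^ 4)
           \<le> 3 * (\<Sum>j\<in>J. expectation (\<lambda>x. (Y j x)\<^sup>2))\<^sup>2 + (\<Sum>j\<in>J. expectation (\<lambda>x. Y j x ^ 4))" (is "?four J")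
proof -
  have Y: "Y j \<in> borel_measurable M" if "j \<in> J" for j
    using assms(2) that by (auto simp: indep_vars_def2)
  have "integrable M (Y j)" if "j \<in> J" for j
    using integrable_power_of_power4[OF Y assms(3), of j 1] that by simp
  then show z: "expectation (\<lambda>x. \<Sum>j\<in>J. Y j x) = 0"
    using assms by (subst Bochner_Integration.integral_sum) auto
  have "expectation (\<lambda>x. \<Sum>j\<in>J. Y j x) = 0 \<and> ?two J \<and> ?four J"
    using assms Y
  proof (induction J rule: finite_induct)
    case empty
    then show ?case by simp
  next
    case (insert i J)
    let ?S = "\<lambda>x. \<Sum>j\<in>J. Y j x"
    have ind: "indep_var borel (Y i) borel ?S"
      by (rule indep_vars_sum) (use insert in auto)
    have IH: "expectation ?S = 0" "?two J" "?four J"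
      using insert indep_vars_subset[of _ Y "insert i J" J] by (auto simp: subset_insertI)
    have [measurable]: "Y i \<in> borel_measurable M" "?S \<in> borel_measurable M"
      using insert by auto
    have Y4: "integrable M (\<lambda>x. Y i x ^ 4)" and S4: "integrable M (\<lambda>x. ?S x ^ 4)"
      using insert by (auto intro!: integrable_power4_sum)
    have S1: "integrable M ?S" and Y1: "integrable M (Y i)"
      using integrable_power_of_power4[OF _ S4, of 1] integrable_power_of_power4[OF _ Y4, of 1] by auto
    have P: "integrable M (\<lambda>x. Y i x ^ k * ?S x ^ l)" if "k + l \<le> 4" for k l
      using that Y4 S4 by (intro integrable_prod_of_power4) auto
    have E: "expectation (\<lambda>x. Y i x ^ k * ?S x ^ l) = expectation (\<lambda>x. Y i x ^ k) * expectation (\<lambda>x. ?S x ^ l)"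
      if "k \<le> 4" "l \<le> 4" for k l
      using that Y4 S4 by (intro indep_var_integral_powers ind) auto
    have Y0: "expectation (Y i) = 0" using insert by auto
    have "expectation (\<lambda>x. (\<Sum>j\<in>insert i J. Y j x)\<^sup>2)
        = expectation (\<lambda>x. Y i x ^ 2 * ?S x ^ 0 + 2 * (Y i x ^ 1 * ?S x ^ 1) + Y i x ^ 0 * ?S x ^ 2)"
      using insert by (intro Bochner_Integration.integral_cong) (auto simp: power2_sum)
    also have "\<dots> = expectation (\<lambda>x. Y i x ^ 2) + expectation (\<lambda>x. ?S x ^ 2)"
      using P[of 2 0] P[of 1 1] P[of 0 2] E[of 1 1] IH(1)
      by (simp add: Bochner_Integration.integral_add)
    finally have two: "?two (insert i J)" using IH insert by simp
    have "expectation (\<lambda>x. (\<Sum>j\<in>insert i J. Y j x) ^ 4)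
        = expectation (\<lambda>x. Y i x ^ 4 * ?S x ^ 0 + 4 * (Y i x ^ 3 * ?S x ^ 1) + 6 * (Y i x ^ 2 * ?S x ^ 2)
            + 4 * (Y i x ^ 1 * ?S x ^ 3) + Y i x ^ 0 * ?S x ^ 4)"
      using insert by (intro Bochner_Integration.integral_cong)
        (auto simp: power4_eq_xxxx power2_eq_square power3_eq_cube algebra_simps)
    also have "\<dots> = expectation (\<lambda>x. Y i x ^ 4) + 6 * (expectation (\<lambda>x. Y i x ^ 2) * expectation (\<lambda>x. ?S x ^ 2))
         + expectation (\<lambda>x. ?S x ^ 4)"
      using P[of 4 0] P[of 3 1] P[of 2 2] P[of 1 3] P[of 0 4] E[of 3 1] E[of 2 2] E[of 1 3] IH(1) Y0
      by (simp add: Bochner_Integration.integral_add)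
    also have "\<dots> \<le> expectation (\<lambda>x. Y i x ^ 4) + 6 * (expectation (\<lambda>x. Y i x ^ 2) * (\<Sum>j\<in>J. expectation (\<lambda>x. (Y j x)\<^sup>2)))
         + (3 * (\<Sum>j\<in>J. expectation (\<lambda>x. (Y j x)\<^sup>2))\<^sup>2 + (\<Sum>j\<in>J. expectation (\<lambda>x. Y j x ^ 4)))"
      using IH by simp
    \<comment> \<open>With a the new variance and b the sum of the old ones, 6 a b + 3 b^2 <= 3 (a +
      b)^2; the slack is 3 a^2.\<close>
    also have "\<dots> \<le> 3 * (expectation (\<lambda>x. Y i x ^ 2) + (\<Sum>j\<in>J. expectation (\<lambda>x. (Y j x)\<^sup>2)))\<^sup>2
       + (expectation (\<lambda>x. Y i x ^ 4) + (\<Sum>j\<in>J. expectation (\<lambda>x. Y j x ^ 4)))"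
      by (simp add: power2_eq_square algebra_simps)
    finally have four: "?four (insert i J)" using insert by simp
    have "expectation (\<lambda>x. \<Sum>j\<in>insert i J. Y j x) = 0"
      using insert S1 Y1 IH(1) Y0 by simp
    with two four show ?case by simp
  qed
  then show "?two J" "?four J" by auto
qed

text \<open>The Cauchy-Schwarz inequality, carried over from nonnegative integrals once the product
  is known to be integrable.\<close>

lemma (in prob_space) expectation_abs_mult_le:
  fixes Y Z :: "'a \<Rightarrow> real"
  assumes [measurable]: "Y \<in> borel_measurable M" "Z \<in> borel_measurable M"
    and Y: "integrable M (\<lambda>x. (Y x)\<^sup>2)" and Z: "integrable M (\<lambda>x. (Z x)\<^sup>2)"
  shows "integrable M (\<lambda>x. Y x * Z x)"
    and "expectation (\<lambda>x. \<bar>Y x * Z x\<bar>) \<le> sqrt (expectation (\<lambda>x. (Y x)\<^sup>2)) * sqrt (expectation (\<lambda>x. (Z x)\<^sup>2))"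
proof -
  have "integrable M (\<lambda>x. (Y x)\<^sup>2 + (Z x)\<^sup>2)" using Y Z by auto
  then show I: "integrable M (\<lambda>x. Y x * Z x)"
  proof (rule Bochner_Integration.integrable_bound)
    have "\<bar>y * z\<bar> \<le> y\<^sup>2 + z\<^sup>2" for y z :: real
      using sum_squares_bound[of "\<bar>y\<bar>" "\<bar>z\<bar>"] abs_ge_zero[of "y * z"]
      unfolding abs_mult power2_abs mult.assoc by linarith
    then show "AE x in M. norm (Y x * Z x) \<le> norm ((Y x)\<^sup>2 + (Z x)\<^sup>2)"
      by (auto intro: order_trans[OF _ abs_ge_self])
  qed simp
  have "(\<integral>\<^sup>+x. ennreal \<bar>Y x\<bar> * ennreal \<bar>Z x\<bar> \<partial>M)\<^sup>2 \<le> (\<integral>\<^sup>+x. (ennreal \<bar>Y x\<bar>)\<^sup>2 \<partial>M) * (\<integral>\<^sup>+x. (ennreal \<bar>Z x\<bar>)\<^sup>2 \<partial>M)"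
    by (rule Cauchy_Schwarz_nn_integral) auto
  moreover have "(\<integral>\<^sup>+x. ennreal \<bar>Y x\<bar> * ennreal \<bar>Z x\<bar> \<partial>M) = ennreal (expectation (\<lambda>x. \<bar>Y x * Z x\<bar>))"
    using integrable_abs[OF I] by (subst nn_integral_eq_integral[symmetric]) (auto simp: abs_mult ennreal_mult)
  ultimately have "(ennreal (expectation (\<lambda>x. \<bar>Y x * Z x\<bar>)))\<^sup>2 \<le> ennreal (expectation (\<lambda>x. (Y x)\<^sup>2)) * ennreal (expectation (\<lambda>x. (Z x)\<^sup>2))"
    using Y Z by (simp add: ennreal_power nn_integral_eq_integral)
  then have "(expectation (\<lambda>x. \<bar>Y x * Z x\<bar>))\<^sup>2 \<le> expectation (\<lambda>x. (Y x)\<^sup>2) * expectation (\<lambda>x. (Z x)\<^sup>2)"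
    by (simp add: ennreal_power flip: ennreal_mult)
  then show "expectation (\<lambda>x. \<bar>Y x * Z x\<bar>) \<le> sqrt (expectation (\<lambda>x. (Y x)\<^sup>2)) * sqrt (expectation (\<lambda>x. (Z x)\<^sup>2))"
    unfolding real_sqrt_mult[symmetric] by (rule real_le_rsqrt)
qed

lemma (in prob_space) expectation_abs_le_sqrt:
  fixes Y :: "'a \<Rightarrow> real"
  assumes "Y \<in> borel_measurable M" "integrable M (\<lambda>x. (Y x)\<^sup>2)"
  shows "integrable M Y" and "expectation (\<lambda>x. \<bar>Y x\<bar>) \<le> sqrt (expectation (\<lambda>x. (Y x)\<^sup>2))"
  using expectation_abs_mult_le[of Y "\<lambda>_. 1"] assms by (auto simp: prob_space)


text \<open>A single Gaussian exchange. \<open>\<tau>\<close> is kept apart from the second moment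
  because a random conditional variance will be compared with its mean. The weight
  \<open>\<delta>\<close> stays free: it will be a small constant for the quadratic form and a null
  sequence for the sum of the errors.\<close>

lemma (in prob_space) iexp_expectation_gaussian_approx:
  fixes Z :: "'a \<Rightarrow> real"
  assumes [measurable]: "Z \<in> borel_measurable M"
    and Z4: "integrable M (\<lambda>x. Z x ^ 4)" and Z0: "expectation Z = 0" and "0 \<le> \<tau>" "0 < \<delta>"
  shows "cmod (expectation (\<lambda>x. iexp (Z x)) - complex_of_real (exp (- \<tau> / 2)))
    \<le> \<bar>expectation (\<lambda>x. (Z x)\<^sup>2) - \<tau>\<bar> / 2 + \<tau>\<^sup>2 / 8
       + (\<delta> * expectation (\<lambda>x. (Z x)\<^sup>2) + expectation (\<lambda>x. Z x ^ 4) / \<delta>) / 12"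
proof -
  have Z2: "integrable M (\<lambda>x. (Z x)\<^sup>2)" and Z1: "integrable M Z"
    using integrable_power_of_power4[OF _ Z4, of 2] integrable_power_of_power4[OF _ Z4, of 1] by auto
  have Ie: "integrable M (\<lambda>x. iexp (Z x))"
    by (rule integrable_const_bound[where B=1]) auto
  \<comment> \<open>The Taylor polynomial of degree two; as \<open>Z\<close> is centred, its mean is
    real and involves the second moment alone.\<close>
  define p where "p x = 1 + \<i> * complex_of_real (Z x) - complex_of_real ((Z x)\<^sup>2 / 2)" for x
  have Ip: "integrable M p" unfolding p_def using Z1 Z2 by (auto simp del: of_real_divide of_real_power)
  have Ep: "expectation p = complex_of_real (1 - expectation (\<lambda>x. (Z x)\<^sup>2) / 2)"
    unfolding p_def using Z1 Z2 Z0 by (simp add: prob_space del: of_real_divide of_real_power)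
  have pt: "cmod (iexp (Z x) - p x) \<le> (\<delta> * (Z x)\<^sup>2 + Z x ^ 4 / \<delta>) / 12" for x
  proof -
    have "cmod (iexp (Z x) - p x) = cmod (iexp (Z x) - (\<Sum>k \<le> 2. (\<i> * Z x)^k / fact k))"
      by (simp add: p_def atMost_nat_numeral power2_eq_square fact_numeral algebra_simps)
    also have "\<dots> \<le> \<bar>Z x\<bar> ^ 3 / 6" using iexp_approx1[of "Z x" 2] by (simp add: fact_numeral numeral_3_eq_3)
    \<comment> \<open>AM-GM trades the third moment for the second and the fourth, which are computed exactly.\<close>
    also have "\<bar>Z x\<bar> ^ 3 \<le> (\<delta> * (Z x)\<^sup>2 + Z x ^ 4 / \<delta>) / 2"
    proof -
      have "0 \<le> (Z x)\<^sup>2 * (\<delta> - \<bar>Z x\<bar>)\<^sup>2 / \<delta>" using \<open>0 < \<delta>\<close> by simp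
      also have "\<dots> = \<delta> * (Z x)\<^sup>2 - 2 * \<bar>Z x\<bar> ^ 3 + Z x ^ 4 / \<delta>"
        using \<open>0 < \<delta>\<close> by (simp add: field_simps power2_eq_square power3_eq_cube power4_eq_xxxx)
      finally show ?thesis by simp
    qed
    finally show ?thesis by simp
  qed
  have "cmod (expectation (\<lambda>x. iexp (Z x)) - expectation p) = cmod (expectation (\<lambda>x. iexp (Z x) - p x))"
    using Ie Ip by simp
  also have "\<dots> \<le> expectation (\<lambda>x. (\<delta> * (Z x)\<^sup>2 + Z x ^ 4 / \<delta>) / 12)"
    using Ie Ip Z2 Z4 pt
    by (intro order_trans[OF integral_norm_bound] integral_mono) (auto intro!: Bochner_Integration.integrable_diff)
  also have "\<dots> = (\<delta> * expectation (\<lambda>x. (Z x)\<^sup>2) + expectation (\<lambda>x. Z x ^ 4) / \<delta>) / 12"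
    using Z2 Z4 by simp
  finally have 1: "cmod (expectation (\<lambda>x. iexp (Z x)) - expectation p) \<le> \<dots>" .
  have "exp (- \<tau> / 2) \<le> 1 - \<tau> / 2 + \<tau>\<^sup>2 / 8" "1 - \<tau> / 2 \<le> exp (- \<tau> / 2)"
  proof -
    show "1 - \<tau> / 2 \<le> exp (- \<tau> / 2)" using exp_ge_add_one_self[of "- \<tau> / 2"] by simp
    \<comment> \<open>The third-order Lagrange remainder is nonpositive for x >= 0, which gives the
      upper bound.\<close>
    have "exp (- x) \<le> 1 - x + x\<^sup>2 / 2" if "0 \<le> x" for x :: real
    proof -
      have "\<exists>t. \<bar>t\<bar> \<le> \<bar>- x\<bar> \<and> exp (- x) = (\<Sum>m<3. (- x) ^ m / fact m) + exp t / fact 3 * (- x) ^ 3"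
        by (rule Maclaurin_exp_le)
      then obtain t where "exp (- x) = (\<Sum>m<3. (- x) ^ m / fact m) + exp t / fact 3 * (- x) ^ 3" by blast
      then have "exp (- x) = 1 - x + x\<^sup>2 / 2 - exp t / 6 * x ^ 3"
        by (simp add: numeral_3_eq_3 fact_numeral power2_eq_square)
      moreover have "0 \<le> exp t / 6 * x ^ 3" using that by simp
      ultimately show ?thesis by linarith
    qed
    from this[of "\<tau> / 2"] show "exp (- \<tau> / 2) \<le> 1 - \<tau> / 2 + \<tau>\<^sup>2 / 8" using \<open>0 \<le> \<tau>\<close>
      by (simp add: power_divide)
  qed
  then have "\<bar>1 - expectation (\<lambda>x. (Z x)\<^sup>2) / 2 - exp (- \<tau> / 2)\<bar> \<le> \<bar>expectation (\<lambda>x. (Z x)\<^sup>2) - \<tau>\<bar> / 2 + \<tau>\<^sup>2 / 8"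
    by (auto simp: abs_if field_simps)
  then have 2: "cmod (expectation p - complex_of_real (exp (- \<tau> / 2))) \<le> \<bar>expectation (\<lambda>x. (Z x)\<^sup>2) - \<tau>\<bar> / 2 + \<tau>\<^sup>2 / 8"
    unfolding Ep of_real_diff[symmetric] norm_of_real by simp
  have "cmod (expectation (\<lambda>x. iexp (Z x)) - complex_of_real (exp (- \<tau> / 2)))
      \<le> cmod (expectation (\<lambda>x. iexp (Z x)) - expectation p) + cmod (expectation p - complex_of_real (exp (- \<tau> / 2)))"
    using norm_triangle_ineq[of "expectation (\<lambda>x. iexp (Z x)) - expectation p" "expectation p - complex_of_real (exp (- \<tau> / 2))"]
    by simp
  with 1 2 show ?thesis by linarith
qed

section \<open>Degenerate quadratic forms with deterministic weights\<close>

text \<open>Times the next weight, this is the increment of the quadratic form when a design point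
  \<open>y\<close> is appended to \<open>x\<close>.\<close>

definition lin_form :: "(real \<Rightarrow> real \<Rightarrow> real) \<Rightarrow> (nat \<Rightarrow> real) \<Rightarrow> nat \<Rightarrow> (nat \<Rightarrow> real) \<Rightarrow> real \<Rightarrow> real" where
  "lin_form H w n x y = (\<Sum>s\<in>{1..n}. w s * H (x s) y)"

definition quad_form :: "(real \<Rightarrow> real \<Rightarrow> real) \<Rightarrow> (nat \<Rightarrow> real) \<Rightarrow> nat \<Rightarrow> (nat \<Rightarrow> real) \<Rightarrow> real" where
  "quad_form H w n x = (\<Sum>t\<in>{1..n}. w t * (\<Sum>s\<in>{1..<t}. w s * H (x s) (x t)))"

text \<open>The second elementary symmetric polynomial of the squared weights: the variance of
  \<open>quad_form\<close> per unit of kernel variance.\<close>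

definition pair_sum :: "(nat \<Rightarrow> real) \<Rightarrow> nat \<Rightarrow> real" where
  "pair_sum w n = (\<Sum>t\<in>{1..n}. (w t)\<^sup>2 * (\<Sum>s\<in>{1..<t}. (w s)\<^sup>2))"

lemma quad_form_cong: "(\<And>t. t \<in> {1..n} \<Longrightarrow> x t = y t) \<Longrightarrow> quad_form H w n x = quad_form H w n y"
  unfolding quad_form_def by (intro sum.cong refl arg_cong2[where f="(*)"]) auto

lemma quad_form_Suc: "quad_form H w (Suc n) (x(Suc n := y)) = quad_form H w n x + w (Suc n) * lin_form H w n x y"
proof -
  have "quad_form H w n (x(Suc n := y)) = quad_form H w n x" by (rule quad_form_cong) auto
  then show ?thesis
    by (simp add: quad_form_def lin_form_def atLeastLessThanSuc_atLeastAtMost)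
qed

lemma pair_sum_Suc: "pair_sum w (Suc n) = pair_sum w n + (w (Suc n))\<^sup>2 * (\<Sum>s\<in>{1..n}. (w s)\<^sup>2)"
  by (simp add: pair_sum_def atLeastLessThanSuc_atLeastAtMost)

text \<open>Newton's identity. It reduces the Gaussian exponent to the sum of squares, which obeys a
  law of large numbers, and a sum of fourth powers of lower order.\<close>

lemma pair_sum_eq: "2 * pair_sum w n = (\<Sum>t\<in>{1..n}. (w t)\<^sup>2)\<^sup>2 - (\<Sum>t\<in>{1..n}. w t ^ 4)"
  by (induction n) (simp_all add: pair_sum_Suc pair_sum_def[of w 0] power2_eq_square power4_eq_xxxx algebra_simps)

lemma pair_sum_le: "pair_sum w n \<le> (\<Sum>t\<in>{1..n}. (w t)\<^sup>2)\<^sup>2"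
proof -
  have "0 \<le> (\<Sum>t\<in>{1..n}. w t ^ 4)" by (intro sum_nonneg) auto
  with pair_sum_eq[of w n] show ?thesis using zero_le_power2[of "\<Sum>t\<in>{1..n}. (w t)\<^sup>2"] by linarith
qed

text \<open>Applied to two kernels: to \<open>gram\<close>, after squaring a linear form, and to the
  degenerate kernel inside the double sum over the errors.\<close>

lemma sum_square_quad_form:
  assumes "\<And>x y. G x y = G y x"
  shows "(\<Sum>s\<in>{1..n}. \<Sum>t\<in>{1..n}. w s * w t * G (x s) (x t))
       = (\<Sum>s\<in>{1..n}. (w s)\<^sup>2 * G (x s) (x s)) + 2 * quad_form G w n x"
proof (induction n)
  case 0
  then show ?case by (simp add: quad_form_def)
next
  case (Suc n)
  have row: "(\<Sum>t\<in>{1..n}. w (Suc n) * w t * G (x (Suc n)) (x t)) = w (Suc n) * lin_form G w n x (x (Suc n))"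
    unfolding lin_form_def sum_distrib_left by (intro sum.cong refl) (subst assms, simp)
  have col: "(\<Sum>t\<in>{1..n}. w t * w (Suc n) * G (x t) (x (Suc n))) = w (Suc n) * lin_form G w n x (x (Suc n))"
    unfolding lin_form_def sum_distrib_left by (intro sum.cong refl) simp
  have "(\<Sum>s\<in>{1..Suc n}. \<Sum>t\<in>{1..Suc n}. w s * w t * G (x s) (x t))
     = (\<Sum>s\<in>{1..n}. \<Sum>t\<in>{1..n}. w s * w t * G (x s) (x t))
      + 2 * w (Suc n) * lin_form G w n x (x (Suc n)) + (w (Suc n))\<^sup>2 * G (x (Suc n)) (x (Suc n))"
    using row col by (simp add: sum.distrib power2_eq_square)
  moreover have "quad_form G w (Suc n) x = quad_form G w n x + w (Suc n) * lin_form G w n x (x (Suc n))"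
    using quad_form_Suc[of G w n x "x (Suc n)"] by simp
  ultimately show ?case using Suc by (simp add: algebra_simps)
qed

section \<open>Finite products of the design law\<close>

context real_distribution
begin

abbreviation iid :: "nat \<Rightarrow> (nat \<Rightarrow> real) measure" where
  "iid n \<equiv> PiM {1..n} (\<lambda>_. M)"

lemma prob_UNIV: "prob UNIV = 1"
  using prob_space by simp

lemma prob_space_iid: "prob_space (iid n)"
  by (intro prob_space_PiM) (rule prob_space_axioms)

text \<open>The inner integral is the conditional expectation given the first n points. This peeling
  of the last coordinate plays the part of a filtration in the martingale argument.\<close>

lemma integral_iid_Suc:
  fixes f :: "_ \<Rightarrow> _::{banach, second_countable_topology}"
  assumes "integrable (iid (Suc n)) f"
  shows "integral\<^sup>L (iid (Suc n)) f = (\<integral>x. (\<integral>y. f (x(Suc n := y)) \<partial>M) \<partial>iid n)"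
proof -
  interpret product_sigma_finite "\<lambda>_::nat. M" by standard
  have "{1..Suc n} = insert (Suc n) {1..n}" by auto
  then show ?thesis using product_integral_insert[of "{1..n}" "Suc n" f] assms by simp
qed

lemma integral_iid_component:
  fixes f :: "_ \<Rightarrow> _::{banach, second_countable_topology}"
  assumes "s \<in> {1..n}" and [measurable]: "f \<in> borel_measurable borel"
  shows "(\<integral>x. f (x s) \<partial>iid n) = integral\<^sup>L M f"
proof -
  have "integral\<^sup>L M f = integral\<^sup>L (distr (iid n) M (\<lambda>x. x s)) f"
    using assms by (subst distr_PiM_component) (auto intro: prob_space_axioms)
  also have "\<dots> = (\<integral>x. f (x s) \<partial>iid n)"
    using assms by (subst integral_distr) auto
  finally show ?thesis ..
qed

lemma indep_vars_iid:
  assumes g: "\<And>s. s \<in> {1..n} \<Longrightarrow> g s \<in> borel_measurable borel"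
  shows "prob_space.indep_vars (iid n) (\<lambda>_. borel) (\<lambda>s x. g s (x s)) {1..n}"
proof -
  interpret P: prob_space "iid n" by (rule prob_space_iid)
  have "P.indep_vars (\<lambda>_. M) (\<lambda>s x. x s) {1..n}"
  \<comment> \<open>The characterisation of independence by the product law asks for a nonempty
    index set; over the empty one independence is vacuous.\<close>
  proof (cases "n = 0")
    case True
    then have "{1..n} = {}" by simp
    then show ?thesis unfolding P.indep_vars_def P.indep_sets_def by simp
  next
    case False
    have "(\<Pi>\<^sub>M i\<in>{1..n}. distr (iid n) M (\<lambda>x. x i)) = iid n"
      by (intro PiM_cong refl distr_PiM_component) (auto intro: prob_space_axioms)
    moreover have "distr (iid n) (iid n) (\<lambda>x. \<lambda>i\<in>{1..n}. x i) = distr (iid n) (iid n) (\<lambda>x. x)"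
      by (intro distr_cong) (auto simp: space_PiM PiE_def extensional_def restrict_def fun_eq_iff)
    ultimately show ?thesis
      using False by (subst P.indep_vars_iff_distr_eq_PiM') (auto simp: distr_id2)
  qed
  then show ?thesis
    by (rule P.indep_vars_compose2) (use g in auto)
qed

end

text \<open>The constants carry the bandwidth: for the smoothing kernel \<open>C\<close> stays fixed
  while \<open>D\<close> is proportional to h. Bounds are kept as explicit monomials in
  \<open>C\<close> and \<open>D\<close>, and the exponent of \<open>D\<close> tells which of them
  are negligible.\<close>

locale degenerate_kernel = real_distribution F for F :: "real measure" +
  fixes H :: "real \<Rightarrow> real \<Rightarrow> real" and C D :: real
  assumes H_meas[measurable]: "(\<lambda>(x, y). H x y) \<in> borel_measurable (borel \<Otimes>\<^sub>M borel)"
    and H_sym: "H x y = H y x" and H_bdd: "\<bar>H x y\<bar> \<le> C"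
    and H_L1: "(\<integral>y. \<bar>H x y\<bar> \<partial>F) \<le> D"
    and H_deg: "(\<integral>y. H x y \<partial>F) = 0"
begin

lemma C_nonneg: "0 \<le> C"
  using H_bdd[of 0 0] by simp

lemma D_nonneg: "0 \<le> D"
  by (rule order_trans[OF Bochner_Integration.integral_nonneg H_L1[of 0]]) simp

lemma H_meas1[measurable]: "H x \<in> borel_measurable borel"
  by measurable

lemma H_meas2[measurable]: "f \<in> borel_measurable N \<Longrightarrow> g \<in> borel_measurable N \<Longrightarrow> (\<lambda>x. H (f x) (g x)) \<in> borel_measurable N"
  by measurable

lemma integrable_bounded:
  fixes f :: "'c \<Rightarrow> 'd::{banach,second_countable_topology}"
  assumes "prob_space N" "f \<in> borel_measurable N" "\<And>x. norm (f x) \<le> B"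
  shows "integrable N f"
proof -
  interpret N: prob_space N by fact
  show ?thesis using assms by (intro N.integrable_const_bound[where B=B]) auto
qed

lemma integrable_H: "integrable F (H x)"
  by (rule integrable_bounded[where B=C]) (use H_bdd prob_space_axioms in auto)

text \<open>Boundedness turns all but one power of |H| into factors \<open>C\<close>, so every
  moment keeps exactly one factor \<open>D\<close>.\<close>

lemma H_power_L1:
  "(\<integral>y. (H x y)\<^sup>2 \<partial>F) \<le> C * D" "(\<integral>y. (H x y) ^ 4 \<partial>F) \<le> C ^ 3 * D"
proof -
  have "\<bar>H x y\<bar> ^ Suc k \<le> C ^ k * \<bar>H x y\<bar>" for k y
    using power_mono[OF H_bdd[of x y], of k] by (simp add: mult.commute[of "C ^ k"] mult_left_mono)
  then have *: "(\<integral>y. \<bar>H x y\<bar> ^ Suc k \<partial>F) \<le> C ^ k * D" for k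
  proof -
    have "(\<integral>y. \<bar>H x y\<bar> ^ Suc k \<partial>F) \<le> (\<integral>y. C ^ k * \<bar>H x y\<bar> \<partial>F)"
    proof (rule integral_mono)
      show "integrable F (\<lambda>y. \<bar>H x y\<bar> ^ Suc k)"
        by (rule integrable_bounded[where B="C ^ Suc k"])
           (use H_bdd prob_space_axioms in \<open>auto simp del: power_Suc intro!: power_mono\<close>)
      show "\<bar>H x y\<bar> ^ Suc k \<le> C ^ k * \<bar>H x y\<bar>" for y by fact
    qed (use integrable_H in auto)
    also have "\<dots> \<le> C ^ k * D" using H_L1 C_nonneg by (simp add: mult_left_mono)
    finally show ?thesis .
  qed
  show "(\<integral>y. (H x y)\<^sup>2 \<partial>F) \<le> C * D" "(\<integral>y. (H x y) ^ 4 \<partial>F) \<le> C ^ 3 * D"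
    using *[of 1] *[of 3] by (simp_all add: power_even_abs flip: numeral_2_eq_2 numeral_eq_Suc)
qed

lemma lin_form_meas[measurable]:
  "(\<lambda>(x, y). lin_form H w n x y) \<in> borel_measurable (iid n \<Otimes>\<^sub>M F)"
  unfolding lin_form_def by measurable

lemma lin_form_meas1[measurable]: "(\<lambda>x. lin_form H w n x y) \<in> borel_measurable (iid n)"
  unfolding lin_form_def by measurable

lemma lin_form_meas2[measurable]: "lin_form H w n x \<in> borel_measurable F"
  unfolding lin_form_def by measurable

lemma quad_form_meas[measurable]: "quad_form H w n \<in> borel_measurable (iid n)"
  unfolding quad_form_def by measurable

lemma lin_form_bdd: "\<bar>lin_form H w n x y\<bar> \<le> (\<Sum>s\<in>{1..n}. \<bar>w s\<bar>) * C"
  unfolding lin_form_def sum_distrib_right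
  by (intro order_trans[OF sum_abs] sum_mono) (auto simp: abs_mult intro!: mult_left_mono H_bdd)

lemma quad_form_bdd: "\<bar>quad_form H w n x\<bar> \<le> (\<Sum>t\<in>{1..n}. \<bar>w t\<bar> * ((\<Sum>s\<in>{1..<t}. \<bar>w s\<bar>) * C))"
  unfolding quad_form_def sum_distrib_right
  by (intro order_trans[OF sum_abs] sum_mono)
    (auto simp: abs_mult intro!: mult_left_mono H_bdd order_trans[OF sum_abs] sum_mono)

text \<open>Here \<open>y\<close> is frozen and the design is random, which makes the form a sum of
  independent centred terms by degeneracy of the kernel.\<close>

lemma lin_form_moments:
  "(\<integral>x. (lin_form H w n x y)\<^sup>2 \<partial>iid n) = (\<Sum>s\<in>{1..n}. (w s)\<^sup>2) * (\<integral>x. (H y x)\<^sup>2 \<partial>F)" (is ?A)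
  "(\<integral>x. (lin_form H w n x y) ^ 4 \<partial>iid n)
     \<le> 3 * ((\<Sum>s\<in>{1..n}. (w s)\<^sup>2) * (C * D))\<^sup>2 + (\<Sum>s\<in>{1..n}. w s ^ 4) * (C ^ 3 * D)" (is ?B)
proof -
  interpret P: prob_space "iid n" by (rule prob_space_iid)
  let ?Y = "\<lambda>s x. w s * H y (x s)"
  have lin: "lin_form H w n x y = (\<Sum>s\<in>{1..n}. ?Y s x)" for x
    unfolding lin_form_def by (simp add: H_sym)
  have ind: "P.indep_vars (\<lambda>_. borel) ?Y {1..n}"
    by (rule indep_vars_iid) measurable
  have I4: "integrable (iid n) (\<lambda>x. ?Y s x ^ 4)" if "s \<in> {1..n}" for s
  proof (rule integrable_bounded[where B="(\<bar>w s\<bar> * C) ^ 4"])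
    show "norm (?Y s x ^ 4) \<le> (\<bar>w s\<bar> * C) ^ 4" for x
      unfolding norm_power by (intro power_mono) (auto simp: abs_mult intro!: mult_left_mono H_bdd)
  qed (use that prob_space_iid in auto)
  have E: "(\<integral>x. ?Y s x ^ k \<partial>iid n) = w s ^ k * (\<integral>x. (H y x) ^ k \<partial>F)" if "s \<in> {1..n}" for s k
    using that by (subst integral_iid_component[where f="\<lambda>z. (w s * H y z) ^ k"]) (auto simp: power_mult_distrib)
  have E0: "(\<integral>x. ?Y s x \<partial>iid n) = 0" if "s \<in> {1..n}" for s
    using E[OF that, of 1] H_deg by simp
  note M = P.indep_sum_moments[OF _ ind I4 E0]
  show ?A unfolding lin using M(2) E[of _ 2] by (simp add: sum_distrib_right)
  have "(\<integral>x. (lin_form H w n x y) ^ 4 \<partial>iid n)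
     \<le> 3 * ((\<Sum>s\<in>{1..n}. (w s)\<^sup>2) * (\<integral>x. (H y x)\<^sup>2 \<partial>F))\<^sup>2 + (\<Sum>s\<in>{1..n}. w s ^ 4) * (\<integral>x. (H y x) ^ 4 \<partial>F)"
    unfolding lin using M(3) E[of _ 2] E[of _ 4] by (simp add: sum_distrib_right)
  also have "\<dots> \<le> 3 * ((\<Sum>s\<in>{1..n}. (w s)\<^sup>2) * (C * D))\<^sup>2 + (\<Sum>s\<in>{1..n}. w s ^ 4) * (C ^ 3 * D)"
    by (intro add_mono mult_left_mono power_mono H_power_L1) (auto intro!: sum_nonneg mult_nonneg_nonneg)
  finally show ?B .
qed


section \<open>Moments of the increments and of the quadratic form\<close>

definition kernel_var :: real where
  "kernel_var = (\<integral>x. (\<integral>y. (H x y)\<^sup>2 \<partial>F) \<partial>F)"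

lemma kernel_var_bounds: "0 \<le> kernel_var" "kernel_var \<le> C * D"
proof -
  show "0 \<le> kernel_var" unfolding kernel_var_def by (intro Bochner_Integration.integral_nonneg) auto
  have "kernel_var \<le> (\<integral>x. C * D \<partial>F)" unfolding kernel_var_def
  proof (rule integral_mono)
    show "integrable F (\<lambda>x. \<integral>y. (H x y)\<^sup>2 \<partial>F)"
      by (rule integrable_bounded[where B="C * D"])
         (use prob_space_axioms H_power_L1(1) in \<open>auto simp: Bochner_Integration.integral_nonneg\<close>)
  qed (use H_power_L1(1) in auto)
  then show "kernel_var \<le> C * D" by (simp add: prob_UNIV)
qed

lemma lin_form_mean: "(\<integral>y. lin_form H w n x y \<partial>F) = 0"
  unfolding lin_form_def using integrable_H H_deg by (simp add: Bochner_Integration.integral_sum)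

lemma integrable_lin_form:
  "integrable F (\<lambda>y. lin_form H w n x y)" "integrable F (\<lambda>y. (lin_form H w n x y) ^ k)"
proof -
  show *: "integrable F (\<lambda>y. (lin_form H w n x y) ^ k)" for k
  proof (rule integrable_bounded[OF prob_space_axioms])
    show "norm (lin_form H w n x y ^ k) \<le> ((\<Sum>s\<in>{1..n}. \<bar>w s\<bar>) * C) ^ k" for y
      unfolding real_norm_def power_abs by (intro power_mono lin_form_bdd abs_ge_zero)
  qed measurable
  from *[of 1] show "integrable F (\<lambda>y. lin_form H w n x y)" by simp
qed

lemma integrable_iid_lin_form_power: "integrable (iid n) (\<lambda>x. \<integral>y. (lin_form H w n x y) ^ k \<partial>F)"
proof (rule integrable_bounded[OF prob_space_iid])
  show "norm (\<integral>y. (lin_form H w n x y) ^ k \<partial>F) \<le> ((\<Sum>s\<in>{1..n}. \<bar>w s\<bar>) * C) ^ k" for x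
  proof -
    have "norm (\<integral>y. (lin_form H w n x y) ^ k \<partial>F) \<le> (\<integral>y. ((\<Sum>s\<in>{1..n}. \<bar>w s\<bar>) * C) ^ k \<partial>F)"
      by (intro order_trans[OF integral_norm_bound] integral_mono integrable_norm integrable_lin_form)
         (auto simp: power_abs simp del: One_nat_def intro!: power_mono lin_form_bdd)
    then show ?thesis by (simp add: prob_UNIV)
  qed
qed measurable

text \<open>The exchange step integrates over the new point first, whereas independence of the
  summands holds for a fixed new point; Fubini joins the two views.\<close>

lemma lin_form_swap:
  "(\<integral>x. (\<integral>y. (lin_form H w n x y) ^ k \<partial>F) \<partial>iid n) = (\<integral>y. (\<integral>x. (lin_form H w n x y) ^ k \<partial>iid n) \<partial>F)"
proof -
  interpret P: prob_space "iid n" by (rule prob_space_iid)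
  interpret PF: pair_prob_space "iid n" F ..
  have "integrable (iid n \<Otimes>\<^sub>M F) (\<lambda>(x, y). (lin_form H w n x y) ^ k)"
  proof (rule integrable_bounded[OF PF.prob_space_axioms])
    show "norm ((\<lambda>(x, y). (lin_form H w n x y) ^ k) z) \<le> ((\<Sum>s\<in>{1..n}. \<bar>w s\<bar>) * C) ^ k" for z
      by (cases z) (auto simp: power_abs simp del: One_nat_def intro!: power_mono lin_form_bdd)
  qed measurable
  from PF.Fubini_integral[OF this] show ?thesis by simp
qed

lemma lin_form_second_moment:
  "(\<integral>x. (\<integral>y. (lin_form H w n x y)\<^sup>2 \<partial>F) \<partial>iid n) = (\<Sum>s\<in>{1..n}. (w s)\<^sup>2) * kernel_var"
  unfolding lin_form_swap lin_form_moments(1) kernel_var_def by simp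

lemma lin_form_fourth_moment:
  "(\<integral>x. (\<integral>y. (lin_form H w n x y) ^ 4 \<partial>F) \<partial>iid n)
     \<le> 3 * ((\<Sum>s\<in>{1..n}. (w s)\<^sup>2) * (C * D))\<^sup>2 + (\<Sum>s\<in>{1..n}. w s ^ 4) * (C ^ 3 * D)" (is "_ \<le> ?b")
proof -
  have "(\<integral>y. (\<integral>x. (lin_form H w n x y) ^ 4 \<partial>iid n) \<partial>F) \<le> (\<integral>y. ?b \<partial>F)"
  proof (rule integral_mono)
    interpret P: prob_space "iid n" by (rule prob_space_iid)
    show "integrable F (\<lambda>y. \<integral>x. (lin_form H w n x y) ^ 4 \<partial>iid n)"
    proof (rule integrable_bounded[OF prob_space_axioms])
      have "0 \<le> (\<integral>x. (lin_form H w n x y) ^ 4 \<partial>iid n)" for y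
        by (intro Bochner_Integration.integral_nonneg) auto
      then show "norm (\<integral>x. (lin_form H w n x y) ^ 4 \<partial>iid n) \<le> ?b" for y
        using lin_form_moments(2)[of n w y] by simp
      have [measurable]: "(\<lambda>(y, x). lin_form H w n x y) \<in> borel_measurable (F \<Otimes>\<^sub>M iid n)"
        unfolding lin_form_def by measurable
      show "(\<lambda>y. \<integral>x. (lin_form H w n x y) ^ 4 \<partial>iid n) \<in> borel_measurable F" by measurable
    qed
  qed (use lin_form_moments(2) in auto)
  then show ?thesis unfolding lin_form_swap by (simp add: prob_UNIV)
qed

text \<open>Martingale increments are orthogonal: given the earlier points the increment has mean
  zero, so the cross term of the square drops out. The formula is exact and is used for
  \<open>gram\<close> as well as for \<open>H\<close>.\<close>

lemma quad_form_second_moment: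
  "integrable (iid n) (\<lambda>x. (quad_form H w n x)\<^sup>2)"
  "(\<integral>x. (quad_form H w n x)\<^sup>2 \<partial>iid n) = kernel_var * pair_sum w n"
proof -
  show int: "integrable (iid n) (\<lambda>x. (quad_form H w n x)\<^sup>2)" for n
  proof (rule integrable_bounded[OF prob_space_iid])
    show "norm ((quad_form H w n x)\<^sup>2) \<le> (\<Sum>t\<in>{1..n}. \<bar>w t\<bar> * ((\<Sum>s\<in>{1..<t}. \<bar>w s\<bar>) * C))\<^sup>2" for x
      unfolding real_norm_def power_abs by (intro power_mono quad_form_bdd abs_ge_zero)
  qed measurable
  show "(\<integral>x. (quad_form H w n x)\<^sup>2 \<partial>iid n) = kernel_var * pair_sum w n"
  proof (induction n)
    case 0
    then show ?case by (simp add: quad_form_def pair_sum_def)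
  next
    case (Suc n)
    let ?w = "w (Suc n)"
    have inner: "(\<integral>y. (quad_form H w n x + ?w * lin_form H w n x y)\<^sup>2 \<partial>F)
        = (quad_form H w n x)\<^sup>2 + ?w\<^sup>2 * (\<integral>y. (lin_form H w n x y)\<^sup>2 \<partial>F)" for x
    proof -
      have "(\<integral>y. (quad_form H w n x + ?w * lin_form H w n x y)\<^sup>2 \<partial>F)
         = (\<integral>y. (quad_form H w n x)\<^sup>2 + (2 * quad_form H w n x * ?w * lin_form H w n x y
             + ?w\<^sup>2 * (lin_form H w n x y)\<^sup>2) \<partial>F)"
        by (simp add: power2_sum power_mult_distrib algebra_simps)
      also have "\<dots> = (quad_form H w n x)\<^sup>2 + ?w\<^sup>2 * (\<integral>y. (lin_form H w n x y)\<^sup>2 \<partial>F)"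
        using integrable_lin_form by (simp add: lin_form_mean prob_UNIV)
      finally show ?thesis .
    qed
    have "(\<integral>x. (quad_form H w (Suc n) x)\<^sup>2 \<partial>iid (Suc n))
      = (\<integral>x. (quad_form H w n x)\<^sup>2 + ?w\<^sup>2 * (\<integral>y. (lin_form H w n x y)\<^sup>2 \<partial>F) \<partial>iid n)"
      unfolding integral_iid_Suc[OF int] quad_form_Suc inner ..
    also have "\<dots> = kernel_var * pair_sum w n + ?w\<^sup>2 * ((\<Sum>s\<in>{1..n}. (w s)\<^sup>2) * kernel_var)"
      using int integrable_iid_lin_form_power Suc lin_form_second_moment by simp
    finally show ?case by (simp add: pair_sum_Suc algebra_simps)
  qed
qed

text \<open>The kernel of the square of the integral operator with kernel \<open>H\<close>.\<close>

definition gram :: "real \<Rightarrow> real \<Rightarrow> real" where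
  "gram x y = (\<integral>z. H x z * H y z \<partial>F)"

lemma integrable_HH: "integrable F (\<lambda>z. H x z * H y z)"
proof (rule integrable_bounded[OF prob_space_axioms])
  show "norm (H x z * H y z) \<le> C * C" for z
    by (auto simp: abs_mult intro!: mult_mono H_bdd C_nonneg)
qed measurable

text \<open>
The conditional variances of the martingale increments are again quadratic forms, with kernel
\<open>gram\<close>, so the second moment formula for degenerate forms applies to them as well.
\<close>

lemma gram_kernel: "degenerate_kernel F gram (C * D) (D\<^sup>2)"
proof
  show [measurable]: "(\<lambda>(x, y). gram x y) \<in> borel_measurable (borel \<Otimes>\<^sub>M borel)"
    unfolding gram_def by measurable
  show "gram x y = gram y x" for x y unfolding gram_def by (simp add: mult.commute)
  have abs_gram: "\<bar>gram x y\<bar> \<le> (\<integral>z. \<bar>H x z\<bar> * \<bar>H y z\<bar> \<partial>F)" for x y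
    unfolding gram_def abs_mult[symmetric] by (rule integral_abs_bound)
  have iabs: "integrable F (\<lambda>z. \<bar>H x z\<bar> * \<bar>H y z\<bar>)" for x y
    using integrable_abs[OF integrable_HH[of x y]] by (simp add: abs_mult)
  show "\<bar>gram x y\<bar> \<le> C * D" for x y
  proof -
    have "(\<integral>z. \<bar>H x z\<bar> * \<bar>H y z\<bar> \<partial>F) \<le> (\<integral>z. C * \<bar>H y z\<bar> \<partial>F)"
      using iabs integrable_H by (intro integral_mono) (auto intro!: mult_right_mono H_bdd)
    also have "\<dots> \<le> C * D" using H_L1 C_nonneg by (simp add: mult_left_mono)
    finally show ?thesis using abs_gram[of x y] by simp
  qed
  interpret FF: pair_prob_space F F ..
  have sw: "(\<integral>y. g (H y z) \<partial>F) = (\<integral>y. g (H z y) \<partial>F)" for g :: "real \<Rightarrow> real" and z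
    by (rule arg_cong[where f="integral\<^sup>L F"]) (simp add: H_sym)
  have I2: "integrable (F \<Otimes>\<^sub>M F) (\<lambda>(y, z). \<bar>H x z\<bar> * \<bar>H y z\<bar>)" "integrable (F \<Otimes>\<^sub>M F) (\<lambda>(y, z). H x z * H y z)" for x
  proof -
    show "integrable (F \<Otimes>\<^sub>M F) (\<lambda>(y, z). \<bar>H x z\<bar> * \<bar>H y z\<bar>)"
      by (rule integrable_bounded[OF FF.prob_space_axioms, where B="C * C"])
         (auto simp: abs_mult intro!: mult_mono H_bdd C_nonneg)
    show "integrable (F \<Otimes>\<^sub>M F) (\<lambda>(y, z). H x z * H y z)"
      by (rule integrable_bounded[OF FF.prob_space_axioms, where B="C * C"])
         (auto simp: abs_mult intro!: mult_mono H_bdd C_nonneg)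
  qed
  \<comment> \<open>Integrating over \<open>y\<close> first yields a factor \<open>D\<close>
    uniformly in \<open>z\<close>, and the integral over \<open>z\<close> yields the second. This
    gain makes the off-diagonal part of the conditional variance small.\<close>
  show "(\<integral>y. \<bar>gram x y\<bar> \<partial>F) \<le> D\<^sup>2" for x
  proof -
    have "(\<integral>y. \<bar>gram x y\<bar> \<partial>F) \<le> (\<integral>y. (\<integral>z. \<bar>H x z\<bar> * \<bar>H y z\<bar> \<partial>F) \<partial>F)"
    proof (rule integral_mono)
      show I: "integrable F (\<lambda>y. (\<integral>z. \<bar>H x z\<bar> * \<bar>H y z\<bar> \<partial>F))"
        using FF.integrable_fst[OF I2(1)] .
      show "integrable F (\<lambda>y. \<bar>gram x y\<bar>)"
        by (rule Bochner_Integration.integrable_bound[OF I]) (use abs_gram in \<open>auto intro: order_trans[OF _ abs_ge_self]\<close>)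
    qed (rule abs_gram)
    also have "\<dots> = (\<integral>z. \<bar>H x z\<bar> * (\<integral>y. \<bar>H z y\<bar> \<partial>F) \<partial>F)"
      using FF.Fubini_integral[OF I2(1), of x] sw[of abs] by simp
    also have "\<dots> \<le> (\<integral>z. \<bar>H x z\<bar> * D \<partial>F)"
    proof (rule integral_mono)
      show "integrable F (\<lambda>z. \<bar>H x z\<bar> * (\<integral>y. \<bar>H z y\<bar> \<partial>F))"
        using FF.integrable_snd[OF I2(1), of x] sw[of abs] by simp
    qed (use integrable_H H_L1 in \<open>auto intro!: mult_left_mono\<close>)
    also have "\<dots> \<le> D * D" using H_L1 D_nonneg by (simp add: mult_right_mono)
    finally show ?thesis by (simp add: power2_eq_square)
  qed
  show "(\<integral>y. gram x y \<partial>F) = 0" for x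
  proof -
    have "(\<integral>y. gram x y \<partial>F) = (\<integral>z. (\<integral>y. H x z * H y z \<partial>F) \<partial>F)"
      unfolding gram_def using FF.Fubini_integral[OF I2(2)] by simp
    also have "\<dots> = (\<integral>z. H x z * (\<integral>y. H z y \<partial>F) \<partial>F)" using sw[of "\<lambda>h. h"] by simp
    finally show ?thesis by (simp add: H_deg)
  qed
qed


text \<open>Expanding the square gives a double sum in \<open>gram\<close>. Its centred diagonal is
  a sum of independent terms, bounded through the fourth powers of the weights. The rest is twice a
  degenerate form, whose variance is at most C D * D^2 times the squared sum of squares. Both are
  estimated in L2.\<close>

lemma conditional_variance_L1:
  "integrable (iid n) (\<lambda>x. \<bar>(\<integral>y. (lin_form H w n x y)\<^sup>2 \<partial>F) - (\<Sum>s\<in>{1..n}. (w s)\<^sup>2) * kernel_var\<bar>)"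
  "(\<integral>x. \<bar>(\<integral>y. (lin_form H w n x y)\<^sup>2 \<partial>F) - (\<Sum>s\<in>{1..n}. (w s)\<^sup>2) * kernel_var\<bar> \<partial>iid n)
     \<le> sqrt (\<Sum>s\<in>{1..n}. w s ^ 4) * (C * D) + 2 * (\<Sum>s\<in>{1..n}. (w s)\<^sup>2) * sqrt (C * D ^ 3)"
proof -
  interpret P: prob_space "iid n" by (rule prob_space_iid)
  interpret G: degenerate_kernel F gram "C * D" "D\<^sup>2" by (rule gram_kernel)
  show int: "integrable (iid n) (\<lambda>x. \<bar>(\<integral>y. (lin_form H w n x y)\<^sup>2 \<partial>F) - (\<Sum>s\<in>{1..n}. (w s)\<^sup>2) * kernel_var\<bar>)"
    by (intro integrable_abs Bochner_Integration.integrable_diff P.integrable_const integrable_iid_lin_form_power)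
  define g where "g x = gram x x - kernel_var" for x
  have [measurable]: "g \<in> borel_measurable borel" unfolding g_def by measurable
  have gram_diag: "gram x x = (\<integral>y. (H x y)\<^sup>2 \<partial>F)" for x
    unfolding gram_def by (simp add: power2_eq_square)
  have Ig: "integrable F (\<lambda>x. gram x x)"
    by (rule integrable_bounded[OF prob_space_axioms _ G.H_bdd[folded real_norm_def]]) measurable
  have Ig2: "integrable F (\<lambda>x. (gram x x)\<^sup>2)"
    by (rule integrable_bounded[OF prob_space_axioms, where B="(C * D)\<^sup>2"])
       (use power_mono[OF G.H_bdd, of _ _ 2] in auto)
  have Egram: "expectation (\<lambda>x. gram x x) = kernel_var" unfolding kernel_var_def gram_diag ..
  then have Eg: "expectation g = 0" unfolding g_def using Ig by (simp add: prob_UNIV)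
  have "expectation (\<lambda>x. (g x)\<^sup>2) = expectation (\<lambda>x. (gram x x)\<^sup>2) - kernel_var\<^sup>2"
    using variance_eq[OF Ig Ig2] unfolding g_def Egram .
  also have "\<dots> \<le> expectation (\<lambda>x. (gram x x)\<^sup>2)" by simp
  also have "\<dots> \<le> expectation (\<lambda>x. (C * D)\<^sup>2)"
    using Ig2 power_mono[OF G.H_bdd, of _ _ 2] by (intro integral_mono) auto
  finally have Eg2: "expectation (\<lambda>x. (g x)\<^sup>2) \<le> (C * D)\<^sup>2" by (simp add: prob_UNIV)
  let ?Y = "\<lambda>s x. (w s)\<^sup>2 * g (x s)"
  let ?S = "\<lambda>x. \<Sum>s\<in>{1..n}. ?Y s x"
  have gb: "\<bar>g x\<bar> \<le> 2 * (C * D)" for x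
    using G.H_bdd[of x x] kernel_var_bounds by (auto simp: g_def)
  have ind: "P.indep_vars (\<lambda>_. borel) ?Y {1..n}" by (rule indep_vars_iid) measurable
  have I4: "integrable (iid n) (\<lambda>x. ?Y s x ^ 4)" if "s \<in> {1..n}" for s
  proof (rule integrable_bounded[where B="((w s)\<^sup>2 * (2 * (C * D))) ^ 4"])
    show "norm (?Y s x ^ 4) \<le> ((w s)\<^sup>2 * (2 * (C * D))) ^ 4" for x
      unfolding real_norm_def power_abs by (intro power_mono) (auto simp: abs_mult intro!: mult_left_mono gb)
  qed (use that prob_space_iid in auto)
  have E: "(\<integral>x. ?Y s x ^ k \<partial>iid n) = (w s)\<^sup>2 ^ k * (\<integral>x. (g x) ^ k \<partial>F)" if "s \<in> {1..n}" for s k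
    using that by (subst integral_iid_component[where f="\<lambda>z. ((w s)\<^sup>2 * g z) ^ k"]) (auto simp: power_mult_distrib)
  have E0: "(\<integral>x. ?Y s x \<partial>iid n) = 0" if "s \<in> {1..n}" for s
    using E[OF that, of 1] Eg by simp
  have S2: "integrable (iid n) (\<lambda>x. (?S x)\<^sup>2)"
    by (rule P.integrable_power_of_power4[OF _ P.integrable_power4_sum]) (use I4 in auto)
  have "(\<integral>x. (?S x)\<^sup>2 \<partial>iid n) = (\<Sum>s\<in>{1..n}. w s ^ 4) * expectation (\<lambda>x. (g x)\<^sup>2)"
    using P.indep_sum_moments(2)[OF _ ind I4 E0] E[of _ 2] by (simp add: sum_distrib_right flip: power_mult)
  also have "\<dots> \<le> (\<Sum>s\<in>{1..n}. w s ^ 4) * (C * D)\<^sup>2"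
    by (intro mult_left_mono Eg2) (auto intro!: sum_nonneg)
  finally have "sqrt (\<integral>x. (?S x)\<^sup>2 \<partial>iid n) \<le> sqrt ((\<Sum>s\<in>{1..n}. w s ^ 4) * (C * D)\<^sup>2)"
    by (rule real_sqrt_le_mono)
  also have "\<dots> = sqrt (\<Sum>s\<in>{1..n}. w s ^ 4) * (C * D)"
    using C_nonneg D_nonneg by (simp add: real_sqrt_mult)
  finally have part1: "(\<integral>x. \<bar>?S x\<bar> \<partial>iid n) \<le> sqrt (\<Sum>s\<in>{1..n}. w s ^ 4) * (C * D)"
    using P.expectation_abs_le_sqrt(2)[of ?S, OF _ S2] by simp
  have IS: "integrable (iid n) ?S" using P.expectation_abs_le_sqrt(1)[of ?S, OF _ S2] by simp
  have "G.kernel_var * pair_sum w n \<le> (C * D * D\<^sup>2) * (\<Sum>s\<in>{1..n}. (w s)\<^sup>2)\<^sup>2"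
    using G.kernel_var_bounds pair_sum_le by (intro mult_mono) (auto simp: pair_sum_def intro!: sum_nonneg mult_nonneg_nonneg)
  then have "sqrt (G.kernel_var * pair_sum w n) \<le> sqrt ((C * D * D\<^sup>2) * (\<Sum>s\<in>{1..n}. (w s)\<^sup>2)\<^sup>2)"
    by (rule real_sqrt_le_mono)
  also have "\<dots> = (\<Sum>s\<in>{1..n}. (w s)\<^sup>2) * sqrt (C * D ^ 3)"
    by (simp add: real_sqrt_mult real_sqrt_abs2 sum_nonneg power2_eq_square power3_eq_cube)
  finally have part2: "(\<integral>x. \<bar>quad_form gram w n x\<bar> \<partial>iid n) \<le> (\<Sum>s\<in>{1..n}. (w s)\<^sup>2) * sqrt (C * D ^ 3)"
    by (rule order_trans[OF P.expectation_abs_le_sqrt(2)[OF G.quad_form_meas G.quad_form_second_moment(1),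
            unfolded G.quad_form_second_moment(2)]])
  have IQ: "integrable (iid n) (quad_form gram w n)"
    by (rule P.expectation_abs_le_sqrt(1)[OF G.quad_form_meas G.quad_form_second_moment(1)])
  have eq: "(\<integral>y. (lin_form H w n x y)\<^sup>2 \<partial>F) - (\<Sum>s\<in>{1..n}. (w s)\<^sup>2) * kernel_var = ?S x + 2 * quad_form gram w n x" for x
  proof -
    have "(\<integral>y. (lin_form H w n x y)\<^sup>2 \<partial>F)
        = (\<integral>y. (\<Sum>s\<in>{1..n}. \<Sum>t\<in>{1..n}. w s * w t * (H (x s) y * H (x t) y)) \<partial>F)"
      by (simp add: lin_form_def power2_eq_square sum_product algebra_simps)
    also have "\<dots> = (\<Sum>s\<in>{1..n}. \<Sum>t\<in>{1..n}. w s * w t * gram (x s) (x t))"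
      using integrable_HH by (simp add: Bochner_Integration.integral_sum gram_def)
    also have "\<dots> = (\<Sum>s\<in>{1..n}. (w s)\<^sup>2 * gram (x s) (x s)) + 2 * quad_form gram w n x"
      by (rule sum_square_quad_form) (rule G.H_sym)
    finally show ?thesis by (simp add: g_def sum_subtractf right_diff_distrib sum_distrib_right)
  qed
  have "(\<integral>x. \<bar>(\<integral>y. (lin_form H w n x y)\<^sup>2 \<partial>F) - (\<Sum>s\<in>{1..n}. (w s)\<^sup>2) * kernel_var\<bar> \<partial>iid n)
    \<le> (\<integral>x. \<bar>?S x\<bar> + 2 * \<bar>quad_form gram w n x\<bar> \<partial>iid n)"
    by (rule integral_mono[OF int]) (use IS IQ in \<open>auto simp: eq simp del: One_nat_def\<close>)
  also have "\<dots> = (\<integral>x. \<bar>?S x\<bar> \<partial>iid n) + 2 * (\<integral>x. \<bar>quad_form gram w n x\<bar> \<partial>iid n)"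
    using IS IQ by simp
  finally show "(\<integral>x. \<bar>(\<integral>y. (lin_form H w n x y)\<^sup>2 \<partial>F) - (\<Sum>s\<in>{1..n}. (w s)\<^sup>2) * kernel_var\<bar> \<partial>iid n)
     \<le> sqrt (\<Sum>s\<in>{1..n}. w s ^ 4) * (C * D) + 2 * (\<Sum>s\<in>{1..n}. (w s)\<^sup>2) * sqrt (C * D ^ 3)"
    using part1 part2 by linarith
qed

text \<open>The Gaussian comparison is applied for each fixed design, with \<open>\<tau>\<close>
  equal to the design mean of the conditional variance. Integrating over the design turns the
  variance mismatch into the preceding L1 bound and the other terms into moments.\<close>

lemma lin_form_char_approx:
  fixes w :: "nat \<Rightarrow> real" and n :: nat
  assumes "0 < \<delta>"
  defines "S \<equiv> \<Sum>s\<in>{1..n}. (w s)\<^sup>2"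
  shows "(\<integral>x. cmod ((\<integral>y. iexp (c * lin_form H w n x y) \<partial>F) - complex_of_real (exp (- (c\<^sup>2 * (S * kernel_var)) / 2))) \<partial>iid n)
    \<le> c\<^sup>2 / 2 * (sqrt (\<Sum>s\<in>{1..n}. w s ^ 4) * (C * D) + 2 * S * sqrt (C * D ^ 3))
       + c ^ 4 * (S * (C * D))\<^sup>2 / 8
       + (\<delta> * c\<^sup>2 * (S * (C * D)) + c ^ 4 * (3 * (S * (C * D))\<^sup>2 + (\<Sum>s\<in>{1..n}. w s ^ 4) * (C ^ 3 * D)) / \<delta>) / 12"
    (is "(\<integral>x. ?J x \<partial>iid n) \<le> _")
proof -
  interpret P: prob_space "iid n" by (rule prob_space_iid)
  define \<tau> where "\<tau> = c\<^sup>2 * (S * kernel_var)"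
  define Q where "Q x = (\<integral>y. (lin_form H w n x y)\<^sup>2 \<partial>F)" for x
  define R where "R x = (\<integral>y. (lin_form H w n x y) ^ 4 \<partial>F)" for x
  have S0: "0 \<le> S" unfolding S_def by (auto intro!: sum_nonneg)
  have \<tau>0: "0 \<le> \<tau>" unfolding \<tau>_def using S0 kernel_var_bounds by simp
  have IQ: "integrable (iid n) Q" and IR: "integrable (iid n) R"
    unfolding Q_def R_def by (rule integrable_iid_lin_form_power)+
  have IA: "integrable (iid n) (\<lambda>x. \<bar>Q x - S * kernel_var\<bar>)"
    unfolding Q_def S_def by (rule conditional_variance_L1)
  have pt: "?J x \<le> c\<^sup>2 * \<bar>Q x - S * kernel_var\<bar> / 2 + \<tau>\<^sup>2 / 8 + (\<delta> * (c\<^sup>2 * Q x) + c ^ 4 * R x / \<delta>) / 12" for x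
  proof -
    have "?J x \<le> \<bar>expectation (\<lambda>y. (c * lin_form H w n x y)\<^sup>2) - \<tau>\<bar> / 2 + \<tau>\<^sup>2 / 8
       + (\<delta> * expectation (\<lambda>y. (c * lin_form H w n x y)\<^sup>2) + expectation (\<lambda>y. (c * lin_form H w n x y) ^ 4) / \<delta>) / 12"
      unfolding \<tau>_def
    proof (rule iexp_expectation_gaussian_approx)
      show "integrable F (\<lambda>y. (c * lin_form H w n x y) ^ 4)"
        using integrable_lin_form by (simp add: power_mult_distrib)
    qed (use assms \<tau>0 lin_form_mean in \<open>auto simp: \<tau>_def\<close>)
    also have "expectation (\<lambda>y. (c * lin_form H w n x y)\<^sup>2) = c\<^sup>2 * Q x"
      by (simp add: power_mult_distrib Q_def)
    also have "expectation (\<lambda>y. (c * lin_form H w n x y) ^ 4) = c ^ 4 * R x"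
      by (simp add: power_mult_distrib R_def)
    also have "\<bar>c\<^sup>2 * Q x - \<tau>\<bar> = c\<^sup>2 * \<bar>Q x - S * kernel_var\<bar>"
      unfolding \<tau>_def by (simp add: abs_mult flip: right_diff_distrib)
    finally show ?thesis .
  qed
  have IJ: "integrable (iid n) ?J"
  proof (rule integrable_bounded[OF prob_space_iid, where B=2])
    show "norm (?J x) \<le> 2" for x
    proof -
      have "cmod (\<integral>y. iexp (c * lin_form H w n x y) \<partial>F) \<le> expectation (\<lambda>y. 1)"
        by (rule order_trans[OF integral_norm_bound]) simp
      then have a: "cmod (\<integral>y. iexp (c * lin_form H w n x y) \<partial>F) \<le> 1" by (simp add: prob_UNIV)
      have b: "cmod (complex_of_real (exp (- \<tau> / 2))) \<le> 1" using \<tau>0 by simp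
      show ?thesis
        using order_trans[OF norm_triangle_ineq4 add_mono[OF a b[unfolded \<tau>_def]]]
        unfolding real_norm_def abs_norm_cancel by (simp only: one_add_one)
    qed
  qed measurable
  have "(\<integral>x. ?J x \<partial>iid n) \<le> (\<integral>x. c\<^sup>2 * \<bar>Q x - S * kernel_var\<bar> / 2 + \<tau>\<^sup>2 / 8 + (\<delta> * (c\<^sup>2 * Q x) + c ^ 4 * R x / \<delta>) / 12 \<partial>iid n)"
    by (rule integral_mono[OF IJ _ pt]) (use IQ IR IA in \<open>auto simp del: One_nat_def\<close>)
  also have "\<dots> = c\<^sup>2 / 2 * (\<integral>x. \<bar>Q x - S * kernel_var\<bar> \<partial>iid n) + \<tau>\<^sup>2 / 8
       + (\<delta> * c\<^sup>2 * integral\<^sup>L (iid n) Q + c ^ 4 * integral\<^sup>L (iid n) R / \<delta>) / 12"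
    using IQ IR IA by (simp add: P.prob_space del: One_nat_def)
  also have "\<dots> \<le> c\<^sup>2 / 2 * (sqrt (\<Sum>s\<in>{1..n}. w s ^ 4) * (C * D) + 2 * S * sqrt (C * D ^ 3))
       + c ^ 4 * (S * (C * D))\<^sup>2 / 8
       + (\<delta> * c\<^sup>2 * (S * (C * D)) + c ^ 4 * (3 * (S * (C * D))\<^sup>2 + (\<Sum>s\<in>{1..n}. w s ^ 4) * (C ^ 3 * D)) / \<delta>) / 12"
  proof (intro add_mono divide_right_mono mult_left_mono)
    show "(\<integral>x. \<bar>Q x - S * kernel_var\<bar> \<partial>iid n) \<le> sqrt (\<Sum>s\<in>{1..n}. w s ^ 4) * (C * D) + 2 * S * sqrt (C * D ^ 3)"
      unfolding Q_def S_def by (rule conditional_variance_L1)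
    have "\<tau>\<^sup>2 = c ^ 4 * (S * kernel_var)\<^sup>2" unfolding \<tau>_def by (simp add: power_mult_distrib flip: power_mult)
    also have "\<dots> \<le> c ^ 4 * (S * (C * D))\<^sup>2"
      using S0 kernel_var_bounds by (intro mult_left_mono power_mono) auto
    finally show "\<tau>\<^sup>2 \<le> c ^ 4 * (S * (C * D))\<^sup>2" .
    show "integral\<^sup>L (iid n) Q \<le> S * (C * D)"
      unfolding Q_def lin_form_second_moment S_def[symmetric] using S0 kernel_var_bounds by (intro mult_left_mono)
    show "integral\<^sup>L (iid n) R \<le> 3 * (S * (C * D))\<^sup>2 + (\<Sum>s\<in>{1..n}. w s ^ 4) * (C ^ 3 * D)"
      unfolding R_def S_def by (rule lin_form_fourth_moment)
  qed (use assms in auto)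
  finally show ?thesis .
qed

text \<open>
Costs of exchanging one increment for a Gaussian one: the coefficients of \<open>w\<^sub>t\<^sup>2\<close> and of \<open>w\<^sub>t\<^sup>4\<close>, where
\<open>A\<close> and \<open>B\<close> bound the sums of the squares and of the fourth powers of the weights.
\<close>

definition swap_rate2 :: "real \<Rightarrow> real \<Rightarrow> real \<Rightarrow> real \<Rightarrow> real" where
  "swap_rate2 \<theta> \<delta> A B = \<theta>\<^sup>2 * ((sqrt B * (C * D) + 2 * A * sqrt (C * D ^ 3)) / 2 + \<delta> * (A * (C * D)) / 12)"

definition swap_rate4 :: "real \<Rightarrow> real \<Rightarrow> real \<Rightarrow> real \<Rightarrow> real" where
  "swap_rate4 \<theta> \<delta> A B = \<theta> ^ 4 * ((A * (C * D))\<^sup>2 / 8 + (3 * (A * (C * D))\<^sup>2 + B * (C ^ 3 * D)) / (12 * \<delta>))"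

text \<open>The exchange is an induction on the number of design points. Because the conditional
  variance has been replaced by its mean, the Gaussian factor is deterministic and leaves the
  integral over the earlier points, so the errors simply add up. \<open>A\<close> and
  \<open>B\<close> are fixed beforehand to keep the rates the same at every step.\<close>

lemma quad_form_char_approx:
  assumes "0 < \<delta>" "(\<Sum>s\<in>{1..n}. (w s)\<^sup>2) \<le> A" "(\<Sum>s\<in>{1..n}. w s ^ 4) \<le> B"
  shows "cmod ((\<integral>x. iexp (\<theta> * quad_form H w n x) \<partial>iid n) - complex_of_real (exp (- (\<theta>\<^sup>2 * (kernel_var * pair_sum w n)) / 2)))
     \<le> swap_rate2 \<theta> \<delta> A B * (\<Sum>s\<in>{1..n}. (w s)\<^sup>2) + swap_rate4 \<theta> \<delta> A B * (\<Sum>s\<in>{1..n}. w s ^ 4)"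
  using assms(2,3)
proof (induction n)
  case 0
  interpret P: prob_space "iid 0" by (rule prob_space_iid)
  show ?case using P.prob_space by (simp add: quad_form_def pair_sum_def)
next
  case (Suc n)
  interpret P: prob_space "iid n" by (rule prob_space_iid)
  let ?w = "w (Suc n)"
  let ?S = "\<Sum>s\<in>{1..n}. (w s)\<^sup>2" and ?B = "\<Sum>s\<in>{1..n}. w s ^ 4"
  let ?L = "\<lambda>x y. lin_form H w n x y"
  have S0: "0 \<le> ?S" and B0: "0 \<le> ?B" by (auto intro!: sum_nonneg)
  have "?S + ?w\<^sup>2 \<le> A" "?B + ?w ^ 4 \<le> B" "0 \<le> ?w\<^sup>2" "0 \<le> ?w ^ 4"
    using Suc.prems by simp_all
  then have SA: "?S \<le> A" and BB: "?B \<le> B" by linarith+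
  note IH = Suc.IH[OF SA BB]
  define g where "g = complex_of_real (exp (- (\<theta>\<^sup>2 * (kernel_var * pair_sum w n)) / 2))"
  define g' where "g' = complex_of_real (exp (- ((\<theta> * ?w)\<^sup>2 * (?S * kernel_var)) / 2))"
  have gg: "complex_of_real (exp (- (\<theta>\<^sup>2 * (kernel_var * pair_sum w (Suc n))) / 2)) = g * g'"
    unfolding g_def g'_def of_real_mult[symmetric] exp_add[symmetric] pair_sum_Suc
    by (simp add: power_mult_distrib field_simps)
  have ng': "cmod g' \<le> 1" unfolding g'_def using S0 kernel_var_bounds by simp
  define E where "E x = iexp (\<theta> * quad_form H w n x)" for x
  define J where "J x = (\<integral>y. iexp (\<theta> * ?w * ?L x y) \<partial>F)" for x
  have [measurable]: "E \<in> borel_measurable (iid n)" "J \<in> borel_measurable (iid n)"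
    unfolding E_def J_def by measurable
  have nJ: "cmod (J x) \<le> 1" for x
  proof -
    have "cmod (J x) \<le> expectation (\<lambda>y. 1)" unfolding J_def
      by (rule order_trans[OF integral_norm_bound]) simp
    then show ?thesis by (simp add: prob_UNIV)
  qed
  have nE: "cmod (E x) = 1" for x unfolding E_def by simp
  have IE: "integrable (iid n) E"
    by (rule integrable_bounded[OF prob_space_iid, where B=1]) (auto simp: nE simp del: One_nat_def)
  have IEJ: "integrable (iid n) (\<lambda>x. E x * J x)"
    by (rule integrable_bounded[OF prob_space_iid, where B=1]) (auto simp: nE nJ norm_mult simp del: One_nat_def)
  have IJg: "integrable (iid n) (\<lambda>x. cmod (J x - g'))"
    by (rule integrable_bounded[OF prob_space_iid, where B=2])
       (use order_trans[OF norm_triangle_ineq4 add_mono[OF nJ ng']] in \<open>auto simp del: One_nat_def\<close>)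
  have "(\<integral>x. iexp (\<theta> * quad_form H w (Suc n) x) \<partial>iid (Suc n))
      = (\<integral>x. (\<integral>y. iexp (\<theta> * quad_form H w (Suc n) (x(Suc n := y))) \<partial>F) \<partial>iid n)"
    by (rule integral_iid_Suc, rule integrable_bounded[OF prob_space_iid, where B=1]) (auto simp del: One_nat_def)
  also have "\<dots> = (\<integral>x. E x * J x \<partial>iid n)"
    unfolding quad_form_Suc E_def J_def
    by (simp add: distrib_left exp_add mult.assoc)
  finally have eq: "(\<integral>x. iexp (\<theta> * quad_form H w (Suc n) x) \<partial>iid (Suc n)) = (\<integral>x. E x * J x \<partial>iid n)" .
  \<comment> \<open>The last factor is exchanged first, then the earlier ones. \<open>E\<close> has
    modulus one and \<open>g'\<close> modulus at most one, so neither error is amplified.\<close>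
  have "(\<integral>x. E x * J x \<partial>iid n) - g * g' = (\<integral>x. E x * (J x - g') \<partial>iid n) + g' * ((\<integral>x. E x \<partial>iid n) - g)"
    using IEJ IE by (simp add: right_diff_distrib mult.commute del: One_nat_def)
  also have "cmod \<dots> \<le> (\<integral>x. cmod (J x - g') \<partial>iid n) + cmod ((\<integral>x. E x \<partial>iid n) - g)"
  proof (rule norm_triangle_mono)
    show "cmod (\<integral>x. E x * (J x - g') \<partial>iid n) \<le> (\<integral>x. cmod (J x - g') \<partial>iid n)"
      by (rule order_trans[OF integral_norm_bound]) (simp add: norm_mult nE)
    show "cmod (g' * ((\<integral>x. E x \<partial>iid n) - g)) \<le> cmod ((\<integral>x. E x \<partial>iid n) - g)"
      unfolding norm_mult using ng' by (simp add: mult_left_le_one_le)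
  qed
  also have "(\<integral>x. cmod (J x - g') \<partial>iid n) \<le>
     (\<theta> * ?w)\<^sup>2 / 2 * (sqrt ?B * (C * D) + 2 * ?S * sqrt (C * D ^ 3)) + (\<theta> * ?w) ^ 4 * (?S * (C * D))\<^sup>2 / 8
       + (\<delta> * (\<theta> * ?w)\<^sup>2 * (?S * (C * D)) + (\<theta> * ?w) ^ 4 * (3 * (?S * (C * D))\<^sup>2 + ?B * (C ^ 3 * D)) / \<delta>) / 12"
    unfolding J_def g'_def by (rule lin_form_char_approx) fact
  also have "\<dots> \<le> (\<theta> * ?w)\<^sup>2 / 2 * (sqrt B * (C * D) + 2 * A * sqrt (C * D ^ 3)) + (\<theta> * ?w) ^ 4 * (A * (C * D))\<^sup>2 / 8
       + (\<delta> * (\<theta> * ?w)\<^sup>2 * (A * (C * D)) + (\<theta> * ?w) ^ 4 * (3 * (A * (C * D))\<^sup>2 + B * (C ^ 3 * D)) / \<delta>) / 12"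
    using SA BB S0 B0 C_nonneg D_nonneg \<open>0 < \<delta>\<close>
    by (intro add_mono mult_left_mono mult_right_mono power_mono divide_right_mono) auto
  also have "\<dots> = swap_rate2 \<theta> \<delta> A B * ?w\<^sup>2 + swap_rate4 \<theta> \<delta> A B * ?w ^ 4"
    using \<open>0 < \<delta>\<close> unfolding swap_rate2_def swap_rate4_def by (simp add: power_mult_distrib field_simps)
  also have "cmod ((\<integral>x. E x \<partial>iid n) - g) \<le> swap_rate2 \<theta> \<delta> A B * ?S + swap_rate4 \<theta> \<delta> A B * ?B"
    using IH unfolding E_def g_def .
  finally show ?case unfolding eq gg by (simp add: distrib_left)
qed

end

section \<open>Linear processes\<close>

text \<open>The error process is an almost sure limit, so bounds on its moments come from Fatou's
  lemma. The index \<open>m\<close> admits bounds that hold only from some truncation level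
  on.\<close>

lemma (in prob_space) fatou_expectation:
  fixes g :: "nat \<Rightarrow> 'a \<Rightarrow> real"
  assumes [measurable]: "\<And>N. g N \<in> borel_measurable M" "G \<in> borel_measurable M"
    and nn: "\<And>N x. 0 \<le> g N x" and lim: "AE x in M. (\<lambda>N. g N x) \<longlonglongrightarrow> G x"
    and int: "\<And>N. integrable M (g N)" and le: "\<And>N. m \<le> N \<Longrightarrow> expectation (g N) \<le> B"
  shows "integrable M G" and "expectation G \<le> B"
proof -
  have G0: "AE x in M. 0 \<le> G x"
    using lim by eventually_elim (rule LIMSEQ_le_const, auto simp: nn)
  have "0 \<le> expectation (g m)" by (intro Bochner_Integration.integral_nonneg nn)
  then have B0: "0 \<le> B" using le[of m] by simp
  have "(\<integral>\<^sup>+x. ennreal (G x) \<partial>M) = (\<integral>\<^sup>+x. liminf (\<lambda>N. ennreal (g N x)) \<partial>M)"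
  proof (rule nn_integral_cong_AE)
    show "AE x in M. ennreal (G x) = liminf (\<lambda>N. ennreal (g N x))"
      using lim by eventually_elim (metis tendsto_ennrealI lim_imp_Liminf trivial_limit_sequentially)
  qed
  also have "\<dots> \<le> liminf (\<lambda>N. \<integral>\<^sup>+x. ennreal (g N x) \<partial>M)" by (rule nn_integral_liminf) measurable
  also have "\<dots> \<le> ennreal B"
  proof (rule Liminf_le)
    show "eventually (\<lambda>N. (\<integral>\<^sup>+x. ennreal (g N x) \<partial>M) \<le> ennreal B) sequentially"
      using eventually_ge_at_top[of m]
    proof eventually_elim
      case (elim N)
      then show ?case
        using le[of N] int[of N] nn by (subst nn_integral_eq_integral) (auto intro!: ennreal_leI)
    qed
  qed simp
  finally have nn_le: "(\<integral>\<^sup>+x. ennreal (G x) \<partial>M) \<le> ennreal B" .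
  then show I: "integrable M G"
    using G0 by (intro integrableI_nonneg) (auto simp: top.not_eq_extremum intro: le_less_trans)
  then have "ennreal (expectation G) \<le> ennreal B" using nn_le G0 by (simp add: nn_integral_eq_integral)
  then show "expectation G \<le> B" using B0 by (simp add: ennreal_le_iff)
qed

text \<open>Continuity of the L2 inner product, which carries covariances from the truncated process
  to its limit.\<close>

lemma (in prob_space) L2_product_limit:
  fixes Y Z :: "'a \<Rightarrow> real" and YN ZN :: "nat \<Rightarrow> 'a \<Rightarrow> real"
  assumes [measurable]: "Y \<in> borel_measurable M" "Z \<in> borel_measurable M"
      "\<And>N. YN N \<in> borel_measurable M" "\<And>N. ZN N \<in> borel_measurable M"
    and "integrable M (\<lambda>x. (Y x)\<^sup>2)" "integrable M (\<lambda>x. (Z x)\<^sup>2)"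
      "\<And>N. integrable M (\<lambda>x. (YN N x)\<^sup>2)" "\<And>N. integrable M (\<lambda>x. (ZN N x)\<^sup>2)"
      "\<And>N. integrable M (\<lambda>x. (Y x - YN N x)\<^sup>2)" "\<And>N. integrable M (\<lambda>x. (Z x - ZN N x)\<^sup>2)"
    and Yl: "(\<lambda>N. expectation (\<lambda>x. (Y x - YN N x)\<^sup>2)) \<longlonglongrightarrow> 0"
    and Zl: "(\<lambda>N. expectation (\<lambda>x. (Z x - ZN N x)\<^sup>2)) \<longlonglongrightarrow> 0"
    and ZB: "\<And>N. expectation (\<lambda>x. (ZN N x)\<^sup>2) \<le> B"
  shows "(\<lambda>N. expectation (\<lambda>x. YN N x * ZN N x)) \<longlonglongrightarrow> expectation (\<lambda>x. Y x * Z x)"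
proof -
  let ?n = "\<lambda>Y::'a \<Rightarrow> real. sqrt (expectation (\<lambda>x. (Y x)\<^sup>2))"
  have bound: "norm (expectation (\<lambda>x. YN N x * ZN N x) - expectation (\<lambda>x. Y x * Z x))
      \<le> ?n (\<lambda>x. Y x - YN N x) * sqrt B + ?n Y * ?n (\<lambda>x. Z x - ZN N x)" for N
  proof -
    note I = expectation_abs_mult_le(1)
    have i1: "integrable M (\<lambda>x. (Y x - YN N x) * ZN N x)" and i2: "integrable M (\<lambda>x. Y x * (Z x - ZN N x))"
      and i3: "integrable M (\<lambda>x. YN N x * ZN N x)" and i4: "integrable M (\<lambda>x. Y x * Z x)"
      using assms by (auto intro!: I)
    have "expectation (\<lambda>x. YN N x * ZN N x) - expectation (\<lambda>x. Y x * Z x)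
        = expectation (\<lambda>x. - ((Y x - YN N x) * ZN N x) - Y x * (Z x - ZN N x))"
      unfolding Bochner_Integration.integral_diff[OF i3 i4, symmetric]
      by (intro Bochner_Integration.integral_cong) (auto simp: algebra_simps)
    also have "\<dots> = - expectation (\<lambda>x. (Y x - YN N x) * ZN N x) - expectation (\<lambda>x. Y x * (Z x - ZN N x))"
      using i1 i2 by simp
    also have "norm \<dots> \<le> expectation (\<lambda>x. \<bar>(Y x - YN N x) * ZN N x\<bar>) + expectation (\<lambda>x. \<bar>Y x * (Z x - ZN N x)\<bar>)"
      using integral_abs_bound[of M "\<lambda>x. (Y x - YN N x) * ZN N x"] integral_abs_bound[of M "\<lambda>x. Y x * (Z x - ZN N x)"]
      by (auto simp: abs_if split: if_splits)
    also have "\<dots> \<le> ?n (\<lambda>x. Y x - YN N x) * ?n (ZN N) + ?n Y * ?n (\<lambda>x. Z x - ZN N x)"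
      using assms by (intro add_mono expectation_abs_mult_le) auto
    also have "\<dots> \<le> ?n (\<lambda>x. Y x - YN N x) * sqrt B + ?n Y * ?n (\<lambda>x. Z x - ZN N x)"
      using ZB by (intro add_right_mono mult_left_mono) (auto intro!: Bochner_Integration.integral_nonneg)
    finally show ?thesis .
  qed
  have "(\<lambda>N. ?n (\<lambda>x. Y x - YN N x) * sqrt B + ?n Y * ?n (\<lambda>x. Z x - ZN N x)) \<longlonglongrightarrow> sqrt 0 * sqrt B + ?n Y * sqrt 0"
    by (intro tendsto_intros Yl Zl)
  then have "(\<lambda>N. ?n (\<lambda>x. Y x - YN N x) * sqrt B + ?n Y * ?n (\<lambda>x. Z x - ZN N x)) \<longlonglongrightarrow> 0" by simp
  then have "(\<lambda>N. expectation (\<lambda>x. YN N x * ZN N x) - expectation (\<lambda>x. Y x * Z x)) \<longlonglongrightarrow> 0"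
    by (rule Lim_null_comparison[rotated]) (intro always_eventually allI bound)
  then show ?thesis by (rule LIM_zero_cancel)
qed

text \<open>Moments and covariances of \<open>e\<close> are not postulated: they are derived from
  the convergence of the symmetric partial sums.\<close>

locale linear_process = prob_space M for M :: "'w measure" +
  fixes \<xi> :: "int \<Rightarrow> 'w \<Rightarrow> real" and \<psi> :: "int \<Rightarrow> real" and e :: "int \<Rightarrow> 'w \<Rightarrow> real"
  assumes xi_indep: "indep_vars (\<lambda>_. borel) \<xi> UNIV"
    and xi_id: "\<And>j. distr M borel (\<xi> j) = distr M borel (\<xi> 0)"
    and xi_mean0: "expectation (\<xi> 0) = 0"
    and xi_var0: "expectation (\<lambda>\<omega>. (\<xi> 0 \<omega>)\<^sup>2) = 1"
    and xi_m4: "integrable M (\<lambda>\<omega>. \<xi> 0 \<omega> ^ 4)"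
    and psi_sq: "(\<lambda>j. (\<psi> j)\<^sup>2) summable_on UNIV"
    and e_rv[measurable]: "\<And>t. e t \<in> borel_measurable M"
    and e_lim: "\<And>t. AE \<omega> in M. (\<lambda>N. \<Sum>j\<in>{- int N..int N}. \<psi> j * \<xi> (t - j) \<omega>) \<longlonglongrightarrow> e t \<omega>"
begin

lemma xi_rv[measurable]: "\<xi> j \<in> borel_measurable M"
  using xi_indep by (auto simp: indep_vars_def2)

lemma xi_transfer:
  fixes g :: "real \<Rightarrow> real"
  assumes [measurable]: "g \<in> borel_measurable borel"
  shows "expectation (\<lambda>\<omega>. g (\<xi> j \<omega>)) = expectation (\<lambda>\<omega>. g (\<xi> 0 \<omega>))"
    and "integrable M (\<lambda>\<omega>. g (\<xi> j \<omega>)) \<longleftrightarrow> integrable M (\<lambda>\<omega>. g (\<xi> 0 \<omega>))"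
proof -
  have "expectation (\<lambda>\<omega>. g (\<xi> i \<omega>)) = integral\<^sup>L (distr M borel (\<xi> i)) g" for i
    by (simp add: integral_distr)
  then show "expectation (\<lambda>\<omega>. g (\<xi> j \<omega>)) = expectation (\<lambda>\<omega>. g (\<xi> 0 \<omega>))" using xi_id[of j] by simp
  have "integrable M (\<lambda>\<omega>. g (\<xi> i \<omega>)) \<longleftrightarrow> integrable (distr M borel (\<xi> i)) g" for i
    by (simp add: integrable_distr_eq)
  then show "integrable M (\<lambda>\<omega>. g (\<xi> j \<omega>)) \<longleftrightarrow> integrable M (\<lambda>\<omega>. g (\<xi> 0 \<omega>))" using xi_id[of j] by simp
qed

definition m4 :: real where "m4 = expectation (\<lambda>\<omega>. \<xi> 0 \<omega> ^ 4)"

lemma m4_nonneg: "0 \<le> m4"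
  unfolding m4_def by (rule Bochner_Integration.integral_nonneg) auto

lemma xi_mean: "expectation (\<xi> j) = 0"
  using xi_transfer(1)[of "\<lambda>x. x" j] xi_mean0 by simp

lemma xi_var: "expectation (\<lambda>\<omega>. (\<xi> j \<omega>)\<^sup>2) = 1"
  using xi_transfer(1)[of "\<lambda>x. x\<^sup>2" j] xi_var0 by simp

lemma xi_int4: "integrable M (\<lambda>\<omega>. \<xi> j \<omega> ^ 4)"
  using xi_transfer(2)[of "\<lambda>x. x ^ 4" j] xi_m4 by simp

lemma xi_E4: "expectation (\<lambda>\<omega>. \<xi> j \<omega> ^ 4) = m4"
  using xi_transfer(1)[of "\<lambda>x. x ^ 4" j] by (simp add: m4_def)

text \<open>Coefficients are attached to innovation times rather than to lags, so that forms
  belonging to different dates can be combined.\<close>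

definition lin :: "(int \<Rightarrow> real) \<Rightarrow> int set \<Rightarrow> 'w \<Rightarrow> real" where
  "lin c J \<omega> = (\<Sum>j\<in>J. c j * \<xi> j \<omega>)"

lemma lin_meas[measurable]: "lin c J \<in> borel_measurable M"
  unfolding lin_def by measurable

lemma lin_int4: "finite J \<Longrightarrow> integrable M (\<lambda>\<omega>. lin c J \<omega> ^ 4)"
  unfolding lin_def using xi_int4 by (intro integrable_power4_sum) (auto simp: power_mult_distrib)

lemma lin_int2: "finite J \<Longrightarrow> integrable M (\<lambda>\<omega>. (lin c J \<omega>)\<^sup>2)"
  using integrable_power_of_power4[where k=2, OF lin_meas lin_int4] by simp

text \<open>The fourth powers of the coefficients sum to at most the square of the sum of squares.
  The fourth moment is therefore controlled by the variance alone, uniformly in the index set, and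
  the bound survives the limit of infinitely many innovations.\<close>

lemma lin_moments:
  assumes "finite J"
  shows "expectation (\<lambda>\<omega>. (lin c J \<omega>)\<^sup>2) = (\<Sum>j\<in>J. (c j)\<^sup>2)"
    and "expectation (\<lambda>\<omega>. lin c J \<omega> ^ 4) \<le> (3 + m4) * (\<Sum>j\<in>J. (c j)\<^sup>2)\<^sup>2"
proof -
  have ind: "indep_vars (\<lambda>_. borel) (\<lambda>j \<omega>. c j * \<xi> j \<omega>) J"
    by (rule indep_vars_compose2[OF indep_vars_subset[OF xi_indep]]) auto
  have i4: "integrable M (\<lambda>\<omega>. (c j * \<xi> j \<omega>) ^ 4)" for j
    using xi_int4 by (simp add: power_mult_distrib)
  have z: "expectation (\<lambda>\<omega>. c j * \<xi> j \<omega>) = 0" for j by (simp add: xi_mean)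
  note M = indep_sum_moments[OF assms ind i4 z]
  show two: "expectation (\<lambda>\<omega>. (lin c J \<omega>)\<^sup>2) = (\<Sum>j\<in>J. (c j)\<^sup>2)"
    unfolding lin_def M(2) by (simp add: power_mult_distrib xi_var)
  have "expectation (\<lambda>\<omega>. lin c J \<omega> ^ 4) \<le> 3 * (\<Sum>j\<in>J. (c j)\<^sup>2)\<^sup>2 + (\<Sum>j\<in>J. c j ^ 4 * m4)"
    using M(3) unfolding lin_def by (simp add: power_mult_distrib xi_var xi_E4)
  also have "(\<Sum>j\<in>J. c j ^ 4 * m4) \<le> m4 * (\<Sum>j\<in>J. (c j)\<^sup>2)\<^sup>2"
  proof -
    have "(\<Sum>j\<in>J. ((c j)\<^sup>2)\<^sup>2) \<le> (\<Sum>j\<in>J. (c j)\<^sup>2 * (\<Sum>j\<in>J. (c j)\<^sup>2))"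
      unfolding power2_eq_square[of "(c _)\<^sup>2"]
      using assms by (intro sum_mono mult_left_mono member_le_sum) auto
    also have "\<dots> = (\<Sum>j\<in>J. (c j)\<^sup>2)\<^sup>2" by (simp add: power2_eq_square[of "sum _ _"] sum_distrib_right)
    finally show ?thesis using m4_nonneg
      by (simp add: sum_distrib_left[symmetric] mult.commute[of _ m4] mult_left_mono flip: power_mult)
  qed
  finally show "expectation (\<lambda>\<omega>. lin c J \<omega> ^ 4) \<le> (3 + m4) * (\<Sum>j\<in>J. (c j)\<^sup>2)\<^sup>2"
    by (simp add: algebra_simps)
qed

lemma lin_product:
  assumes "finite J"
  shows "expectation (\<lambda>\<omega>. lin a J \<omega> * lin b J \<omega>) = (\<Sum>j\<in>J. a j * b j)"
proof -
  \<comment> \<open>Polarisation reduces the product to the variances already computed.\<close>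
  have pol: "lin a J \<omega> * lin b J \<omega> = ((lin (\<lambda>j. a j + b j) J \<omega>)\<^sup>2 - (lin (\<lambda>j. a j - b j) J \<omega>)\<^sup>2) / 4" for \<omega>
  proof -
    have "lin (\<lambda>j. a j + b j) J \<omega> = lin a J \<omega> + lin b J \<omega>" "lin (\<lambda>j. a j - b j) J \<omega> = lin a J \<omega> - lin b J \<omega>"
      unfolding lin_def by (simp_all add: algebra_simps sum.distrib sum_subtractf)
    note eq = this
    show ?thesis unfolding eq by (simp add: power2_eq_square algebra_simps)
  qed
  have "expectation (\<lambda>\<omega>. lin a J \<omega> * lin b J \<omega>)
      = ((\<Sum>j\<in>J. (a j + b j)\<^sup>2) - (\<Sum>j\<in>J. (a j - b j)\<^sup>2)) / 4"
    unfolding pol using assms by (simp add: lin_int2 lin_moments(1))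
  also have "\<dots> = (\<Sum>j\<in>J. ((a j + b j)\<^sup>2 - (a j - b j)\<^sup>2) / 4)"
    unfolding sum_divide_distrib[symmetric] sum_subtractf ..
  also have "\<dots> = (\<Sum>j\<in>J. a j * b j)"
    by (intro sum.cong refl) (simp add: power2_eq_square algebra_simps)
  finally show ?thesis .
qed

text \<open>Characteristic functions of independent terms multiply, and a difference of products of
  factors in the unit disc is at most the sum of the differences. With \<open>\<tau>\<close> the
  exact variance of each term only remainders are left, and c^4 <= \<kappa> c^2 makes them a
  fraction of the total variance: the Lindeberg condition in quantitative form.\<close>

lemma lin_char_approx:
  assumes "finite J" "0 < \<delta>" and \<kappa>: "\<And>j. j \<in> J \<Longrightarrow> (c j)\<^sup>2 \<le> \<kappa>"
  shows "cmod (expectation (\<lambda>\<omega>. iexp (u * lin c J \<omega>)) - complex_of_real (exp (- (u\<^sup>2 * (\<Sum>j\<in>J. (c j)\<^sup>2)) / 2)))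
     \<le> (\<Sum>j\<in>J. (c j)\<^sup>2) * (u ^ 4 * \<kappa> / 8 + (\<delta> * u\<^sup>2 + u ^ 4 * \<kappa> * m4 / \<delta>) / 12)"
proof -
  let ?Y = "\<lambda>j \<omega>. c j * \<xi> j \<omega>"
  have ind: "indep_vars (\<lambda>_. borel) ?Y J"
    by (rule indep_vars_compose2[OF indep_vars_subset[OF xi_indep]]) auto
  have char: "char (distr M borel Y) u = expectation (\<lambda>\<omega>. iexp (u * Y \<omega>))" if [measurable]: "Y \<in> borel_measurable M" for Y
    unfolding char_def by (subst integral_distr) auto
  let ?z = "\<lambda>j. expectation (\<lambda>\<omega>. iexp (u * ?Y j \<omega>))"
  let ?v = "\<lambda>j. complex_of_real (exp (- (u\<^sup>2 * (c j)\<^sup>2) / 2))"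
  have "expectation (\<lambda>\<omega>. iexp (u * lin c J \<omega>)) = (\<Prod>j\<in>J. ?z j)"
    using char_distr_sum[OF ind, of u] char[of "lin c J"] char[of "?Y _"] unfolding lin_def by simp
  moreover have "complex_of_real (exp (- (u\<^sup>2 * (\<Sum>j\<in>J. (c j)\<^sup>2)) / 2)) = (\<Prod>j\<in>J. ?v j)"
    using assms(1) by (simp add: exp_sum sum_distrib_left sum_divide_distrib sum_negf[symmetric] of_real_prod[symmetric] del: of_real_prod of_real_exp)
  moreover have "cmod ((\<Prod>j\<in>J. ?z j) - (\<Prod>j\<in>J. ?v j)) \<le> (\<Sum>j\<in>J. cmod (?z j - ?v j))"
  proof (rule norm_prod_diff)
    show "norm (?z j) \<le> 1" for j
    proof -
      have "norm (?z j) \<le> expectation (\<lambda>\<omega>. 1)" by (rule order_trans[OF integral_norm_bound]) simp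
      then show ?thesis by (simp add: prob_space)
    qed
  qed auto
  moreover have "(\<Sum>j\<in>J. cmod (?z j - ?v j))
      \<le> (\<Sum>j\<in>J. (c j)\<^sup>2 * (u ^ 4 * \<kappa> / 8 + (\<delta> * u\<^sup>2 + u ^ 4 * \<kappa> * m4 / \<delta>) / 12))"
  proof (rule sum_mono)
    fix j assume j: "j \<in> J"
    have E2: "expectation (\<lambda>\<omega>. (u * ?Y j \<omega>)\<^sup>2) = u\<^sup>2 * (c j)\<^sup>2" by (simp add: power_mult_distrib xi_var)
    have E4: "expectation (\<lambda>\<omega>. (u * ?Y j \<omega>) ^ 4) = u ^ 4 * c j ^ 4 * m4" by (simp add: power_mult_distrib xi_E4)
    have "cmod (?z j - ?v j) \<le> \<bar>u\<^sup>2 * (c j)\<^sup>2 - u\<^sup>2 * (c j)\<^sup>2\<bar> / 2 + (u\<^sup>2 * (c j)\<^sup>2)\<^sup>2 / 8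
       + (\<delta> * (u\<^sup>2 * (c j)\<^sup>2) + u ^ 4 * c j ^ 4 * m4 / \<delta>) / 12"
      unfolding E2[symmetric] E4[symmetric]
      by (rule iexp_expectation_gaussian_approx[where \<tau>="expectation (\<lambda>\<omega>. (u * ?Y j \<omega>)\<^sup>2)" and Z="\<lambda>\<omega>. u * ?Y j \<omega>"])
         (use assms(2) in \<open>auto simp: xi_mean power_mult_distrib xi_int4 xi_var\<close>)
    also have "\<dots> = u ^ 4 * c j ^ 4 / 8 + (\<delta> * (u\<^sup>2 * (c j)\<^sup>2) + u ^ 4 * c j ^ 4 * m4 / \<delta>) / 12"
      by (simp add: power_mult_distrib flip: power_mult)
    also have "\<dots> \<le> u ^ 4 * ((c j)\<^sup>2 * \<kappa>) / 8 + (\<delta> * (u\<^sup>2 * (c j)\<^sup>2) + u ^ 4 * ((c j)\<^sup>2 * \<kappa>) * m4 / \<delta>) / 12"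
    proof -
      have "c j ^ 4 = (c j)\<^sup>2 * (c j)\<^sup>2" by (simp add: power2_eq_square power4_eq_xxxx)
      also have "\<dots> \<le> (c j)\<^sup>2 * \<kappa>" using \<kappa>[OF j] by (intro mult_left_mono) auto
      finally have c4: "c j ^ 4 \<le> (c j)\<^sup>2 * \<kappa>" .
      show ?thesis using assms(2) m4_nonneg
        by (intro add_mono divide_right_mono mult_left_mono mult_right_mono c4) auto
    qed
    also have "\<dots> = (c j)\<^sup>2 * (u ^ 4 * \<kappa> / 8 + (\<delta> * u\<^sup>2 + u ^ 4 * \<kappa> * m4 / \<delta>) / 12)"
      using assms(2) by (simp add: field_simps)
    finally show "cmod (?z j - ?v j) \<le> \<dots>" .
  qed
  ultimately show ?thesis by (simp add: sum_distrib_right)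
qed


section \<open>Truncation of the linear process\<close>

definition trunc :: "nat \<Rightarrow> int \<Rightarrow> real" where
  "trunc N k = (if \<bar>k\<bar> \<le> int N then \<psi> k else 0)"

definition eN :: "nat \<Rightarrow> int \<Rightarrow> 'w \<Rightarrow> real" where
  "eN N t = lin (\<lambda>i. \<psi> (t - i)) {t - int N..t + int N}"

text \<open>Padding with zeros places truncations at different dates and levels over one index set,
  where they combine into a single linear form.\<close>

lemma eN_eq_lin:
  assumes "finite J" "{t - int N..t + int N} \<subseteq> J"
  shows "eN N t = lin (\<lambda>i. trunc N (t - i)) J"
proof
  fix \<omega>
  have "(\<Sum>i\<in>{t - int N..t + int N}. \<psi> (t - i) * \<xi> i \<omega>) = (\<Sum>i\<in>J. trunc N (t - i) * \<xi> i \<omega>)"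
    using assms by (intro sum.mono_neutral_cong_left) (auto simp: trunc_def)
  then show "eN N t \<omega> = lin (\<lambda>i. trunc N (t - i)) J \<omega>" by (simp add: eN_def lin_def)
qed

lemma eN_lim: "AE \<omega> in M. (\<lambda>N. eN N t \<omega>) \<longlonglongrightarrow> e t \<omega>"
proof -
  have "(\<Sum>j\<in>{- int N..int N}. \<psi> j * \<xi> (t - j) \<omega>) = eN N t \<omega>" for N \<omega>
    unfolding eN_def lin_def
    by (rule sum.reindex_bij_witness[where i="\<lambda>i. t - i" and j="\<lambda>j. t - j"]) auto
  then show ?thesis using e_lim[of t] by simp
qed

definition \<Gamma> :: real where "\<Gamma> = (\<Sum>\<^sub>\<infinity>j. (\<psi> j)\<^sup>2)"

lemma sum_psi_sq_le: "finite J \<Longrightarrow> (\<Sum>j\<in>J. (\<psi> j)\<^sup>2) \<le> \<Gamma>"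
  unfolding \<Gamma>_def by (rule finite_sum_le_infsum[OF psi_sq]) auto

lemma Gamma_nonneg: "0 \<le> \<Gamma>"
  using sum_psi_sq_le[of "{}"] by simp

definition \<Gamma>N :: "nat \<Rightarrow> real" where "\<Gamma>N N = (\<Sum>j\<in>{- int N..int N}. (\<psi> j)\<^sup>2)"

text \<open>The infinite sums are limits along the net of finite sets; any sequence of finite sets
  that eventually contains each integer may be used to compute them.\<close>

lemma filterlim_finite_subsets_int:
  assumes "\<And>N. finite (A N)" "\<And>k. eventually (\<lambda>N. k \<in> A N) sequentially"
  shows "filterlim A (finite_subsets_at_top (UNIV :: int set)) sequentially"
  unfolding filterlim_finite_subsets_at_top
proof (intro allI impI)
  fix X :: "int set" assume X: "finite X \<and> X \<subseteq> UNIV"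
  then have "eventually (\<lambda>N. \<forall>k\<in>X. k \<in> A N) sequentially"
    using assms(2) by (intro eventually_ball_finite) auto
  then show "eventually (\<lambda>N. finite (A N) \<and> X \<subseteq> A N \<and> A N \<subseteq> UNIV) sequentially"
    by eventually_elim (use assms(1) in auto)
qed

lemma GammaN_lim: "\<Gamma>N \<longlonglongrightarrow> \<Gamma>"
proof -
  have "((\<lambda>j. (\<psi> j)\<^sup>2) has_sum \<Gamma>) UNIV" unfolding \<Gamma>_def using psi_sq by (rule has_sum_infsum)
  then have "(sum (\<lambda>j. (\<psi> j)\<^sup>2) \<longlongrightarrow> \<Gamma>) (finite_subsets_at_top UNIV)" by (simp add: has_sum_def)
  moreover have "filterlim (\<lambda>N. {- int N..int N}) (finite_subsets_at_top UNIV) sequentially"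
  proof (rule filterlim_finite_subsets_int)
    show "eventually (\<lambda>N. k \<in> {- int N..int N}) sequentially" for k
      using eventually_ge_at_top[of "nat \<bar>k\<bar>"] by eventually_elim auto
  qed simp
  ultimately show ?thesis unfolding \<Gamma>N_def using filterlim_compose by blast
qed

lemma eN_meas[measurable]: "eN N t \<in> borel_measurable M"
  unfolding eN_def by measurable

lemma eN_int4: "integrable M (\<lambda>\<omega>. eN N t \<omega> ^ 4)"
  unfolding eN_def by (rule lin_int4) simp

lemma eN_int2: "integrable M (\<lambda>\<omega>. (eN N t \<omega>)\<^sup>2)"
  unfolding eN_def by (rule lin_int2) simp

lemma eN_sq_sum: "(\<Sum>i\<in>{t - int N..t + int N}. (\<psi> (t - i))\<^sup>2) = \<Gamma>N N"
  unfolding \<Gamma>N_def by (rule sum.reindex_bij_witness[where i="\<lambda>i. t - i" and j="\<lambda>j. t - j"]) auto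

lemma eN_E2: "expectation (\<lambda>\<omega>. (eN N t \<omega>)\<^sup>2) = \<Gamma>N N"
  unfolding eN_def by (subst lin_moments(1)) (simp_all add: eN_sq_sum)

lemma GammaN_le: "0 \<le> \<Gamma>N N" "\<Gamma>N N \<le> \<Gamma>"
  unfolding \<Gamma>N_def by (auto intro!: sum_psi_sq_le sum_nonneg)

definition B4 :: real where "B4 = (3 + m4) * \<Gamma>\<^sup>2"

lemma B4_nonneg: "0 \<le> B4" unfolding B4_def using m4_nonneg by simp

lemma eN_E4: "expectation (\<lambda>\<omega>. eN N t \<omega> ^ 4) \<le> B4"
proof -
  have "expectation (\<lambda>\<omega>. eN N t \<omega> ^ 4) \<le> (3 + m4) * (\<Gamma>N N)\<^sup>2"
    unfolding eN_def using lin_moments(2)[of "{t - int N..t + int N}" "\<lambda>i. \<psi> (t - i)"] by (simp add: eN_sq_sum)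
  also have "\<dots> \<le> B4" unfolding B4_def using m4_nonneg GammaN_le by (intro mult_left_mono power_mono) auto
  finally show ?thesis .
qed

lemma e_fourth_moment: "integrable M (\<lambda>\<omega>. e t \<omega> ^ 4)" "expectation (\<lambda>\<omega>. e t \<omega> ^ 4) \<le> B4"
proof -
  have lim: "AE \<omega> in M. (\<lambda>N. eN N t \<omega> ^ 4) \<longlonglongrightarrow> e t \<omega> ^ 4"
    using eN_lim[of t] by eventually_elim (rule tendsto_power)
  note F = fatou_expectation[OF _ _ _ lim eN_int4, where m=0 and B=B4]
  show "integrable M (\<lambda>\<omega>. e t \<omega> ^ 4)" by (rule F) (auto simp: eN_E4)
  show "expectation (\<lambda>\<omega>. e t \<omega> ^ 4) \<le> B4" by (rule F) (auto simp: eN_E4)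
qed

lemma e_int2: "integrable M (\<lambda>\<omega>. (e t \<omega>)\<^sup>2)"
  by (rule integrable_power_of_power4[OF e_rv e_fourth_moment(1)]) simp

text \<open>Fatou in the outer level \<open>K\<close>: for \<open>K\<close> at least
  \<open>N\<close> the difference of the two truncations involves only the lags between them, and
  its variance is at most the tail of the series.\<close>

lemma eN_diff:
  "integrable M (\<lambda>\<omega>. (e t \<omega> - eN N t \<omega>)\<^sup>2)" "expectation (\<lambda>\<omega>. (e t \<omega> - eN N t \<omega>)\<^sup>2) \<le> \<Gamma> - \<Gamma>N N"
proof -
  have lim: "AE \<omega> in M. (\<lambda>K. (eN K t \<omega> - eN N t \<omega>)\<^sup>2) \<longlonglongrightarrow> (e t \<omega> - eN N t \<omega>)\<^sup>2"
    using eN_lim[of t] by eventually_elim (intro tendsto_intros)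
  have int: "integrable M (\<lambda>\<omega>. (eN K t \<omega> - eN N t \<omega>)\<^sup>2)" for K
  proof -
    let ?J = "{t - int (max K N)..t + int (max K N)}"
    have "(\<lambda>\<omega>. (eN K t \<omega> - eN N t \<omega>)) = lin (\<lambda>i. trunc K (t - i) - trunc N (t - i)) ?J"
      by (subst (1 2) eN_eq_lin[of ?J]) (auto simp: lin_def algebra_simps sum_subtractf)
    then show ?thesis using lin_int2[of ?J] by (metis finite_atLeastAtMost_int)
  qed
  have E: "expectation (\<lambda>\<omega>. (eN K t \<omega> - eN N t \<omega>)\<^sup>2) \<le> \<Gamma> - \<Gamma>N N" if "N \<le> K" for K
  proof -
    let ?J = "{t - int K..t + int K}"
    have eq: "eN K t \<omega> - eN N t \<omega> = lin (\<lambda>i. trunc K (t - i) - trunc N (t - i)) ?J \<omega>" for \<omega>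
      using that by (subst (1 2) eN_eq_lin[of ?J]) (auto simp: lin_def algebra_simps sum_subtractf)
    have "expectation (\<lambda>\<omega>. (eN K t \<omega> - eN N t \<omega>)\<^sup>2) = (\<Sum>i\<in>?J. (trunc K (t - i) - trunc N (t - i))\<^sup>2)"
      unfolding eq by (rule lin_moments(1)) simp
    \<comment> \<open>Each coefficient of the inner truncation equals that of the outer one or
      vanishes, so the square of the difference is the difference of the squares.\<close>
    also have "\<dots> = (\<Sum>i\<in>?J. (\<psi> (t - i))\<^sup>2 - (trunc N (t - i))\<^sup>2)"
      by (intro sum.cong refl) (auto simp: trunc_def)
    also have "\<dots> = \<Gamma>N K - (\<Sum>i\<in>?J. (trunc N (t - i))\<^sup>2)" by (simp add: sum_subtractf eN_sq_sum)
    also have "(\<Sum>i\<in>?J. (trunc N (t - i))\<^sup>2) = (\<Sum>i\<in>{t - int N..t + int N}. (\<psi> (t - i))\<^sup>2)"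
      using that by (intro sum.mono_neutral_cong_right) (auto simp: trunc_def)
    finally show ?thesis using GammaN_le[of K] by (simp add: eN_sq_sum)
  qed
  note F = fatou_expectation[OF _ _ _ lim int, where m=N and B="\<Gamma> - \<Gamma>N N"]
  show "integrable M (\<lambda>\<omega>. (e t \<omega> - eN N t \<omega>)\<^sup>2)" by (rule F) (auto simp: E)
  show "expectation (\<lambda>\<omega>. (e t \<omega> - eN N t \<omega>)\<^sup>2) \<le> \<Gamma> - \<Gamma>N N" by (rule F) (auto simp: E)
qed

lemma eN_L2_lim: "(\<lambda>N. expectation (\<lambda>\<omega>. (e t \<omega> - eN N t \<omega>)\<^sup>2)) \<longlonglongrightarrow> 0"
proof (rule Lim_null_comparison)
  show "eventually (\<lambda>N. norm (expectation (\<lambda>\<omega>. (e t \<omega> - eN N t \<omega>)\<^sup>2)) \<le> \<Gamma> - \<Gamma>N N) sequentially"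
    using eN_diff(2) by (intro always_eventually allI) (simp add: Bochner_Integration.integral_nonneg)
  show "(\<lambda>N. \<Gamma> - \<Gamma>N N) \<longlonglongrightarrow> 0" using tendsto_diff[OF tendsto_const GammaN_lim, of \<Gamma>] by simp
qed

lemma psi_product_summable: "(\<lambda>j. \<psi> j * \<psi> (j + k)) summable_on UNIV"
proof (rule abs_summable_summable, rule summable_on_comparison_test)
  have "(\<lambda>j. (\<psi> (j + k))\<^sup>2) summable_on UNIV"
    using summable_on_reindex_bij_betw[of "\<lambda>j. j + k" UNIV UNIV "\<lambda>j. (\<psi> j)\<^sup>2"] psi_sq
    by (simp add: bij_plus_right)
  then show "(\<lambda>j. (\<psi> j)\<^sup>2 + (\<psi> (j + k))\<^sup>2) summable_on UNIV" by (intro summable_on_add psi_sq)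
  show "norm (\<psi> j * \<psi> (j + k)) \<le> (\<psi> j)\<^sup>2 + (\<psi> (j + k))\<^sup>2" for j
    using sum_squares_bound[of "\<bar>\<psi> j\<bar>" "\<bar>\<psi> (j + k)\<bar>"] abs_ge_zero[of "\<psi> j * \<psi> (j + k)"]
    unfolding real_norm_def abs_mult power2_abs mult.assoc by linarith
qed auto

lemma eN_product_lim: "(\<lambda>N. expectation (\<lambda>\<omega>. eN N s \<omega> * eN N t \<omega>)) \<longlonglongrightarrow> lp_gamma \<psi> (t - s)"
proof -
  \<comment> \<open>The lags that contribute to both truncated variables. These windows exhaust the
    integers, so the finite sums tend to the covariance series.\<close>
  define A where "A N = {k. \<bar>k\<bar> \<le> int N \<and> \<bar>k + (t - s)\<bar> \<le> int N}" for N
  have fin: "finite (A N)" for N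
    by (rule finite_subset[of _ "{- int N..int N}"]) (auto simp: A_def)
  have "expectation (\<lambda>\<omega>. eN N s \<omega> * eN N t \<omega>) = (\<Sum>k\<in>A N. \<psi> k * \<psi> (k + (t - s)))" for N
  proof -
    let ?J = "{min s t - int N..max s t + int N}"
    have "expectation (\<lambda>\<omega>. eN N s \<omega> * eN N t \<omega>) = (\<Sum>i\<in>?J. trunc N (s - i) * trunc N (t - i))"
      by (subst (1 2) eN_eq_lin[of ?J]) (auto simp: lin_product)
    also have "\<dots> = (\<Sum>i\<in>(\<lambda>k. s - k) ` A N. trunc N (s - i) * trunc N (t - i))"
    proof (rule sum.mono_neutral_right)
      show "\<forall>i\<in>?J - (\<lambda>k. s - k) ` A N. trunc N (s - i) * trunc N (t - i) = 0"
      proof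
        fix i assume "i \<in> ?J - (\<lambda>k. s - k) ` A N"
        then have "s - i \<notin> A N" by (auto simp: image_iff)
        then show "trunc N (s - i) * trunc N (t - i) = 0" by (auto simp: A_def trunc_def)
      qed
    qed (auto simp: A_def)
    also have "\<dots> = (\<Sum>k\<in>A N. trunc N k * trunc N (k + (t - s)))"
      by (subst sum.reindex) (auto simp: inj_on_def algebra_simps)
    also have "\<dots> = (\<Sum>k\<in>A N. \<psi> k * \<psi> (k + (t - s)))"
      by (intro sum.cong refl) (auto simp: A_def trunc_def)
    finally show ?thesis .
  qed
  moreover have "(\<lambda>N. \<Sum>k\<in>A N. \<psi> k * \<psi> (k + (t - s))) \<longlonglongrightarrow> lp_gamma \<psi> (t - s)"
  proof -
    have "((\<lambda>j. \<psi> j * \<psi> (j + (t - s))) has_sum lp_gamma \<psi> (t - s)) UNIV"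
      unfolding lp_gamma_def using psi_product_summable by (rule has_sum_infsum)
    then have "(sum (\<lambda>j. \<psi> j * \<psi> (j + (t - s))) \<longlongrightarrow> lp_gamma \<psi> (t - s)) (finite_subsets_at_top UNIV)"
      by (simp add: has_sum_def)
    moreover have "filterlim A (finite_subsets_at_top UNIV) sequentially"
    proof (rule filterlim_finite_subsets_int[OF fin])
      show "eventually (\<lambda>N. k \<in> A N) sequentially" for k
        using eventually_ge_at_top[of "nat (\<bar>k\<bar> + \<bar>t - s\<bar>)"] by eventually_elim (auto simp: A_def)
    qed
    ultimately show ?thesis using filterlim_compose by blast
  qed
  ultimately show ?thesis by simp
qed

lemma e_covariance: "expectation (\<lambda>\<omega>. e s \<omega> * e t \<omega>) = lp_gamma \<psi> (t - s)"
proof -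
  have "(\<lambda>N. expectation (\<lambda>\<omega>. eN N s \<omega> * eN N t \<omega>)) \<longlonglongrightarrow> expectation (\<lambda>\<omega>. e s \<omega> * e t \<omega>)"
    by (rule L2_product_limit[where B=\<Gamma>]) (auto simp: e_int2 eN_int2 eN_diff(1) eN_L2_lim eN_E2 GammaN_le)
  then show ?thesis using eN_product_lim LIMSEQ_unique by blast
qed

lemma lp_gamma_0: "lp_gamma \<psi> 0 = \<Gamma>"
  unfolding lp_gamma_def \<Gamma>_def by (simp add: power2_eq_square)

text \<open>Read off from the symmetry of the covariances.\<close>

lemma lp_gamma_minus: "lp_gamma \<psi> (- k) = lp_gamma \<psi> k"
  using e_covariance[of 0 k] e_covariance[of k 0] by (simp add: mult.commute)

lemma e_E2: "expectation (\<lambda>\<omega>. (e t \<omega>)\<^sup>2) = \<Gamma>"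
  using e_covariance[of t t] by (simp add: power2_eq_square lp_gamma_0)

section \<open>Partial sums of the errors\<close>

definition S :: "nat \<Rightarrow> 'w \<Rightarrow> real" where "S n \<omega> = (\<Sum>t\<in>{1..n}. e (int t) \<omega>)"

definition V :: "nat \<Rightarrow> real" where
  "V n = (\<Sum>s\<in>{1..n}. \<Sum>t\<in>{1..n}. lp_gamma \<psi> (int t - int s))"

lemma S_meas[measurable]: "S n \<in> borel_measurable M"
  unfolding S_def by measurable

lemma e_product_int: "integrable M (\<lambda>\<omega>. e s \<omega> * e t \<omega>)"
  by (rule expectation_abs_mult_le(1)) (auto simp: e_int2)

lemma S_sq: "(S n \<omega>)\<^sup>2 = (\<Sum>s\<in>{1..n}. \<Sum>t\<in>{1..n}. e (int s) \<omega> * e (int t) \<omega>)"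
  unfolding S_def power2_eq_square sum_product ..

lemma S_second_moment: "integrable M (\<lambda>\<omega>. (S n \<omega>)\<^sup>2)" "expectation (\<lambda>\<omega>. (S n \<omega>)\<^sup>2) = V n"
  unfolding S_sq V_def
  by (simp_all add: e_product_int Bochner_Integration.integral_sum Bochner_Integration.integrable_sum e_covariance)

lemma V_nonneg: "0 \<le> V n"
  unfolding S_second_moment(2)[symmetric] by (rule Bochner_Integration.integral_nonneg) simp

text \<open>A sum of truncated errors is one linear form in the innovations. By Cauchy-Schwarz each
  squared coefficient is at most n \<Gamma>, whatever the truncation level, so the bound passes to
  the limit by dominated convergence. It is useful when n is small compared with \<open>V n\<close>,
  as under long memory.\<close>

lemma S_char_approx:
  assumes "0 < \<delta>"
  shows "cmod (expectation (\<lambda>\<omega>. iexp (u * S n \<omega>)) - complex_of_real (exp (- (u\<^sup>2 * V n) / 2)))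
     \<le> V n * (u ^ 4 * (real n * \<Gamma>) / 8 + (\<delta> * u\<^sup>2 + u ^ 4 * (real n * \<Gamma>) * m4 / \<delta>) / 12)"
proof -
  define SN where "SN N \<omega> = (\<Sum>t\<in>{1..n}. eN N (int t) \<omega>)" for N \<omega>
  define J where "J N = {1 - int N..int n + int N}" for N
  define c where "c N i = (\<Sum>t\<in>{1..n}. trunc N (int t - i))" for N i
  define VN where "VN N = (\<Sum>i\<in>J N. (c N i)\<^sup>2)" for N
  have fin: "finite (J N)" for N by (simp add: J_def)
  have SN: "SN N = lin (c N) (J N)" for N
  proof
    fix \<omega>
    have "SN N \<omega> = (\<Sum>t\<in>{1..n}. lin (\<lambda>i. trunc N (int t - i)) (J N) \<omega>)"
      unfolding SN_def by (intro sum.cong refl fun_cong[OF eN_eq_lin]) (auto simp: J_def)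
    also have "\<dots> = lin (c N) (J N) \<omega>"
      unfolding lin_def c_def sum_distrib_right by (rule sum.swap)
    finally show "SN N \<omega> = lin (c N) (J N) \<omega>" .
  qed
  have \<kappa>: "(c N i)\<^sup>2 \<le> real n * \<Gamma>" for N i
  proof -
    have "(c N i)\<^sup>2 \<le> real n * (\<Sum>t\<in>{1..n}. (trunc N (int t - i))\<^sup>2)"
      using sum_squared_le_sum_of_squares[of "\<lambda>t. trunc N (int t - i)" "{1..n}"]
      unfolding c_def by (simp add: mult.commute)
    also have "(\<Sum>t\<in>{1..n}. (trunc N (int t - i))\<^sup>2) \<le> (\<Sum>t\<in>{1..n}. (\<psi> (int t - i))\<^sup>2)"
      by (intro sum_mono) (auto simp: trunc_def)
    also have "\<dots> = (\<Sum>j\<in>(\<lambda>t. int t - i) ` {1..n}. (\<psi> j)\<^sup>2)"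
      by (subst sum.reindex) (auto simp: inj_on_def)
    also have "\<dots> \<le> \<Gamma>" by (rule sum_psi_sq_le) simp
    finally show ?thesis by (simp add: mult_left_mono)
  qed
  have bound: "cmod (expectation (\<lambda>\<omega>. iexp (u * SN N \<omega>)) - complex_of_real (exp (- (u\<^sup>2 * VN N) / 2)))
     \<le> VN N * (u ^ 4 * (real n * \<Gamma>) / 8 + (\<delta> * u\<^sup>2 + u ^ 4 * (real n * \<Gamma>) * m4 / \<delta>) / 12)" for N
    unfolding SN VN_def by (rule lin_char_approx[OF fin assms \<kappa>])
  have VN: "VN \<longlonglongrightarrow> V n"
  proof -
    have "VN N = (\<Sum>s\<in>{1..n}. \<Sum>t\<in>{1..n}. expectation (\<lambda>\<omega>. eN N (int s) \<omega> * eN N (int t) \<omega>))" for N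
    proof -
      have "integrable M (\<lambda>\<omega>. eN N s \<omega> * eN N t \<omega>)" for s t
        by (rule expectation_abs_mult_le(1)) (auto simp: eN_int2)
      moreover have "VN N = expectation (\<lambda>\<omega>. (SN N \<omega>)\<^sup>2)" unfolding VN_def SN lin_moments(1)[OF fin] ..
      ultimately show ?thesis
        unfolding SN_def power2_eq_square sum_product
        by (simp add: Bochner_Integration.integral_sum Bochner_Integration.integrable_sum)
    qed
    then have "VN = (\<lambda>N. \<Sum>s\<in>{1..n}. \<Sum>t\<in>{1..n}. expectation (\<lambda>\<omega>. eN N (int s) \<omega> * eN N (int t) \<omega>))" by auto
    then show ?thesis unfolding V_def by (simp add: tendsto_sum eN_product_lim)
  qed
  have SN_meas[measurable]: "SN N \<in> borel_measurable M" for N unfolding SN by measurable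
  have lim: "(\<lambda>N. expectation (\<lambda>\<omega>. iexp (u * SN N \<omega>))) \<longlonglongrightarrow> expectation (\<lambda>\<omega>. iexp (u * S n \<omega>))"
  proof (rule integral_dominated_convergence[where w="\<lambda>_. 1"])
    have "AE \<omega> in M. \<forall>t\<in>{1..n}. (\<lambda>N. eN N (int t) \<omega>) \<longlonglongrightarrow> e (int t) \<omega>"
      by (intro AE_finite_allI) (auto simp: eN_lim)
    then show "AE \<omega> in M. (\<lambda>N. iexp (u * SN N \<omega>)) \<longlonglongrightarrow> iexp (u * S n \<omega>)"
    proof eventually_elim
      case (elim \<omega>)
      then have "(\<lambda>N. SN N \<omega>) \<longlonglongrightarrow> S n \<omega>" unfolding SN_def S_def by (intro tendsto_sum) auto
      then show ?case by (intro tendsto_intros)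
    qed
  qed auto
  show ?thesis
  proof (rule LIMSEQ_le)
    show "(\<lambda>N. cmod (expectation (\<lambda>\<omega>. iexp (u * SN N \<omega>)) - complex_of_real (exp (- (u\<^sup>2 * VN N) / 2))))
      \<longlonglongrightarrow> cmod (expectation (\<lambda>\<omega>. iexp (u * S n \<omega>)) - complex_of_real (exp (- (u\<^sup>2 * V n) / 2)))"
      by (intro tendsto_intros lim VN) auto
    show "(\<lambda>N. VN N * (u ^ 4 * (real n * \<Gamma>) / 8 + (\<delta> * u\<^sup>2 + u ^ 4 * (real n * \<Gamma>) * m4 / \<delta>) / 12))
      \<longlonglongrightarrow> V n * (u ^ 4 * (real n * \<Gamma>) / 8 + (\<delta> * u\<^sup>2 + u ^ 4 * (real n * \<Gamma>) * m4 / \<delta>) / 12)"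
      by (intro tendsto_mult VN tendsto_const)
  qed (use bound in auto)
qed

text \<open>Truncated errors more than 2 N apart are functions of disjoint blocks of
  innovations.\<close>

lemma eN_sq_indep:
  assumes "2 * int N < \<bar>s - t\<bar>"
  shows "expectation (\<lambda>\<omega>. ((eN N s \<omega>)\<^sup>2 - \<Gamma>N N) * ((eN N t \<omega>)\<^sup>2 - \<Gamma>N N)) = 0"
proof -
  let ?A = "\<lambda>s. {s - int N..s + int N}"
  let ?h = "\<lambda>s f. (\<Sum>i\<in>?A s. \<psi> (s - i) * f i)\<^sup>2 - \<Gamma>N N"
  have disj: "?A s \<inter> ?A t = {}" using assms by auto
  have "indep_var borel (?h s \<circ> (\<lambda>\<omega>. restrict (\<lambda>i. \<xi> i \<omega>) (?A s))) borel (?h t \<circ> (\<lambda>\<omega>. restrict (\<lambda>i. \<xi> i \<omega>) (?A t)))"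
    by (intro indep_var_compose[OF indep_var_restrict[OF xi_indep disj]]) auto
  moreover have "?h s \<circ> (\<lambda>\<omega>. restrict (\<lambda>i. \<xi> i \<omega>) (?A s)) = (\<lambda>\<omega>. (eN N s \<omega>)\<^sup>2 - \<Gamma>N N)" for s
    by (auto simp: eN_def lin_def fun_eq_iff intro!: arg_cong[where f="\<lambda>x. x\<^sup>2"] sum.cong)
  ultimately have ind: "indep_var borel (\<lambda>\<omega>. (eN N s \<omega>)\<^sup>2 - \<Gamma>N N) borel (\<lambda>\<omega>. (eN N t \<omega>)\<^sup>2 - \<Gamma>N N)"
    by metis
  have i: "integrable M (\<lambda>\<omega>. (eN N s \<omega>)\<^sup>2 - \<Gamma>N N)" for s using eN_int2 by simp
  have "expectation (\<lambda>\<omega>. (eN N s \<omega>)\<^sup>2 - \<Gamma>N N) = 0" for s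
    using eN_int2 by (simp add: eN_E2 prob_space)
  then show ?thesis using indep_var_lebesgue_integral[OF ind i i] by simp
qed

lemma eN_sq_variance:
  "integrable M (\<lambda>\<omega>. ((eN N s \<omega>)\<^sup>2 - \<Gamma>N N)\<^sup>2)" "expectation (\<lambda>\<omega>. ((eN N s \<omega>)\<^sup>2 - \<Gamma>N N)\<^sup>2) \<le> B4"
proof -
  have eq: "((eN N s \<omega>)\<^sup>2 - \<Gamma>N N)\<^sup>2 = eN N s \<omega> ^ 4 - 2 * \<Gamma>N N * (eN N s \<omega>)\<^sup>2 + (\<Gamma>N N)\<^sup>2" for \<omega>
    by (simp add: power2_diff flip: power_mult)
  show "integrable M (\<lambda>\<omega>. ((eN N s \<omega>)\<^sup>2 - \<Gamma>N N)\<^sup>2)" unfolding eq using eN_int4 eN_int2 by simp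
  have "expectation (\<lambda>\<omega>. ((eN N s \<omega>)\<^sup>2 - \<Gamma>N N)\<^sup>2) = expectation (\<lambda>\<omega>. eN N s \<omega> ^ 4) - (\<Gamma>N N)\<^sup>2"
    unfolding eq using eN_int4 eN_int2 by (simp add: eN_E2 prob_space) (simp add: power2_eq_square)
  also have "\<dots> \<le> B4" using eN_E4[of N s] zero_le_power2[of "\<Gamma>N N"] by linarith
  finally show "expectation (\<lambda>\<omega>. ((eN N s \<omega>)\<^sup>2 - \<Gamma>N N)\<^sup>2) \<le> B4" .
qed

text \<open>Each row of the covariance matrix of the squares has at most 4 N + 1 nonzero entries,
  all bounded by \<open>B4\<close>; the variance of the sum thus grows linearly in n.\<close>

lemma eN_LLN:
  "integrable M (\<lambda>\<omega>. (\<Sum>t\<in>{1..n}. (eN N (int t) \<omega>)\<^sup>2 - \<Gamma>N N))"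
  "expectation (\<lambda>\<omega>. \<bar>\<Sum>t\<in>{1..n}. (eN N (int t) \<omega>)\<^sup>2 - \<Gamma>N N\<bar>) \<le> sqrt (real n * (real (4 * N + 1) * B4))"
proof -
  let ?Y = "\<lambda>t \<omega>. (eN N (int t) \<omega>)\<^sup>2 - \<Gamma>N N"
  have i: "integrable M (\<lambda>\<omega>. ?Y s \<omega> * ?Y t \<omega>)" for s t
    by (rule expectation_abs_mult_le(1)) (auto simp: eN_sq_variance)
  have sq: "(\<Sum>t\<in>{1..n}. ?Y t \<omega>)\<^sup>2 = (\<Sum>s\<in>{1..n}. \<Sum>t\<in>{1..n}. ?Y s \<omega> * ?Y t \<omega>)" for \<omega>
    unfolding power2_eq_square[of "sum _ _"] sum_product ..
  have int: "integrable M (\<lambda>\<omega>. (\<Sum>t\<in>{1..n}. ?Y t \<omega>)\<^sup>2)"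
    unfolding sq using i by (intro Bochner_Integration.integrable_sum) auto
  have row: "(\<Sum>t\<in>{1..n}. expectation (\<lambda>\<omega>. ?Y s \<omega> * ?Y t \<omega>)) \<le> real (4 * N + 1) * B4" for s
  proof -
    let ?W = "{t\<in>{1..n}. \<bar>int s - int t\<bar> \<le> 2 * int N}"
    have "(\<Sum>t\<in>{1..n}. expectation (\<lambda>\<omega>. ?Y s \<omega> * ?Y t \<omega>)) = (\<Sum>t\<in>?W. expectation (\<lambda>\<omega>. ?Y s \<omega> * ?Y t \<omega>))"
      by (intro sum.mono_neutral_right ballI eN_sq_indep) auto
    also have "\<dots> \<le> (\<Sum>t\<in>?W. B4)"
    proof (rule sum_mono)
      fix t
      have "expectation (\<lambda>\<omega>. ?Y s \<omega> * ?Y t \<omega>) \<le> expectation (\<lambda>\<omega>. \<bar>?Y s \<omega> * ?Y t \<omega>\<bar>)"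
        using i[of s t] by (intro integral_mono) auto
      also have "\<dots> \<le> sqrt (expectation (\<lambda>\<omega>. (?Y s \<omega>)\<^sup>2)) * sqrt (expectation (\<lambda>\<omega>. (?Y t \<omega>)\<^sup>2))"
        by (rule expectation_abs_mult_le(2)) (auto simp: eN_sq_variance)
      also have "\<dots> \<le> sqrt B4 * sqrt B4"
        by (intro mult_mono real_sqrt_le_mono eN_sq_variance(2)) (auto simp: B4_nonneg intro!: Bochner_Integration.integral_nonneg)
      finally show "expectation (\<lambda>\<omega>. ?Y s \<omega> * ?Y t \<omega>) \<le> B4" using B4_nonneg by simp
    qed
    also have "\<dots> = real (card ?W) * B4" by simp
    also have "\<dots> \<le> real (4 * N + 1) * B4"
    proof (rule mult_right_mono)
      have "card ?W \<le> card (nat ` {int s - 2 * int N..int s + 2 * int N})"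
      proof (rule card_mono)
        show "?W \<subseteq> nat ` {int s - 2 * int N..int s + 2 * int N}"
        proof
          fix t assume "t \<in> ?W"
          then have "int t \<in> {int s - 2 * int N..int s + 2 * int N}" by auto
          then show "t \<in> nat ` {int s - 2 * int N..int s + 2 * int N}" by (metis image_eqI nat_int)
        qed
      qed simp
      also have "\<dots> \<le> card {int s - 2 * int N..int s + 2 * int N}" by (rule card_image_le) simp
      also have "\<dots> = 4 * N + 1" by simp
      finally show "real (card ?W) \<le> real (4 * N + 1)" by linarith
    qed (rule B4_nonneg)
    finally show ?thesis .
  qed
  have "expectation (\<lambda>\<omega>. (\<Sum>t\<in>{1..n}. ?Y t \<omega>)\<^sup>2) = (\<Sum>s\<in>{1..n}. \<Sum>t\<in>{1..n}. expectation (\<lambda>\<omega>. ?Y s \<omega> * ?Y t \<omega>))"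
    unfolding sq using i by (simp add: Bochner_Integration.integral_sum Bochner_Integration.integrable_sum)
  also have "\<dots> \<le> (\<Sum>s\<in>{1..n}. real (4 * N + 1) * B4)" by (intro sum_mono row)
  also have "\<dots> = real n * (real (4 * N + 1) * B4)" by simp
  finally have "expectation (\<lambda>\<omega>. (\<Sum>t\<in>{1..n}. ?Y t \<omega>)\<^sup>2) \<le> \<dots>" .
  then show "expectation (\<lambda>\<omega>. \<bar>\<Sum>t\<in>{1..n}. ?Y t \<omega>\<bar>) \<le> sqrt (real n * (real (4 * N + 1) * B4))"
    by (intro order_trans[OF expectation_abs_le_sqrt(2) real_sqrt_le_mono] int) measurable
  show "integrable M (\<lambda>\<omega>. (\<Sum>t\<in>{1..n}. ?Y t \<omega>))"
    using eN_int2 by (intro Bochner_Integration.integrable_sum) auto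
qed

lemma eN_sq_L1: 
  "expectation (\<lambda>\<omega>. \<bar>(e t \<omega>)\<^sup>2 - (eN N t \<omega>)\<^sup>2\<bar>) \<le> sqrt (\<Gamma> - \<Gamma>N N) * sqrt (4 * \<Gamma>)"
proof -
  have plus_le: "(a + b)\<^sup>2 \<le> 2 * a\<^sup>2 + 2 * b\<^sup>2" for a b :: real
    using zero_le_power2[of "a - b"] by (simp add: power2_sum power2_diff)
  have int: "integrable M (\<lambda>\<omega>. (e t \<omega> + eN N t \<omega>)\<^sup>2)"
  proof (rule Bochner_Integration.integrable_bound)
    show "integrable M (\<lambda>\<omega>. 2 * (e t \<omega>)\<^sup>2 + 2 * (eN N t \<omega>)\<^sup>2)" using e_int2 eN_int2 by simp
  qed (use plus_le in auto)
  have "expectation (\<lambda>\<omega>. \<bar>(e t \<omega>)\<^sup>2 - (eN N t \<omega>)\<^sup>2\<bar>) = expectation (\<lambda>\<omega>. \<bar>(e t \<omega> - eN N t \<omega>) * (e t \<omega> + eN N t \<omega>)\<bar>)"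
    by (intro Bochner_Integration.integral_cong refl arg_cong[where f=abs]) (simp add: power2_eq_square algebra_simps)
  also have "\<dots> \<le> sqrt (expectation (\<lambda>\<omega>. (e t \<omega> - eN N t \<omega>)\<^sup>2)) * sqrt (expectation (\<lambda>\<omega>. (e t \<omega> + eN N t \<omega>)\<^sup>2))"
    by (rule expectation_abs_mult_le(2)) (auto simp: eN_diff int)
  also have "\<dots> \<le> sqrt (\<Gamma> - \<Gamma>N N) * sqrt (4 * \<Gamma>)"
  proof (intro mult_mono real_sqrt_le_mono eN_diff)
    have "expectation (\<lambda>\<omega>. (e t \<omega> + eN N t \<omega>)\<^sup>2) \<le> expectation (\<lambda>\<omega>. 2 * (e t \<omega>)\<^sup>2 + 2 * (eN N t \<omega>)\<^sup>2)"
      using e_int2 eN_int2 by (intro integral_mono int plus_le) auto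
    also have "\<dots> = 2 * \<Gamma> + 2 * \<Gamma>N N" using e_int2 eN_int2 by (simp add: e_E2 eN_E2)
    finally show "expectation (\<lambda>\<omega>. (e t \<omega> + eN N t \<omega>)\<^sup>2) \<le> 4 * \<Gamma>" using GammaN_le[of N] by linarith
  qed (use GammaN_le in \<open>auto intro!: Bochner_Integration.integral_nonneg\<close>)
  finally show ?thesis .
qed

text \<open>The L1 cost of truncating is the same for every date, hence uniform in n. The level N is
  chosen first to make it small; for this N the truncated squares are finitely dependent and average
  out as n grows.\<close>

lemma e_LLN: "(\<lambda>n. expectation (\<lambda>\<omega>. \<bar>(\<Sum>t\<in>{1..n}. (e (int t) \<omega>)\<^sup>2) / real n - \<Gamma>\<bar>)) \<longlonglongrightarrow> 0"
proof -
  have bound: "expectation (\<lambda>\<omega>. \<bar>(\<Sum>t\<in>{1..n}. (e (int t) \<omega>)\<^sup>2) / real n - \<Gamma>\<bar>)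
      \<le> sqrt (\<Gamma> - \<Gamma>N N) * sqrt (4 * \<Gamma>) + (\<Gamma> - \<Gamma>N N) + sqrt (real (4 * N + 1) * B4 / real n)" if n: "0 < n" for n N
  proof -
    let ?d = "\<lambda>t \<omega>. (e (int t) \<omega>)\<^sup>2 - (eN N (int t) \<omega>)\<^sup>2"
    let ?Y = "\<lambda>\<omega>. \<Sum>t\<in>{1..n}. (eN N (int t) \<omega>)\<^sup>2 - \<Gamma>N N"
    have id: "integrable M (?d t)" for t using e_int2 eN_int2 by simp
    have "expectation (\<lambda>\<omega>. \<bar>(\<Sum>t\<in>{1..n}. (e (int t) \<omega>)\<^sup>2) / real n - \<Gamma>\<bar>)
      \<le> expectation (\<lambda>\<omega>. (\<Sum>t\<in>{1..n}. \<bar>?d t \<omega>\<bar>) / real n + (\<Gamma> - \<Gamma>N N) + \<bar>?Y \<omega>\<bar> / real n)"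
    proof (rule integral_mono)
      show "integrable M (\<lambda>\<omega>. \<bar>(\<Sum>t\<in>{1..n}. (e (int t) \<omega>)\<^sup>2) / real n - \<Gamma>\<bar>)" using e_int2 by simp
      show "integrable M (\<lambda>\<omega>. (\<Sum>t\<in>{1..n}. \<bar>?d t \<omega>\<bar>) / real n + (\<Gamma> - \<Gamma>N N) + \<bar>?Y \<omega>\<bar> / real n)"
        by (intro Bochner_Integration.integrable_add Bochner_Integration.integrable_divide integrable_abs integrable_const
              Bochner_Integration.integrable_sum id eN_LLN)
      fix \<omega>
      have eq: "(\<Sum>t\<in>{1..n}. (e (int t) \<omega>)\<^sup>2) / real n - \<Gamma> = (\<Sum>t\<in>{1..n}. ?d t \<omega>) / real n - (\<Gamma> - \<Gamma>N N) + ?Y \<omega> / real n"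
        using n by (simp add: sum_subtractf field_simps)
      have tri: "\<bar>a - b + c\<bar> \<le> a' + b + \<bar>c\<bar>" if "\<bar>a\<bar> \<le> a'" "0 \<le> b" for a a' b c :: real
        using that by linarith
      have "\<bar>(\<Sum>t\<in>{1..n}. ?d t \<omega>) / real n\<bar> \<le> (\<Sum>t\<in>{1..n}. \<bar>?d t \<omega>\<bar>) / real n"
        unfolding abs_divide abs_of_nat by (intro divide_right_mono sum_abs) simp
      from tri[OF this, of "\<Gamma> - \<Gamma>N N" "?Y \<omega> / real n"] GammaN_le[of N]
      show "\<bar>(\<Sum>t\<in>{1..n}. (e (int t) \<omega>)\<^sup>2) / real n - \<Gamma>\<bar>
         \<le> (\<Sum>t\<in>{1..n}. \<bar>?d t \<omega>\<bar>) / real n + (\<Gamma> - \<Gamma>N N) + \<bar>?Y \<omega>\<bar> / real n"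
        unfolding eq by (simp only: abs_divide abs_of_nat diff_ge_0_iff_ge)
    qed
    also have "\<dots> = (\<Sum>t\<in>{1..n}. expectation (\<lambda>\<omega>. \<bar>?d t \<omega>\<bar>)) / real n + (\<Gamma> - \<Gamma>N N) + expectation (\<lambda>\<omega>. \<bar>?Y \<omega>\<bar>) / real n"
      using id eN_LLN(1)[of N n] by (simp add: Bochner_Integration.integral_add Bochner_Integration.integral_sum integrable_abs
          Bochner_Integration.integrable_sum prob_space del: One_nat_def)
    also have "\<dots> \<le> (\<Sum>t\<in>{1..n}. sqrt (\<Gamma> - \<Gamma>N N) * sqrt (4 * \<Gamma>)) / real n + (\<Gamma> - \<Gamma>N N) + sqrt (real n * (real (4 * N + 1) * B4)) / real n"
      by (intro add_mono divide_right_mono sum_mono eN_sq_L1 eN_LLN) auto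
    also have "(\<Sum>t\<in>{1..n}. sqrt (\<Gamma> - \<Gamma>N N) * sqrt (4 * \<Gamma>)) / real n = sqrt (\<Gamma> - \<Gamma>N N) * sqrt (4 * \<Gamma>)"
      using n by simp
    also have "sqrt (real n * (real (4 * N + 1) * B4)) / real n = sqrt (real (4 * N + 1) * B4 / real n)"
    proof -
      have "sqrt (real n * (real (4 * N + 1) * B4)) / real n = sqrt (real n * (real (4 * N + 1) * B4) / (real n)\<^sup>2)"
        by (simp add: real_sqrt_divide)
      then show ?thesis using n by (simp add: power2_eq_square)
    qed
    finally show ?thesis .
  qed
  show ?thesis
  proof (rule LIMSEQ_I)
    fix \<epsilon> :: real assume "0 < \<epsilon>"
    have "(\<lambda>N. sqrt (\<Gamma> - \<Gamma>N N) * sqrt (4 * \<Gamma>) + (\<Gamma> - \<Gamma>N N)) \<longlonglongrightarrow> sqrt (\<Gamma> - \<Gamma>) * sqrt (4 * \<Gamma>) + (\<Gamma> - \<Gamma>)"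
      by (intro tendsto_intros GammaN_lim)
    then have "eventually (\<lambda>N. sqrt (\<Gamma> - \<Gamma>N N) * sqrt (4 * \<Gamma>) + (\<Gamma> - \<Gamma>N N) < \<epsilon> / 2) sequentially"
      using \<open>0 < \<epsilon>\<close> by (intro order_tendstoD(2)) auto
    then obtain N where N: "sqrt (\<Gamma> - \<Gamma>N N) * sqrt (4 * \<Gamma>) + (\<Gamma> - \<Gamma>N N) < \<epsilon> / 2"
      by (auto simp: eventually_sequentially)
    have "(\<lambda>n. sqrt (real (4 * N + 1) * B4 / real n)) \<longlonglongrightarrow> sqrt 0"
      by (intro tendsto_real_sqrt lim_const_over_n)
    then have "eventually (\<lambda>n. sqrt (real (4 * N + 1) * B4 / real n) < \<epsilon> / 2) sequentially"
      using \<open>0 < \<epsilon>\<close> by (intro order_tendstoD(2)) auto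
    then have "eventually (\<lambda>n. norm (expectation (\<lambda>\<omega>. \<bar>(\<Sum>t\<in>{1..n}. (e (int t) \<omega>)\<^sup>2) / real n - \<Gamma>\<bar>) - 0) < \<epsilon>) sequentially"
      using eventually_gt_at_top[of 0]
    proof eventually_elim
      case (elim n)
      have "0 \<le> expectation (\<lambda>\<omega>. \<bar>(\<Sum>t\<in>{1..n}. (e (int t) \<omega>)\<^sup>2) / real n - \<Gamma>\<bar>)"
        by (rule Bochner_Integration.integral_nonneg) simp
      then show ?case using bound[OF elim(2), of N] N elim(1) by simp
    qed
    then show "\<exists>no. \<forall>n\<ge>no. norm (expectation (\<lambda>\<omega>. \<bar>(\<Sum>t\<in>{1..n}. (e (int t) \<omega>)\<^sup>2) / real n - \<Gamma>\<bar>) - 0) < \<epsilon>"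
      by (simp add: eventually_sequentially)
  qed
qed

end

section \<open>Long memory and kernel smoothing asymptotics\<close>

text \<open>The Stolz-Cesaro theorem, stated through the increments of the two sequences.\<close>

lemma weighted_cesaro:
  fixes a b :: "nat \<Rightarrow> real"
  assumes b: "\<And>k. 1 \<le> k \<Longrightarrow> 0 < b k"
    and top: "filterlim (\<lambda>n. \<Sum>k\<in>{1..n}. b k) at_top sequentially"
    and lim: "(\<lambda>k. a k / b k) \<longlonglongrightarrow> c"
  shows "(\<lambda>n. (\<Sum>k\<in>{1..n}. a k) / (\<Sum>k\<in>{1..n}. b k)) \<longlonglongrightarrow> c"
proof (rule LIMSEQ_I)
  fix \<epsilon> :: real assume "0 < \<epsilon>"
  then obtain N where N: "\<And>k. k \<ge> N \<Longrightarrow> \<bar>a k / b k - c\<bar> < \<epsilon> / 2"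
    using LIMSEQ_D[OF lim, of "\<epsilon> / 2"] by auto
  \<comment> \<open>\<open>b\<close> is known to be positive only from index one on.\<close>
  define m where "m = max N 1"
  have Nb: "\<bar>a k - c * b k\<bar> \<le> \<epsilon> / 2 * b k" if "k \<ge> m" for k
  proof -
    have "0 < b k" "\<bar>a k / b k - c\<bar> < \<epsilon> / 2" using that b N by (auto simp: m_def)
    moreover have "a k - c * b k = (a k / b k - c) * b k" using \<open>0 < b k\<close> by (simp add: field_simps)
    ultimately show ?thesis by (simp add: abs_mult mult_right_mono)
  qed
  define R where "R = (\<Sum>k\<in>{1..<m}. \<bar>a k - c * b k\<bar>)"
  have "eventually (\<lambda>n. (\<Sum>k\<in>{1..n}. b k) > 2 * R / \<epsilon>) sequentially"
    "eventually (\<lambda>n. (\<Sum>k\<in>{1..n}. b k) > 0) sequentially"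
    using top by (auto simp: filterlim_at_top_dense)
  then have "eventually (\<lambda>n. norm ((\<Sum>k\<in>{1..n}. a k) / (\<Sum>k\<in>{1..n}. b k) - c) < \<epsilon>) sequentially"
    using eventually_ge_at_top[of m]
  proof eventually_elim
    case (elim n)
    let ?B = "\<Sum>k\<in>{1..n}. b k"
    have split: "{1..n} = {1..<m} \<union> {m..n}" using elim by (auto simp: m_def)
    have "\<bar>(\<Sum>k\<in>{1..n}. a k) - c * ?B\<bar> = \<bar>\<Sum>k\<in>{1..n}. a k - c * b k\<bar>"
      by (simp add: sum_subtractf sum_distrib_left)
    also have "\<dots> \<le> (\<Sum>k\<in>{1..n}. \<bar>a k - c * b k\<bar>)" by (rule sum_abs)
    also have "\<dots> = R + (\<Sum>k\<in>{m..n}. \<bar>a k - c * b k\<bar>)"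
      unfolding R_def split by (rule sum.union_disjoint) auto
    also have "\<dots> \<le> R + (\<Sum>k\<in>{m..n}. \<epsilon> / 2 * b k)"
      using Nb by (intro add_left_mono sum_mono) auto
    also have "\<dots> \<le> R + (\<Sum>k\<in>{1..n}. \<epsilon> / 2 * b k)"
      using b \<open>0 < \<epsilon>\<close> by (intro add_left_mono sum_mono2) (auto simp: m_def less_imp_le)
    also have "\<dots> = R + \<epsilon> / 2 * ?B" by (simp add: sum_distrib_left)
    also have "\<dots> < \<epsilon> * ?B" using elim(1) \<open>0 < \<epsilon>\<close> by (simp add: field_simps)
    finally have "\<bar>(\<Sum>k\<in>{1..n}. a k) - c * ?B\<bar> < \<epsilon> * ?B" .
    moreover have "(\<Sum>k\<in>{1..n}. a k) / ?B - c = ((\<Sum>k\<in>{1..n}. a k) - c * ?B) / ?B"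
      using elim(2) by (simp add: field_simps)
    ultimately show ?case using elim(2) by (simp add: abs_divide pos_divide_less_eq)
  qed
  then show "\<exists>N. \<forall>n\<ge>N. norm ((\<Sum>k\<in>{1..n}. a k) / (\<Sum>k\<in>{1..n}. b k) - c) < \<epsilon>"
    by (simp add: eventually_sequentially)
qed

text \<open>Instead of comparing with an integral, the summands are compared with increments of
  k^(p+1), which sum exactly to n^(p+1) and are equivalent to (p+1) k^p. This is the source of the
  factor 1/(p+1).\<close>

lemma sum_powr_asymptotics:
  fixes a :: "nat \<Rightarrow> real"
  assumes p: "- 1 < p" and lim: "(\<lambda>k. a k / real k powr p) \<longlonglongrightarrow> c"
  shows "(\<lambda>n. (\<Sum>k\<in>{1..n}. a k) / real n powr (p + 1)) \<longlonglongrightarrow> c / (p + 1)"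
proof -
  \<comment> \<open>The telescoping sum starts at k = 1, where the subtracted term is
    \<open>0 powr (p + 1)\<close>, that is 0.\<close>
  define b where "b k = real k powr (p + 1) - (real k - 1) powr (p + 1)" for k
  have sb: "(\<Sum>k\<in>{1..n}. b k) = real n powr (p + 1)" for n
    by (induction n) (auto simp: b_def)
  have b: "0 < b k" if "1 \<le> k" for k
    unfolding b_def using that p powr_less_mono2[of "p + 1" "real k - 1" "real k"] by simp
  have top: "filterlim (\<lambda>n. \<Sum>k\<in>{1..n}. b k) at_top sequentially"
    unfolding sb using p by real_asymp
  have bl: "(\<lambda>k. b k / real k powr p) \<longlonglongrightarrow> p + 1"
    unfolding b_def using p by real_asymp
  have "(\<lambda>k. (a k / real k powr p) / (b k / real k powr p)) \<longlonglongrightarrow> c / (p + 1)"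
    using p by (intro tendsto_divide lim bl) auto
  then have "(\<lambda>k. a k / b k) \<longlonglongrightarrow> c / (p + 1)"
    by (rule Lim_transform_eventually) (rule eventually_mono[OF eventually_gt_at_top[of 0]], simp)
  from weighted_cesaro[OF b top this] show ?thesis unfolding sb .
qed

lemma toeplitz_sum_Suc:
  fixes \<gamma> :: "int \<Rightarrow> real"
  assumes "\<And>k. \<gamma> (- k) = \<gamma> k"
  shows "(\<Sum>s\<in>{1..Suc n}. \<Sum>t\<in>{1..Suc n}. \<gamma> (int t - int s))
       = (\<Sum>s\<in>{1..n}. \<Sum>t\<in>{1..n}. \<gamma> (int t - int s)) + (\<gamma> 0 + 2 * (\<Sum>k\<in>{1..n}. \<gamma> (int k)))"
proof -
  have *: "(\<Sum>s\<in>{1..n}. \<gamma> (1 + int n - int s)) = (\<Sum>k\<in>{1..n}. \<gamma> (int k))"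
    by (rule sum.reindex_bij_witness[where i="\<lambda>k. Suc n - k" and j="\<lambda>k. Suc n - k"]) (auto simp: of_nat_diff algebra_simps)
  moreover have "(\<Sum>s\<in>{1..n}. \<gamma> (int s - (1 + int n))) = (\<Sum>s\<in>{1..n}. \<gamma> (1 + int n - int s))"
    using assms by (intro sum.cong refl) (metis minus_diff_eq)
  ultimately show ?thesis by (simp add: sum.distrib)
qed

text \<open>The power-sum lemma is used twice: over the lags with exponent -\<alpha> and over the
  matrix size with exponent 1-\<alpha>. The two uses supply the factors 1/(1-\<alpha>) and
  1/(2-\<alpha>), and the symmetry of \<gamma> supplies the 2.\<close>

lemma toeplitz_sum_asymptotics:
  fixes \<gamma> :: "int \<Rightarrow> real"
  assumes even: "\<And>k. \<gamma> (- k) = \<gamma> k" and \<alpha>: "0 < \<alpha>" "\<alpha> < 1"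
    and lim: "(\<lambda>k. \<gamma> (int k) / real k powr (- \<alpha>)) \<longlonglongrightarrow> \<eta>"
  shows "(\<lambda>n. (\<Sum>s\<in>{1..n}. \<Sum>t\<in>{1..n}. \<gamma> (int t - int s)) / real n powr (2 - \<alpha>))
            \<longlonglongrightarrow> 2 * \<eta> / ((1 - \<alpha>) * (2 - \<alpha>))"
proof -
  define g where "g m = (\<Sum>k\<in>{1..m}. \<gamma> (int k))" for m
  \<comment> \<open>Enlarging the matrix to size m adds the lags 1 to m - 1 twice. The shift from m
    - 1 to m changes the sum only by a relative amount of order 1/m.\<close>
  define a where "a m = \<gamma> 0 + 2 * g (m - 1)" for m
  have V: "(\<Sum>s\<in>{1..n}. \<Sum>t\<in>{1..n}. \<gamma> (int t - int s)) = (\<Sum>m\<in>{1..n}. a m)" for n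
  proof (induction n)
    case (Suc n)
    then show ?case unfolding toeplitz_sum_Suc[of \<gamma>, OF even] by (simp add: a_def g_def)
  qed simp
  have g: "(\<lambda>m. g m / real m powr (1 - \<alpha>)) \<longlonglongrightarrow> \<eta> / (1 - \<alpha>)"
    using sum_powr_asymptotics[OF _ lim] \<alpha> unfolding g_def by (simp add: algebra_simps)
  have "(\<lambda>m. \<gamma> 0 * real m powr (\<alpha> - 1) + 2 * (g m / real m powr (1 - \<alpha>)
            - (\<gamma> (int m) / real m powr (- \<alpha>)) * real m powr (- 1)))
        \<longlonglongrightarrow> \<gamma> 0 * 0 + 2 * (\<eta> / (1 - \<alpha>) - \<eta> * 0)"
  proof (intro tendsto_add tendsto_mult tendsto_diff tendsto_const g lim)
    show "(\<lambda>m. real m powr (\<alpha> - 1)) \<longlonglongrightarrow> 0" using \<alpha> by real_asymp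
    show "(\<lambda>m. real m powr (- 1)) \<longlonglongrightarrow> 0" by real_asymp
  qed
  then have "(\<lambda>m. a m / real m powr (1 - \<alpha>)) \<longlonglongrightarrow> \<gamma> 0 * 0 + 2 * (\<eta> / (1 - \<alpha>) - \<eta> * 0)"
  proof (rule Lim_transform_eventually)
    show "eventually (\<lambda>m. \<gamma> 0 * real m powr (\<alpha> - 1) + 2 * (g m / real m powr (1 - \<alpha>)
            - (\<gamma> (int m) / real m powr (- \<alpha>)) * real m powr (- 1)) = a m / real m powr (1 - \<alpha>)) sequentially"
      using eventually_ge_at_top[of 1]
    proof eventually_elim
      case (elim m)
      then obtain k where k: "m = Suc k" by (cases m) auto
      have g1: "g (m - 1) = g m - \<gamma> (int m)" unfolding g_def k by simp
      have r1: "real m powr (\<alpha> - 1) = 1 / real m powr (1 - \<alpha>)"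
        using powr_minus_divide[of "real m" "1 - \<alpha>"] by simp
      have r2: "\<gamma> (int m) / real m powr (- \<alpha>) * real m powr (- 1) = \<gamma> (int m) / real m powr (1 - \<alpha>)"
        using elim by (simp add: powr_minus powr_diff field_simps)
      show ?case unfolding a_def g1 r1 r2 by (simp add: add_divide_distrib diff_divide_distrib)
    qed
  qed
  from sum_powr_asymptotics[OF _ this] \<alpha> show ?thesis unfolding V by (simp add: algebra_simps)
qed

text \<open>The substitution y = x - h z turns the inner integral into h times an average of f near
  x. Boundedness and continuity of f then allow dominated convergence, first inside and then
  outside. The general \<kappa> serves both K and its square.\<close>

lemma kernel_smoothing_limit:
  fixes f \<kappa> :: "real \<Rightarrow> real" and h :: "nat \<Rightarrow> real"
  assumes f: "integrable lborel f" "\<And>x. \<bar>f x\<bar> \<le> B" "continuous_on UNIV f"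
    and \<kappa>: "integrable lborel \<kappa>" and h: "\<And>n. 0 < h n" "h \<longlonglongrightarrow> 0"
  shows "(\<lambda>n. (\<integral>x. f x * (\<integral>y. \<kappa> ((x - y) / h n) * f y \<partial>lborel) \<partial>lborel) / h n)
           \<longlonglongrightarrow> (\<integral>x. \<kappa> x \<partial>lborel) * (\<integral>y. (f y)\<^sup>2 \<partial>lborel)"
proof -
  have [measurable]: "f \<in> borel_measurable borel" "\<kappa> \<in> borel_measurable borel" using f \<kappa> by auto
  have "0 \<le> B" using f(2)[of 0] by simp
  have sub: "(\<integral>y. \<kappa> ((x - y) / h n) * f y \<partial>lborel) = h n * (\<integral>z. \<kappa> z * f (x - h n * z) \<partial>lborel)" for x n
    using lborel_integral_real_affine[of "- h n" "\<lambda>y. \<kappa> ((x - y) / h n) * f y" x] h(1)[of n]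
    by simp
  define I where "I n x = (\<integral>z. \<kappa> z * f (x - h n * z) \<partial>lborel)" for n x
  have I_lim: "(\<lambda>n. I n x) \<longlonglongrightarrow> (\<integral>z. \<kappa> z * f x \<partial>lborel)" for x
    unfolding I_def
  proof (rule integral_dominated_convergence)
    show "integrable lborel (\<lambda>z. \<bar>\<kappa> z\<bar> * B)" using \<kappa> by simp
    show "AE z in lborel. (\<lambda>n. \<kappa> z * f (x - h n * z)) \<longlonglongrightarrow> \<kappa> z * f x"
    proof (rule AE_I2)
      fix z
      have "(\<lambda>n. x - h n * z) \<longlonglongrightarrow> x" using tendsto_diff[OF tendsto_const tendsto_mult_left_zero[OF h(2)], of x z] by simp
      then have "(\<lambda>n. f (x - h n * z)) \<longlonglongrightarrow> f x"
        using f(3) continuous_on_tendsto_compose[OF f(3)] by auto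
      then show "(\<lambda>n. \<kappa> z * f (x - h n * z)) \<longlonglongrightarrow> \<kappa> z * f x" by (rule tendsto_mult_left)
    qed
    show "AE z in lborel. norm (\<kappa> z * f (x - h n * z)) \<le> \<bar>\<kappa> z\<bar> * B" for n
      using f(2) by (auto simp: abs_mult intro!: mult_left_mono)
  qed auto
  have I_bdd: "\<bar>I n x\<bar> \<le> (\<integral>z. \<bar>\<kappa> z\<bar> * B \<partial>lborel)" for n x
    unfolding I_def
  proof (rule integral_abs_bound_integral)
    show dom: "integrable lborel (\<lambda>z. \<bar>\<kappa> z\<bar> * B)" using \<kappa> by simp
    show le: "\<bar>\<kappa> z * f (x - h n * z)\<bar> \<le> \<bar>\<kappa> z\<bar> * B" for z
      using f(2) by (auto simp: abs_mult intro!: mult_left_mono)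
    show "integrable lborel (\<lambda>z. \<kappa> z * f (x - h n * z))"
      by (rule Bochner_Integration.integrable_bound[OF dom])
         (use le in \<open>auto intro: order_trans[OF _ abs_ge_self]\<close>)
  qed
  have "(\<lambda>n. (\<integral>x. f x * I n x \<partial>lborel)) \<longlonglongrightarrow> (\<integral>x. f x * (\<integral>z. \<kappa> z * f x \<partial>lborel) \<partial>lborel)"
  proof (rule integral_dominated_convergence)
    show "integrable lborel (\<lambda>x. \<bar>f x\<bar> * (\<integral>z. \<bar>\<kappa> z\<bar> * B \<partial>lborel))" using f by simp
    show "AE x in lborel. (\<lambda>n. f x * I n x) \<longlonglongrightarrow> f x * (\<integral>z. \<kappa> z * f x \<partial>lborel)"
      by (intro AE_I2 tendsto_mult_left I_lim)
    show "AE x in lborel. norm (f x * I n x) \<le> \<bar>f x\<bar> * (\<integral>z. \<bar>\<kappa> z\<bar> * B \<partial>lborel)" for n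
      using I_bdd by (auto simp: abs_mult intro!: mult_left_mono)
    show "(\<lambda>x. f x * I n x) \<in> borel_measurable lborel" for n unfolding I_def by measurable
    show "(\<lambda>x. f x * (\<integral>z. \<kappa> z * f x \<partial>lborel)) \<in> borel_measurable lborel" by simp
  qed
  moreover have "(\<integral>x. f x * (\<integral>y. \<kappa> ((x - y) / h n) * f y \<partial>lborel) \<partial>lborel) / h n = (\<integral>x. f x * I n x \<partial>lborel)" for n
    unfolding sub I_def using h(1)[of n] by (simp add: mult.left_commute[of _ "h n"])
  moreover have "(\<integral>x. f x * (\<integral>z. \<kappa> z * f x \<partial>lborel) \<partial>lborel) = (\<integral>x. \<kappa> x \<partial>lborel) * (\<integral>y. (f y)\<^sup>2 \<partial>lborel)"
    by (simp add: power2_eq_square mult.left_commute[of "f _"])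
  ultimately show ?thesis by simp
qed

locale smoothing =
  fixes f K :: "real \<Rightarrow> real" and Bf BK :: real
  assumes f_nonneg: "\<And>x. 0 \<le> f x" and f_le: "\<And>x. f x \<le> Bf" and f_cont: "continuous_on UNIV f"
    and f_prob: "prob_space (density lborel (\<lambda>x. ennreal (f x)))"
    and K_meas[measurable]: "K \<in> borel_measurable borel" and K_nonneg: "\<And>x. 0 \<le> K x" and K_le: "\<And>x. K x \<le> BK"
    and K_int: "integrable lborel K" and K_one: "(\<integral>x. K x \<partial>lborel) = 1" and K_sym: "\<And>x. K (- x) = K x"
begin

definition F :: "real measure" where "F = density lborel (\<lambda>x. ennreal (f x))"

lemma f_meas[measurable]: "f \<in> borel_measurable borel"
  using f_cont by (rule borel_measurable_continuous_onI)

lemma sets_F[measurable_cong, simp]: "sets F = sets borel"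
  by (simp add: F_def)

lemma real_distribution_F: "real_distribution F"
  unfolding real_distribution_def real_distribution_axioms_def using f_prob by (simp add: F_def)

sublocale F: real_distribution F
  by (rule real_distribution_F)

lemma Bf_nonneg: "0 \<le> Bf" using f_nonneg[of 0] f_le[of 0] by linarith

lemma BK_nonneg: "0 \<le> BK" using K_nonneg[of 0] K_le[of 0] by linarith

lemma integral_F: "g \<in> borel_measurable borel \<Longrightarrow> (\<integral>x. g x \<partial>F) = (\<integral>x. f x * g x \<partial>lborel)" for g :: "real \<Rightarrow> real"
  unfolding F_def by (subst integral_density) (auto simp: f_nonneg)

lemma integrable_f: "integrable lborel f"
proof -
  have "integrable F (\<lambda>x. 1 :: real)" by simp
  then show ?thesis unfolding F_def by (subst (asm) integrable_density) (auto simp: f_nonneg)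
qed

lemma integrable_f_sq: "integrable lborel (\<lambda>x. (f x)\<^sup>2)"
  by (rule Bochner_Integration.integrable_bound[OF integrable_mult_right[OF integrable_f, of Bf]])
     (auto simp: power2_eq_square f_nonneg Bf_nonneg intro!: mult_right_mono f_le)

lemma integrable_K_sq: "integrable lborel (\<lambda>x. (K x)\<^sup>2)"
  by (rule Bochner_Integration.integrable_bound[OF integrable_mult_right[OF K_int, of BK]])
     (auto simp: power2_eq_square K_nonneg BK_nonneg intro!: mult_right_mono K_le)

text \<open>In contrast to the limit of the averages, this holds for every bandwidth and uniformly
  in \<open>x\<close>, as the L1 bound on a degenerate kernel demands.\<close>

lemma smoothing_bound:
  fixes \<kappa> :: "real \<Rightarrow> real"
  assumes \<kappa>: "integrable lborel \<kappa>" "\<And>x. 0 \<le> \<kappa> x" and b: "0 < b"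
  shows "(\<integral>y. \<kappa> ((x - y) / b) \<partial>F) \<le> Bf * (\<integral>x. \<kappa> x \<partial>lborel) * b"
proof -
  have [measurable]: "\<kappa> \<in> borel_measurable borel" using \<kappa> by auto
  have *: "((\<lambda>y. \<kappa> ((x - y) / b))) (x + - b * z) = \<kappa> z" for z using b by simp
  have int: "integrable lborel (\<lambda>y. \<kappa> ((x - y) / b))"
    using lborel_integrable_real_affine_iff[of "- b" "\<lambda>y. \<kappa> ((x - y) / b)" x] b \<kappa>(1) unfolding * by simp
  have "(\<integral>y. \<kappa> ((x - y) / b) \<partial>F) = (\<integral>y. f y * \<kappa> ((x - y) / b) \<partial>lborel)" by (rule integral_F) measurable
  also have "\<dots> \<le> (\<integral>y. Bf * \<kappa> ((x - y) / b) \<partial>lborel)"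
  proof (rule integral_mono)
    show "integrable lborel (\<lambda>y. Bf * \<kappa> ((x - y) / b))" using int by simp
    then show "integrable lborel (\<lambda>y. f y * \<kappa> ((x - y) / b))"
      by (rule Bochner_Integration.integrable_bound) (auto simp: abs_mult f_nonneg Bf_nonneg \<kappa>(2) intro!: mult_right_mono f_le)
  qed (auto intro!: mult_right_mono f_le \<kappa>(2))
  also have "\<dots> = Bf * (b * (\<integral>x. \<kappa> x \<partial>lborel))"
    using lborel_integral_real_affine[of "- b" "\<lambda>y. \<kappa> ((x - y) / b)" x] b unfolding * by simp
  finally show ?thesis by (simp add: algebra_simps)
qed

definition Kb :: "real \<Rightarrow> real \<Rightarrow> real \<Rightarrow> real" where "Kb b x y = K ((x - y) / b)"
definition g :: "real \<Rightarrow> real \<Rightarrow> real" where "g b x = (\<integral>y. Kb b x y \<partial>F)"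
definition \<mu> :: "real \<Rightarrow> real" where "\<mu> b = (\<integral>x. g b x \<partial>F)"
definition H :: "real \<Rightarrow> real \<Rightarrow> real \<Rightarrow> real" where "H b x y = Kb b x y - g b x - g b y + \<mu> b"

lemma Kb_meas[measurable]: "(\<lambda>(x, y). Kb b x y) \<in> borel_measurable (borel \<Otimes>\<^sub>M borel)"
  unfolding Kb_def by measurable

lemma Kb_meas2[measurable]: "Kb b x \<in> borel_measurable borel"
  unfolding Kb_def by measurable

lemma Kb_bounds: "0 \<le> Kb b x y" "Kb b x y \<le> BK" "\<bar>Kb b x y\<bar> \<le> BK"
  using K_nonneg K_le by (auto simp: Kb_def)

lemma Kb_sym: "Kb b x y = Kb b y x"
  unfolding Kb_def using K_sym[of "(x - y) / b"] by (simp add: minus_divide_left)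

lemma g_meas[measurable]: "g b \<in> borel_measurable borel"
  unfolding g_def by measurable

lemma integrable_Kb: "integrable F (Kb b x)"
  by (rule F.integrable_const_bound[where B=BK]) (auto simp: Kb_bounds)

lemma g_bounds:
  assumes "0 < b" shows "0 \<le> g b x" "g b x \<le> Bf * b"
proof -
  show "0 \<le> g b x" unfolding g_def by (intro Bochner_Integration.integral_nonneg Kb_bounds)
  show "g b x \<le> Bf * b"
    unfolding g_def Kb_def using smoothing_bound[OF K_int K_nonneg assms, of x] K_one by simp
qed

lemma integrable_g: "0 < b \<Longrightarrow> integrable F (g b)"
  by (rule F.integrable_const_bound[where B="Bf * b"]) (use g_bounds in auto)

lemma \<mu>_bounds:
  assumes "0 < b" shows "0 \<le> \<mu> b" "\<mu> b \<le> Bf * b"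
proof -
  show "0 \<le> \<mu> b" unfolding \<mu>_def by (intro Bochner_Integration.integral_nonneg g_bounds assms)
  have "\<mu> b \<le> (\<integral>x. Bf * b \<partial>F)"
    unfolding \<mu>_def using integrable_g g_bounds assms by (intro integral_mono) auto
  then show "\<mu> b \<le> Bf * b" by (simp add: F.prob_UNIV)
qed

text \<open>Each of the four terms of the Hoeffding decomposition integrates to at most
  \<open>Bf * b\<close>, hence the 4. The restriction to bandwidths at most one makes the supremum
  bound independent of \<open>b\<close>.\<close>

lemma H_kernel:
  assumes b: "0 < b" "b \<le> 1"
  shows "degenerate_kernel F (H b) (BK + 3 * Bf) (4 * Bf * b)"
proof
  show "(\<lambda>(x, y). H b x y) \<in> borel_measurable (borel \<Otimes>\<^sub>M borel)" unfolding H_def by measurable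
  show "H b x y = H b y x" for x y unfolding H_def using Kb_sym[of b x y] by simp
  have Bb: "Bf * b \<le> Bf" using b Bf_nonneg by (simp add: mult_left_le)
  show "\<bar>H b x y\<bar> \<le> BK + 3 * Bf" for x y
    using Kb_bounds[of b x y] g_bounds[OF b(1), of x] g_bounds[OF b(1), of y] \<mu>_bounds[OF b(1)] Bb Bf_nonneg
    unfolding H_def by linarith
  note int = integrable_Kb integrable_g[OF b(1)]
  show "(\<integral>y. H b x y \<partial>F) = 0" for x
    unfolding H_def using int by (simp add: F.prob_UNIV flip: g_def \<mu>_def)
  show "(\<integral>y. \<bar>H b x y\<bar> \<partial>F) \<le> 4 * Bf * b" for x
  proof -
    have "(\<integral>y. \<bar>H b x y\<bar> \<partial>F) \<le> (\<integral>y. Kb b x y + g b x + g b y + \<mu> b \<partial>F)"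
    proof (rule integral_mono)
      show "integrable F (\<lambda>y. \<bar>H b x y\<bar>)" unfolding H_def using int by simp
      show "integrable F (\<lambda>y. Kb b x y + g b x + g b y + \<mu> b)" using int by simp
      show "\<bar>H b x y\<bar> \<le> Kb b x y + g b x + g b y + \<mu> b" for y
        using Kb_bounds[of b x y] g_bounds[OF b(1), of x] g_bounds[OF b(1), of y] \<mu>_bounds[OF b(1)]
        unfolding H_def by linarith
    qed
    also have "\<dots> = 2 * g b x + 2 * \<mu> b"
      using int by (simp add: F.prob_UNIV flip: g_def \<mu>_def)
    also have "\<dots> \<le> 4 * Bf * b" using g_bounds[OF b(1), of x] \<mu>_bounds[OF b(1)] by linarith
    finally show ?thesis .
  qed
qed

lemma \<mu>_limit:
  assumes "\<And>n. 0 < h n" "h \<longlonglongrightarrow> 0"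
  shows "(\<lambda>n. \<mu> (h n) / h n) \<longlonglongrightarrow> (\<integral>y. (f y)\<^sup>2 \<partial>lborel)"
proof -
  have "\<mu> (h n) = (\<integral>x. f x * (\<integral>y. K ((x - y) / h n) * f y \<partial>lborel) \<partial>lborel)" for n
    unfolding \<mu>_def integral_F[OF g_meas] g_def Kb_def by (subst integral_F) (auto simp: mult.commute)
  then show ?thesis
    using kernel_smoothing_limit[OF integrable_f, of Bf, OF _ f_cont K_int assms] f_nonneg f_le K_one by simp
qed

definition k2 :: "real \<Rightarrow> real" where "k2 b = (\<integral>x. (\<integral>y. (Kb b x y)\<^sup>2 \<partial>F) \<partial>F)"

lemma k2_limit:
  assumes "\<And>n. 0 < h n" "h \<longlonglongrightarrow> 0"
  shows "(\<lambda>n. k2 (h n) / h n) \<longlonglongrightarrow> (\<integral>x. (K x)\<^sup>2 \<partial>lborel) * (\<integral>y. (f y)\<^sup>2 \<partial>lborel)"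
proof -
  have [measurable]: "(\<lambda>x. \<integral>y. (Kb b x y)\<^sup>2 \<partial>F) \<in> borel_measurable borel" for b by measurable
  have "k2 (h n) = (\<integral>x. f x * (\<integral>y. (K ((x - y) / h n))\<^sup>2 * f y \<partial>lborel) \<partial>lborel)" for n
    unfolding k2_def by (subst integral_F, simp, unfold Kb_def, subst integral_F) (auto simp: mult.commute)
  then show ?thesis
    using kernel_smoothing_limit[OF integrable_f, of Bf, OF _ f_cont integrable_K_sq assms] f_nonneg f_le by simp
qed

text \<open>The correction \<open>r\<close> is O(b) uniformly and the mean of \<open>Kb\<close> is
  O(b). Its square and its product with \<open>Kb\<close> therefore contribute O(b^2), with 9 and 6
  adding up to 15, while \<open>k2\<close> itself is of order b.\<close>

lemma kernel_var_approx:
  assumes b: "0 < b" "b \<le> 1"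
  shows "\<bar>degenerate_kernel.kernel_var F (H b) - k2 b\<bar> \<le> 15 * Bf\<^sup>2 * b\<^sup>2"
proof -
  interpret D: degenerate_kernel F "H b" "BK + 3 * Bf" "4 * Bf * b" by (rule H_kernel[OF b])
  define r where "r x y = g b x + g b y - \<mu> b" for x y
  have r: "\<bar>r x y\<bar> \<le> 3 * Bf * b" for x y
    using g_bounds[OF b(1), of x] g_bounds[OF b(1), of y] \<mu>_bounds[OF b(1)] unfolding r_def by linarith
  have H: "H b x y = Kb b x y - r x y" for x y unfolding H_def r_def by simp
  have pt: "\<bar>(H b x y)\<^sup>2 - (Kb b x y)\<^sup>2\<bar> \<le> 6 * Bf * b * Kb b x y + 9 * Bf\<^sup>2 * b\<^sup>2" for x y
  proof -
    have "(H b x y)\<^sup>2 - (Kb b x y)\<^sup>2 = (r x y)\<^sup>2 - 2 * Kb b x y * r x y"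
      unfolding H by (simp add: power2_eq_square algebra_simps)
    also have "\<bar>\<dots>\<bar> \<le> \<bar>r x y\<bar>\<^sup>2 + 2 * Kb b x y * \<bar>r x y\<bar>"
      using Kb_bounds(1)[of b x y] abs_triangle_ineq4[of "(r x y)\<^sup>2" "2 * Kb b x y * r x y"] by (simp add: abs_mult)
    also have "\<dots> \<le> (3 * Bf * b)\<^sup>2 + 2 * Kb b x y * (3 * Bf * b)"
      using Kb_bounds(1)[of b x y] r[of x y] by (intro add_mono mult_left_mono power_mono) auto
    finally show ?thesis by (simp add: power_mult_distrib algebra_simps)
  qed
  have iH: "integrable F (\<lambda>y. (H b x y)\<^sup>2)" for x
    by (rule D.integrable_bounded[OF F.prob_space_axioms, where B="(BK + 3 * Bf)\<^sup>2"])
       (use power_mono[OF D.H_bdd, of _ _ 2] in auto)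
  have iK: "integrable F (\<lambda>y. (Kb b x y)\<^sup>2)" for x
    by (rule D.integrable_bounded[OF F.prob_space_axioms, where B="BK\<^sup>2"])
       (use power_mono[OF Kb_bounds(3), of _ _ _ 2] in auto)
  have inner: "\<bar>(\<integral>y. (H b x y)\<^sup>2 \<partial>F) - (\<integral>y. (Kb b x y)\<^sup>2 \<partial>F)\<bar> \<le> 15 * Bf\<^sup>2 * b\<^sup>2" for x
  proof -
    have "\<bar>(\<integral>y. (H b x y)\<^sup>2 \<partial>F) - (\<integral>y. (Kb b x y)\<^sup>2 \<partial>F)\<bar> = \<bar>\<integral>y. (H b x y)\<^sup>2 - (Kb b x y)\<^sup>2 \<partial>F\<bar>"
      using iH iK by simp
    also have "\<dots> \<le> (\<integral>y. 6 * Bf * b * Kb b x y + 9 * Bf\<^sup>2 * b\<^sup>2 \<partial>F)"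
      using iH iK integrable_Kb by (intro integral_abs_bound_integral pt) auto
    also have "\<dots> = 6 * Bf * b * g b x + 9 * Bf\<^sup>2 * b\<^sup>2"
      using integrable_Kb by (simp add: F.prob_UNIV flip: g_def)
    also have "\<dots> \<le> 6 * Bf * b * (Bf * b) + 9 * Bf\<^sup>2 * b\<^sup>2"
      using g_bounds[OF b(1), of x] b Bf_nonneg by (intro add_right_mono mult_left_mono) auto
    finally show ?thesis by (simp add: power2_eq_square algebra_simps)
  qed
  have oH: "integrable F (\<lambda>x. \<integral>y. (H b x y)\<^sup>2 \<partial>F)"
    by (rule D.integrable_bounded[OF F.prob_space_axioms, where B="(BK + 3 * Bf) * (4 * Bf * b)"])
       (use D.H_power_L1(1) in \<open>auto simp: Bochner_Integration.integral_nonneg\<close>)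
  have oK: "integrable F (\<lambda>x. \<integral>y. (Kb b x y)\<^sup>2 \<partial>F)"
  proof (rule D.integrable_bounded[OF F.prob_space_axioms, where B="(BK + 3 * Bf) * (4 * Bf * b) + 15 * Bf\<^sup>2 * b\<^sup>2"])
    fix x
    have "0 \<le> (\<integral>y. (Kb b x y)\<^sup>2 \<partial>F)" by (rule Bochner_Integration.integral_nonneg) simp
    then show "norm (\<integral>y. (Kb b x y)\<^sup>2 \<partial>F) \<le> (BK + 3 * Bf) * (4 * Bf * b) + 15 * Bf\<^sup>2 * b\<^sup>2"
      using inner[of x] D.H_power_L1(1)[of x] by simp
  qed measurable
  have "\<bar>D.kernel_var - k2 b\<bar> = \<bar>\<integral>x. (\<integral>y. (H b x y)\<^sup>2 \<partial>F) - (\<integral>y. (Kb b x y)\<^sup>2 \<partial>F) \<partial>F\<bar>"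
    unfolding D.kernel_var_def k2_def using oH oK by simp
  also have "\<dots> \<le> (\<integral>x. 15 * Bf\<^sup>2 * b\<^sup>2 \<partial>F)"
    using oH oK by (intro integral_abs_bound_integral inner) auto
  finally show ?thesis by (simp add: F.prob_UNIV)
qed

lemma kernel_var_limit:
  assumes h: "\<And>n. 0 < h n" "h \<longlonglongrightarrow> 0"
  shows "(\<lambda>n. degenerate_kernel.kernel_var F (H (h n)) / h n) \<longlonglongrightarrow> (\<integral>x. (K x)\<^sup>2 \<partial>lborel) * (\<integral>y. (f y)\<^sup>2 \<partial>lborel)"
proof -
  have "(\<lambda>n. degenerate_kernel.kernel_var F (H (h n)) / h n - k2 (h n) / h n) \<longlonglongrightarrow> 0"
  proof (rule Lim_null_comparison)
    have "eventually (\<lambda>n. h n < 1) sequentially" using h(2) by (intro order_tendstoD(2)) auto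
    then show "eventually (\<lambda>n. norm (degenerate_kernel.kernel_var F (H (h n)) / h n - k2 (h n) / h n) \<le> 15 * Bf\<^sup>2 * h n) sequentially"
    proof eventually_elim
      case (elim n)
      have "norm (degenerate_kernel.kernel_var F (H (h n)) / h n - k2 (h n) / h n)
         = \<bar>degenerate_kernel.kernel_var F (H (h n)) - k2 (h n)\<bar> / h n"
        using h(1)[of n] by (simp flip: diff_divide_distrib)
      also have "\<dots> \<le> 15 * Bf\<^sup>2 * (h n)\<^sup>2 / h n"
        using kernel_var_approx[of "h n"] h(1)[of n] elim by (intro divide_right_mono) auto
      also have "\<dots> = 15 * Bf\<^sup>2 * h n" using h(1)[of n] by (simp add: power2_eq_square)
      finally show ?case .
    qed
    show "(\<lambda>n. 15 * Bf\<^sup>2 * h n) \<longlonglongrightarrow> 0" using tendsto_mult_right_zero[OF h(2)] by simp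
  qed
  from tendsto_add[OF this k2_limit[OF h]] show ?thesis by simp
qed

text \<open>Keeps the normalising constants away from zero: a function vanishing almost everywhere
  cannot be a density.\<close>

lemma f_sq_pos: "0 < (\<integral>y. (f y)\<^sup>2 \<partial>lborel)"
proof -
  have "(\<integral>y. (f y)\<^sup>2 \<partial>lborel) \<noteq> 0"
  proof
    assume "(\<integral>y. (f y)\<^sup>2 \<partial>lborel) = 0"
    then have "AE y in lborel. (f y)\<^sup>2 = 0"
      using integral_nonneg_eq_0_iff_AE[OF integrable_f_sq] by simp
    then have "AE y in lborel. f y * 1 = 0" by eventually_elim simp
    then have "(\<integral>y. f y * 1 \<partial>lborel) = 0" by (rule integral_eq_zero_AE)
    moreover have "(\<integral>y. f y * 1 \<partial>lborel) = 1" using integral_F[of "\<lambda>_. 1"] by (simp add: F.prob_UNIV)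
    ultimately show False by simp
  qed
  moreover have "0 \<le> (\<integral>y. (f y)\<^sup>2 \<partial>lborel)" by (rule Bochner_Integration.integral_nonneg) simp
  ultimately show ?thesis by linarith
qed

lemma K_sq_pos: "0 < (\<integral>y. (K y)\<^sup>2 \<partial>lborel)"
proof -
  have "(\<integral>y. (K y)\<^sup>2 \<partial>lborel) \<noteq> 0"
  proof
    assume "(\<integral>y. (K y)\<^sup>2 \<partial>lborel) = 0"
    then have "AE y in lborel. (K y)\<^sup>2 = 0"
      using integral_nonneg_eq_0_iff_AE[OF integrable_K_sq] by simp
    then have "AE y in lborel. K y = 0" by eventually_elim simp
    then have "(\<integral>y. K y \<partial>lborel) = 0" by (rule integral_eq_zero_AE)
    then show False using K_one by simp
  qed
  moreover have "0 \<le> (\<integral>y. (K y)\<^sup>2 \<partial>lborel)" by (rule Bochner_Integration.integral_nonneg) simp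
  ultimately show ?thesis by linarith
qed

end

section \<open>The quadratic form in the regression errors\<close>

text \<open>Characteristic functions are Lipschitz in the L1 distance, so a remainder may be
  discarded as soon as its first absolute moment vanishes.\<close>

lemma (in prob_space) expectation_iexp_diff_le:
  fixes A B :: "'a \<Rightarrow> real"
  assumes [measurable]: "A \<in> borel_measurable M" "B \<in> borel_measurable M" and "integrable M (\<lambda>x. A x - B x)"
  shows "cmod (expectation (\<lambda>x. iexp (u * A x)) - expectation (\<lambda>x. iexp (u * B x))) \<le> \<bar>u\<bar> * expectation (\<lambda>x. \<bar>A x - B x\<bar>)"
proof -
  have i: "integrable M (\<lambda>x. iexp (u * C x))" if [measurable]: "C \<in> borel_measurable M" for C
    by (rule integrable_const_bound[where B=1]) auto
  have pt: "cmod (iexp (u * a) - iexp (u * b)) \<le> \<bar>u\<bar> * \<bar>a - b\<bar>" for a b :: real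
  proof -
    have "iexp (u * a) - iexp (u * b) = iexp (u * b) * (iexp (u * (a - b)) - 1)"
      by (simp add: algebra_simps exp_diff)
    also have "cmod \<dots> = cmod (iexp (u * (a - b)) - 1)" by (simp add: norm_mult)
    also have "\<dots> \<le> \<bar>u * (a - b)\<bar>" using iexp_approx1[of "u * (a - b)" 0] by simp
    finally show ?thesis by (simp add: abs_mult)
  qed
  have "cmod (expectation (\<lambda>x. iexp (u * A x)) - expectation (\<lambda>x. iexp (u * B x)))
      = cmod (expectation (\<lambda>x. iexp (u * A x) - iexp (u * B x)))"
    using i by simp
  also have "\<dots> \<le> expectation (\<lambda>x. \<bar>u\<bar> * \<bar>A x - B x\<bar>)"
    using assms(3) i pt by (intro order_trans[OF integral_norm_bound] integral_mono) auto
  finally show ?thesis by simp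
qed

lemma exp_minus_lipschitz:
  fixes a b :: real
  assumes "0 \<le> a" "0 \<le> b" shows "\<bar>exp (- a) - exp (- b)\<bar> \<le> \<bar>a - b\<bar>"
proof -
  have *: "\<bar>exp (- a) - exp (- b)\<bar> \<le> b - a" if "0 \<le> a" "a \<le> b" for a b :: real
  proof -
    have "exp (- a) - exp (- b) = exp (- a) * (1 - exp (- (b - a)))"
      by (simp add: algebra_simps flip: exp_add)
    also have "\<dots> \<le> 1 * (b - a)"
    proof (rule mult_mono)
      show "1 - exp (- (b - a)) \<le> b - a" using exp_ge_add_one_self[of "- (b - a)"] by linarith
    qed (use that in auto)
    finally show ?thesis using that by simp
  qed
  show ?thesis using *[of a b] *[of b a] assms by (cases "a \<le> b") (auto simp: abs_minus_commute)
qed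

text \<open>The Gaussian exponent is quadratic in the mean of the squared errors, whose convergence
  is available in L1. Because exp(-x^2) is globally Lipschitz, only the first power of the deviation
  enters.\<close>

lemma exp_minus_square_lipschitz:
  fixes s t :: real
  assumes "0 \<le> s" "0 \<le> t" shows "\<bar>exp (- s\<^sup>2) - exp (- t\<^sup>2)\<bar> \<le> \<bar>s - t\<bar>"
proof -
  have *: "\<bar>exp (- a\<^sup>2) - exp (- b\<^sup>2)\<bar> \<le> b - a" if "0 \<le> a" "a < b" for a b :: real
  proof -
    have "\<exists>z>a. z < b \<and> exp (- b\<^sup>2) - exp (- a\<^sup>2) = (b - a) * (exp (- z\<^sup>2) * (- (2 * z)))"
      using that by (intro MVT2) (auto intro!: derivative_eq_intros)
    then obtain z where z: "a < z" "exp (- b\<^sup>2) - exp (- a\<^sup>2) = (b - a) * (exp (- z\<^sup>2) * (- (2 * z)))" by blast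
    have "2 * z \<le> 1 + z\<^sup>2" using sum_squares_bound[of z 1] by simp
    also have "\<dots> \<le> exp (z\<^sup>2)" by (rule exp_ge_add_one_self)
    finally have "exp (- z\<^sup>2) * (2 * z) \<le> 1" by (simp add: exp_minus field_simps)
    then have "(b - a) * (exp (- z\<^sup>2) * (2 * z)) \<le> b - a" using that by (simp add: mult_left_le)
    moreover have "0 \<le> (b - a) * (exp (- z\<^sup>2) * (2 * z))" using that z by simp
    moreover have "exp (- a\<^sup>2) - exp (- b\<^sup>2) = (b - a) * (exp (- z\<^sup>2) * (2 * z))" using z(2) by simp
    ultimately show ?thesis by linarith
  qed
  show ?thesis using *[of s t] *[of t s] assms
    by (cases s t rule: linorder_cases) (auto simp: abs_minus_commute)
qed

text \<open>
\<^const>\<open>prob_space.indep_var\<close> forces both variables to have the same type. In the hypothesis on the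
error process the path is therefore coerced to the nonnegative times, as spelled out here.
\<close>

locale kernel_regression = linear_process M \<xi> \<psi> e + smoothing f K Bf BK
  for M :: "'w measure" and \<xi> \<psi> e f K Bf BK +
  fixes X :: "nat \<Rightarrow> 'w \<Rightarrow> real"
  assumes X_rv[measurable]: "\<And>t. X t \<in> borel_measurable M"
    and X_indep: "indep_vars (\<lambda>_. borel) X UNIV"
    and X_dens: "\<And>t. distributed M lborel (X t) (\<lambda>x. ennreal (f x))"
    and Xe_indep: "indep_var (PiM UNIV (\<lambda>_. borel)) (\<lambda>\<omega> t. X t \<omega>) (PiM UNIV (\<lambda>_. borel)) (\<lambda>\<omega> t. e (int t) \<omega>)"
begin

section \<open>Conditioning on the path of the errors\<close>

abbreviation W :: "(nat \<Rightarrow> real) measure" where "W \<equiv> PiM UNIV (\<lambda>_. borel)"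

definition wt :: "'w \<Rightarrow> nat \<Rightarrow> real" where "wt \<omega> t = e (int t) \<omega>"
text \<open>The restriction makes the design an extensional function, hence a point of the finite
  product space.\<close>

definition Xr :: "nat \<Rightarrow> 'w \<Rightarrow> nat \<Rightarrow> real" where "Xr n \<omega> = restrict (\<lambda>t. X t \<omega>) {1..n}"

lemma wt_path_meas[measurable]: "wt \<in> measurable M W"
  unfolding wt_def by (rule measurable_PiM_single') (auto simp: PiE_def extensional_def)

lemma Xr_meas[measurable]: "Xr n \<in> measurable M (F.iid n)"
  unfolding Xr_def by (rule measurable_restrict) measurable

lemma X_law: "distr M borel (X t) = F"
proof -
  have "distr M borel (X t) = distr M lborel (X t)" by (rule distr_cong) auto
  then show ?thesis using distributed_distr_eq_density[OF X_dens[of t]] by (simp add: F_def)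
qed

lemma Xr_law:
  assumes "0 < n" shows "distr M (F.iid n) (Xr n) = F.iid n"
proof -
  have "distr M (F.iid n) (Xr n) = distr M (PiM {1..n} (\<lambda>_. borel)) (Xr n)"
    by (rule distr_cong) (auto intro!: sets_PiM_cong)
  also have "\<dots> = PiM {1..n} (\<lambda>i. distr M borel (X i))"
    using indep_vars_iff_distr_eq_PiM[where I="{1..n}" and M'="\<lambda>_. borel" and X=X] indep_vars_subset[OF X_indep, of "{1..n}"] assms
    unfolding Xr_def by auto
  also have "\<dots> = F.iid n" by (intro PiM_cong refl X_law)
  finally show ?thesis .
qed

lemma joint_law:
  assumes "0 < n"
  shows "distr M (F.iid n \<Otimes>\<^sub>M W) (\<lambda>\<omega>. (Xr n \<omega>, wt \<omega>)) = F.iid n \<Otimes>\<^sub>M distr M W wt"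
proof -
  have "indep_var (F.iid n) ((\<lambda>x. restrict x {1..n}) \<circ> (\<lambda>\<omega> t. X t \<omega>)) W ((\<lambda>w. w) \<circ> (\<lambda>\<omega> t. e (int t) \<omega>))"
    by (rule indep_var_compose[OF Xe_indep]) (auto intro!: measurable_restrict)
  then have "indep_var (F.iid n) (Xr n) W wt"
    by (simp add: comp_def Xr_def[abs_def] wt_def[abs_def] del: One_nat_def)
  then show ?thesis unfolding indep_var_distribution_eq Xr_law[OF assms] by simp
qed

lemma prob_space_wt: "prob_space (distr M W wt)"
  by (rule prob_space_distr) measurable

text \<open>By independence the joint law is a product, so integrating over the design with the
  errors frozen is conditioning on the errors. The unit bound fits characteristic functions.\<close>

lemma transfer_bounded:
  fixes \<Phi> :: "(nat \<Rightarrow> real) \<times> (nat \<Rightarrow> real) \<Rightarrow> complex"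
  assumes "0 < n" and [measurable]: "\<Phi> \<in> borel_measurable (F.iid n \<Otimes>\<^sub>M W)" and bd: "\<And>z. cmod (\<Phi> z) \<le> 1"
  shows "expectation (\<lambda>\<omega>. \<Phi> (Xr n \<omega>, wt \<omega>)) = expectation (\<lambda>\<omega>. \<integral>x. \<Phi> (x, wt \<omega>) \<partial>F.iid n)"
proof -
  interpret P: prob_space "F.iid n" by (rule F.prob_space_iid)
  interpret E: prob_space "distr M W wt" by (rule prob_space_wt)
  interpret PE: pair_prob_space "F.iid n" "distr M W wt" ..
  have [measurable]: "\<Phi> \<in> borel_measurable (F.iid n \<Otimes>\<^sub>M distr M W wt)"
    using assms(2) by (simp cong: measurable_cong_sets)
  have int: "integrable (F.iid n \<Otimes>\<^sub>M distr M W wt) (\<lambda>(x, w). \<Phi> (x, w))"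
    by (rule PE.integrable_const_bound[where B=1]) (use bd in \<open>auto simp del: One_nat_def\<close>)
  have "expectation (\<lambda>\<omega>. \<Phi> (Xr n \<omega>, wt \<omega>)) = integral\<^sup>L (distr M (F.iid n \<Otimes>\<^sub>M W) (\<lambda>\<omega>. (Xr n \<omega>, wt \<omega>))) \<Phi>"
    by (subst integral_distr) (auto simp del: One_nat_def)
  also have "\<dots> = integral\<^sup>L (F.iid n \<Otimes>\<^sub>M distr M W wt) (\<lambda>(x, w). \<Phi> (x, w))"
    unfolding joint_law[OF assms(1)] by simp
  also have "\<dots> = (\<integral>w. (\<integral>x. \<Phi> (x, w) \<partial>F.iid n) \<partial>distr M W wt)"
    using PE.integral_snd[OF int] by simp
  also have "\<dots> = expectation (\<lambda>\<omega>. \<integral>x. \<Phi> (x, wt \<omega>) \<partial>F.iid n)"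
    by (subst integral_distr) (auto simp del: One_nat_def)
  finally show ?thesis .
qed

text \<open>The Tonelli counterpart for second moments. Integrability is a conclusion, obtained from
  the conditional integral \<open>q\<close> being integrable in the errors.\<close>

lemma transfer_nonneg:
  fixes \<Phi> :: "(nat \<Rightarrow> real) \<times> (nat \<Rightarrow> real) \<Rightarrow> real"
  assumes "0 < n" and [measurable]: "\<Phi> \<in> borel_measurable (F.iid n \<Otimes>\<^sub>M W)" and nn: "\<And>z. 0 \<le> \<Phi> z"
    and int: "\<And>w. integrable (F.iid n) (\<lambda>x. \<Phi> (x, w))" and q: "\<And>w. (\<integral>x. \<Phi> (x, w) \<partial>F.iid n) = q w"
    and qi: "integrable M (\<lambda>\<omega>. q (wt \<omega>))"
  shows "integrable M (\<lambda>\<omega>. \<Phi> (Xr n \<omega>, wt \<omega>))" "expectation (\<lambda>\<omega>. \<Phi> (Xr n \<omega>, wt \<omega>)) = expectation (\<lambda>\<omega>. q (wt \<omega>))"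
proof -
  interpret P: prob_space "F.iid n" by (rule F.prob_space_iid)
  interpret E: prob_space "distr M W wt" by (rule prob_space_wt)
  interpret PE: pair_prob_space "F.iid n" "distr M W wt" ..
  have [measurable]: "\<Phi> \<in> borel_measurable (F.iid n \<Otimes>\<^sub>M distr M W wt)"
    using assms(2) by (simp cong: measurable_cong_sets)
  have q0: "0 \<le> q w" for w unfolding q[symmetric] by (rule Bochner_Integration.integral_nonneg) (rule nn)
  have inner: "(\<integral>\<^sup>+x. ennreal (\<Phi> (x, w)) \<partial>F.iid n) = ennreal (q w)" for w
    using nn_integral_eq_integral[OF int[of w]] nn q[of w] by simp
  have "(\<integral>\<^sup>+\<omega>. ennreal (\<Phi> (Xr n \<omega>, wt \<omega>)) \<partial>M)
      = (\<integral>\<^sup>+z. ennreal (\<Phi> z) \<partial>distr M (F.iid n \<Otimes>\<^sub>M W) (\<lambda>\<omega>. (Xr n \<omega>, wt \<omega>)))"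
    by (subst nn_integral_distr) (auto simp del: One_nat_def)
  also have "\<dots> = (\<integral>\<^sup>+w. (\<integral>\<^sup>+x. ennreal (\<Phi> (x, w)) \<partial>F.iid n) \<partial>distr M W wt)"
    unfolding joint_law[OF assms(1)] by (rule PE.nn_integral_snd[symmetric]) measurable
  also have "\<dots> = (\<integral>\<^sup>+\<omega>. (\<integral>\<^sup>+x. ennreal (\<Phi> (x, wt \<omega>)) \<partial>F.iid n) \<partial>M)"
    by (subst nn_integral_distr) (auto simp del: One_nat_def)
  also have "\<dots> = ennreal (expectation (\<lambda>\<omega>. q (wt \<omega>)))"
    unfolding inner using qi q0 by (intro nn_integral_eq_integral) auto
  finally have eq: "(\<integral>\<^sup>+\<omega>. ennreal (\<Phi> (Xr n \<omega>, wt \<omega>)) \<partial>M) = ennreal (expectation (\<lambda>\<omega>. q (wt \<omega>)))" .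
  show I: "integrable M (\<lambda>\<omega>. \<Phi> (Xr n \<omega>, wt \<omega>))"
    using eq nn by (intro integrableI_nonneg) auto
  have "ennreal (expectation (\<lambda>\<omega>. \<Phi> (Xr n \<omega>, wt \<omega>))) = ennreal (expectation (\<lambda>\<omega>. q (wt \<omega>)))"
    using eq nn_integral_eq_integral[OF I] nn by simp
  then show "expectation (\<lambda>\<omega>. \<Phi> (Xr n \<omega>, wt \<omega>)) = expectation (\<lambda>\<omega>. q (wt \<omega>))"
    using nn q0 by (subst (asm) ennreal_inj) (auto intro!: Bochner_Integration.integral_nonneg)
qed

definition A2 :: "nat \<Rightarrow> 'w \<Rightarrow> real" where "A2 n \<omega> = (\<Sum>t\<in>{1..n}. (wt \<omega> t)\<^sup>2)"
definition A4 :: "nat \<Rightarrow> 'w \<Rightarrow> real" where "A4 n \<omega> = (\<Sum>t\<in>{1..n}. wt \<omega> t ^ 4)"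

lemma wt_meas[measurable]: "(\<lambda>\<omega>. wt \<omega> t) \<in> borel_measurable M"
  unfolding wt_def by measurable

lemma A_meas[measurable]: "A2 n \<in> borel_measurable M" "A4 n \<in> borel_measurable M"
  unfolding A2_def A4_def by measurable

lemma A4_moment: "integrable M (A4 n)" "expectation (A4 n) \<le> real n * B4"
proof -
  show "integrable M (A4 n)" unfolding A4_def[abs_def] wt_def
    by (intro Bochner_Integration.integrable_sum e_fourth_moment)
  have "expectation (A4 n) = (\<Sum>t\<in>{1..n}. expectation (\<lambda>\<omega>. e (int t) \<omega> ^ 4))"
    unfolding A4_def[abs_def] wt_def by (intro Bochner_Integration.integral_sum e_fourth_moment)
  also have "\<dots> \<le> (\<Sum>t\<in>{1..n}. B4)" by (intro sum_mono e_fourth_moment)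
  finally show "expectation (A4 n) \<le> real n * B4" by simp
qed

lemma A2_moment: "integrable M (A2 n)" "expectation (A2 n) = real n * \<Gamma>"
proof -
  show "integrable M (A2 n)" unfolding A2_def[abs_def] wt_def
    by (intro Bochner_Integration.integrable_sum e_int2)
  have "expectation (A2 n) = (\<Sum>t\<in>{1..n}. expectation (\<lambda>\<omega>. (e (int t) \<omega>)\<^sup>2))"
    unfolding A2_def[abs_def] wt_def by (intro Bochner_Integration.integral_sum e_int2)
  then show "expectation (A2 n) = real n * \<Gamma>" by (simp add: e_E2)
qed

text \<open>Cauchy-Schwarz; a cutoff on \<open>A4\<close> alone therefore limits both sums of
  weights.\<close>

lemma A2_sq_le: "(A2 n \<omega>)\<^sup>2 \<le> real n * A4 n \<omega>"
  using sum_squared_le_sum_of_squares[of "\<lambda>t. (wt \<omega> t)\<^sup>2" "{1..n}"]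
  unfolding A2_def A4_def by (simp add: mult.commute flip: power_mult)

lemma A_nonneg: "0 \<le> A2 n \<omega>" "0 \<le> A4 n \<omega>"
  unfolding A2_def A4_def by (auto intro!: sum_nonneg)

lemma pair_sum_wt: "2 * pair_sum (wt \<omega>) n = (A2 n \<omega>)\<^sup>2 - A4 n \<omega>"
  unfolding A2_def A4_def by (rule pair_sum_eq)

definition Q :: "real \<Rightarrow> nat \<Rightarrow> 'w \<Rightarrow> real" where
  "Q b n \<omega> = quad_form (H b) (wt \<omega>) n (\<lambda>t. X t \<omega>)"

lemma H_meas[measurable]: "(\<lambda>(x, y). H b x y) \<in> borel_measurable (borel \<Otimes>\<^sub>M borel)"
  unfolding H_def by measurable

lemma quad_meas[measurable]:
  "(\<lambda>(x, w). quad_form (H b) w n x) \<in> borel_measurable (F.iid n \<Otimes>\<^sub>M W)"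
  unfolding quad_form_def by measurable

lemma Q_meas[measurable]: "Q b n \<in> borel_measurable M"
  unfolding Q_def[abs_def] quad_form_def by measurable

lemma Q_eq: "Q b n \<omega> = quad_form (H b) (wt \<omega>) n (Xr n \<omega>)"
  unfolding Q_def by (rule quad_form_cong) (simp add: Xr_def)

text \<open>Given the errors the variance is \<open>kernel_var\<close> times
  \<open>pair_sum\<close>, and the latter is at most n times the sum of fourth powers. So
  \<open>Q\<close> has order n sqrt(b), which is negligible against n^(2-\<alpha>) b in the
  chi-squared regime.\<close>

lemma Q_second_moment:
  assumes b: "0 < b" "b \<le> 1" and n: "0 < n"
  shows "integrable M (\<lambda>\<omega>. (Q b n \<omega>)\<^sup>2)"
    and "expectation (\<lambda>\<omega>. (Q b n \<omega>)\<^sup>2) \<le> (BK + 3 * Bf) * (4 * Bf * b) * ((real n)\<^sup>2 * B4)"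
proof -
  interpret D: degenerate_kernel F "H b" "BK + 3 * Bf" "4 * Bf * b" by (rule H_kernel[OF b])
  have le: "pair_sum (wt \<omega>) n \<le> real n * A4 n \<omega>" for \<omega>
    using pair_sum_le[of "wt \<omega>" n] A2_sq_le[of n \<omega>] unfolding A2_def by linarith
  have ge: "0 \<le> pair_sum (wt \<omega>) n" for \<omega>
    unfolding pair_sum_def by (auto intro!: sum_nonneg mult_nonneg_nonneg)
  have ip: "integrable M (\<lambda>\<omega>. pair_sum (wt \<omega>) n)"
  proof (rule Bochner_Integration.integrable_bound)
    show "integrable M (\<lambda>\<omega>. real n * A4 n \<omega>)" using A4_moment by simp
    show "AE \<omega> in M. norm (pair_sum (wt \<omega>) n) \<le> norm (real n * A4 n \<omega>)" using le ge A_nonneg by simp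
  qed (unfold pair_sum_def, measurable)
  have qi: "integrable M (\<lambda>\<omega>. D.kernel_var * pair_sum (wt \<omega>) n)" using ip by simp
  note T = transfer_nonneg[OF n, where \<Phi>="\<lambda>(x, w). (quad_form (H b) w n x)\<^sup>2"
      and q="\<lambda>w. D.kernel_var * pair_sum w n", unfolded prod.case, OF _ _ D.quad_form_second_moment qi]
  have T1: "integrable M (\<lambda>\<omega>. (Q b n \<omega>)\<^sup>2)"
    unfolding Q_eq by (rule T(1), measurable, simp add: split_beta)
  have T2: "expectation (\<lambda>\<omega>. (Q b n \<omega>)\<^sup>2) = expectation (\<lambda>\<omega>. D.kernel_var * pair_sum (wt \<omega>) n)"
    unfolding Q_eq by (rule T(2), measurable, simp add: split_beta)
  show "integrable M (\<lambda>\<omega>. (Q b n \<omega>)\<^sup>2)" by (rule T1)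
  have "expectation (\<lambda>\<omega>. pair_sum (wt \<omega>) n) \<le> expectation (\<lambda>\<omega>. real n * A4 n \<omega>)"
    using ip A4_moment(1) le by (intro integral_mono) auto
  also have "\<dots> \<le> (real n)\<^sup>2 * B4"
    using A4_moment(2)[of n] by (simp add: power2_eq_square mult.assoc mult_left_mono)
  finally have Eps: "expectation (\<lambda>\<omega>. pair_sum (wt \<omega>) n) \<le> (real n)\<^sup>2 * B4" .
  have "0 \<le> (BK + 3 * Bf) * (4 * Bf * b)" using D.kernel_var_bounds by linarith
  then have "D.kernel_var * expectation (\<lambda>\<omega>. pair_sum (wt \<omega>) n) \<le> (BK + 3 * Bf) * (4 * Bf * b) * ((real n)\<^sup>2 * B4)"
    by (rule mult_mono[OF D.kernel_var_bounds(2) Eps]) (intro Bochner_Integration.integral_nonneg ge)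
  then show "expectation (\<lambda>\<omega>. (Q b n \<omega>)\<^sup>2) \<le> (BK + 3 * Bf) * (4 * Bf * b) * ((real n)\<^sup>2 * B4)"
    unfolding T2 by simp
qed

definition L :: "real \<Rightarrow> nat \<Rightarrow> 'w \<Rightarrow> real" where
  "L b n \<omega> = (\<Sum>t\<in>{1..n}. wt \<omega> t * (g b (X t \<omega>) - \<mu> b))"

lemma L_meas[measurable]: "L b n \<in> borel_measurable M"
  unfolding L_def[abs_def] by measurable

lemma g_centered: "0 < b \<Longrightarrow> \<bar>g b x - \<mu> b\<bar> \<le> Bf * b"
  using g_bounds[of b x] \<mu>_bounds[of b] by (auto simp: abs_if)

text \<open>Given the errors the summands are independent and centred in the design, so the variance
  is of order n b^2 and shows no trace of long memory.\<close>

lemma L_second_moment: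
  assumes b: "0 < b" and n: "0 < n"
  shows "integrable M (\<lambda>\<omega>. (L b n \<omega>)\<^sup>2)"
    and "expectation (\<lambda>\<omega>. (L b n \<omega>)\<^sup>2) \<le> (Bf * b)\<^sup>2 * (real n * \<Gamma>)"
proof -
  interpret P: prob_space "F.iid n" by (rule F.prob_space_iid)
  define c where "c x = g b x - \<mu> b" for x
  have [measurable]: "c \<in> borel_measurable borel" unfolding c_def[abs_def] by measurable
  have cb: "\<bar>c x\<bar> \<le> Bf * b" for x unfolding c_def by (rule g_centered[OF b])
  have c0: "(\<integral>x. c x \<partial>F) = 0" unfolding c_def using integrable_g[OF b] by (simp add: F.prob_UNIV flip: \<mu>_def)
  define v where "v = (\<integral>x. (c x)\<^sup>2 \<partial>F)"
  have v: "0 \<le> v" "v \<le> (Bf * b)\<^sup>2"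
  proof -
    show "0 \<le> v" unfolding v_def by (rule Bochner_Integration.integral_nonneg) simp
    have "v \<le> (\<integral>x. (Bf * b)\<^sup>2 \<partial>F)" unfolding v_def
    proof (rule integral_mono)
      show le: "(c x)\<^sup>2 \<le> (Bf * b)\<^sup>2" for x using power_mono[OF cb[of x], of 2] by simp
      show "integrable F (\<lambda>x. (c x)\<^sup>2)" by (rule F.integrable_const_bound[where B="(Bf * b)\<^sup>2"]) (use le in auto)
    qed simp
    then show "v \<le> (Bf * b)\<^sup>2" by (simp add: F.prob_UNIV)
  qed
  have key: "integrable (F.iid n) (\<lambda>x. (\<Sum>t\<in>{1..n}. w t * c (x t))\<^sup>2)"
       "(\<integral>x. (\<Sum>t\<in>{1..n}. w t * c (x t))\<^sup>2 \<partial>F.iid n) = (\<Sum>t\<in>{1..n}. (w t)\<^sup>2) * v" for w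
  proof -
    let ?Y = "\<lambda>t x. w t * c (x t)"
    have ind: "P.indep_vars (\<lambda>_. borel) ?Y {1..n}" by (rule F.indep_vars_iid) measurable
    have I4: "integrable (F.iid n) (\<lambda>x. ?Y t x ^ 4)" if "t \<in> {1..n}" for t
    proof (rule P.integrable_const_bound[where B="(\<bar>w t\<bar> * (Bf * b)) ^ 4"])
      show "AE x in F.iid n. norm (?Y t x ^ 4) \<le> (\<bar>w t\<bar> * (Bf * b)) ^ 4"
        unfolding real_norm_def power_abs by (intro AE_I2 power_mono) (auto simp: abs_mult intro!: mult_left_mono cb)
    qed (use that in measurable)
    have E: "(\<integral>x. ?Y t x ^ k \<partial>F.iid n) = w t ^ k * (\<integral>x. (c x) ^ k \<partial>F)" if "t \<in> {1..n}" for t k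
      using that by (subst F.integral_iid_component[where f="\<lambda>z. (w t * c z) ^ k"]) (auto simp: power_mult_distrib)
    have E0: "(\<integral>x. ?Y t x \<partial>F.iid n) = 0" if "t \<in> {1..n}" for t using E[OF that, of 1] c0 by simp
    show "integrable (F.iid n) (\<lambda>x. (\<Sum>t\<in>{1..n}. ?Y t x)\<^sup>2)"
      by (rule P.integrable_power_of_power4[OF _ P.integrable_power4_sum]) (use I4 in auto)
    show "(\<integral>x. (\<Sum>t\<in>{1..n}. ?Y t x)\<^sup>2 \<partial>F.iid n) = (\<Sum>t\<in>{1..n}. (w t)\<^sup>2) * v"
      using P.indep_sum_moments(2)[OF _ ind I4 E0] E[of _ 2] by (simp add: sum_distrib_right v_def)
  qed
  have L: "L b n \<omega> = (\<Sum>t\<in>{1..n}. wt \<omega> t * c (Xr n \<omega> t))" for \<omega>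
    unfolding L_def c_def wt_def wt_def Xr_def by simp
  have A: "(\<Sum>t\<in>{1..n}. (wt \<omega> t)\<^sup>2) = A2 n \<omega>" for \<omega> by (simp add: A2_def wt_def wt_def)
  have "integrable M (\<lambda>\<omega>. A2 n \<omega> * v)" using A2_moment by simp
  then have qi: "integrable M (\<lambda>\<omega>. (\<Sum>t\<in>{1..n}. (wt \<omega> t)\<^sup>2) * v)" unfolding A .
  note T = transfer_nonneg[OF n, where \<Phi>="\<lambda>(x, w). (\<Sum>t\<in>{1..n}. w t * c (x t))\<^sup>2"
      and q="\<lambda>w. (\<Sum>t\<in>{1..n}. (w t)\<^sup>2) * v", unfolded prod.case, OF _ _ key qi]
  show "integrable M (\<lambda>\<omega>. (L b n \<omega>)\<^sup>2)"
    unfolding L by (rule T(1), measurable, simp add: split_beta)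
  have T2: "expectation (\<lambda>\<omega>. (L b n \<omega>)\<^sup>2) = expectation (\<lambda>\<omega>. A2 n \<omega> * v)"
    unfolding L A[symmetric] by (rule T(2), measurable, simp add: split_beta)
  have "expectation (\<lambda>\<omega>. (L b n \<omega>)\<^sup>2) = real n * \<Gamma> * v" unfolding T2 by (simp add: A2_moment)
  also have "\<dots> \<le> real n * \<Gamma> * (Bf * b)\<^sup>2" using v Gamma_nonneg by (intro mult_left_mono) auto
  finally show "expectation (\<lambda>\<omega>. (L b n \<omega>)\<^sup>2) \<le> (Bf * b)\<^sup>2 * (real n * \<Gamma>)" by (simp add: mult.commute)
qed

section \<open>Decomposition of the double sum\<close>

definition T :: "real \<Rightarrow> nat \<Rightarrow> 'w \<Rightarrow> real" where
  "T b n \<omega> = (\<Sum>t\<in>{1..n}. \<Sum>s\<in>{1..n} - {t}. e (int s) \<omega> * K ((X s \<omega> - X t \<omega>) / b) * e (int t) \<omega>)"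

lemma T_meas[measurable]: "T b n \<in> borel_measurable M"
  unfolding T_def[abs_def] by measurable

text \<open>The sum over distinct indices is completed to the full square, where products factor
  into \<open>L\<close> and \<open>S\<close>, and the diagonal is then subtracted. The diagonal of
  \<open>H\<close> cancels, which leaves twice the triangular form \<open>Q\<close>.\<close>

lemma T_decomposition:
  "T b n \<omega> = 2 * Q b n \<omega> + 2 * (L b n \<omega> * S n \<omega>) - 2 * (\<Sum>t\<in>{1..n}. (wt \<omega> t)\<^sup>2 * (g b (X t \<omega>) - \<mu> b))
     + \<mu> b * (S n \<omega>)\<^sup>2 - \<mu> b * A2 n \<omega>"
proof -
  let ?w = "wt \<omega>" and ?x = "\<lambda>t. X t \<omega>" and ?I = "{1..n}"
  define c where "c t = g b (?x t) - \<mu> b" for t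
  have Kb: "Kb b (?x s) (?x t) = H b (?x s) (?x t) + c s + c t + \<mu> b" for s t
    unfolding H_def c_def by simp
  have S: "S n \<omega> = (\<Sum>t\<in>?I. ?w t)" unfolding S_def wt_def ..
  have L: "L b n \<omega> = (\<Sum>t\<in>?I. ?w t * c t)" unfolding L_def c_def ..
  have "T b n \<omega> = (\<Sum>t\<in>?I. (\<Sum>s\<in>?I. ?w s * Kb b (?x s) (?x t) * ?w t) - ?w t * Kb b (?x t) (?x t) * ?w t)"
    unfolding T_def Kb_def wt_def by (intro sum.cong refl) (simp add: sum_diff1)
  also have "\<dots> = (\<Sum>t\<in>?I. \<Sum>s\<in>?I. ?w s * ?w t * H b (?x s) (?x t))
      + (\<Sum>t\<in>?I. \<Sum>s\<in>?I. (?w s * c s) * ?w t) + (\<Sum>t\<in>?I. \<Sum>s\<in>?I. ?w s * (?w t * c t)) + \<mu> b * (\<Sum>t\<in>?I. \<Sum>s\<in>?I. ?w s * ?w t)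
      - ((\<Sum>t\<in>?I. (?w t)\<^sup>2 * H b (?x t) (?x t)) + 2 * (\<Sum>t\<in>?I. (?w t)\<^sup>2 * c t) + \<mu> b * (\<Sum>t\<in>?I. (?w t)\<^sup>2))"
    unfolding Kb by (simp add: sum_subtractf sum.distrib sum_distrib_left power2_eq_square algebra_simps)
  also have "(\<Sum>t\<in>?I. \<Sum>s\<in>?I. ?w s * ?w t * H b (?x s) (?x t)) = (\<Sum>t\<in>?I. (?w t)\<^sup>2 * H b (?x t) (?x t)) + 2 * Q b n \<omega>"
    unfolding Q_def by (subst sum.swap, rule sum_square_quad_form) (simp add: H_def Kb_sym)
  also have "(\<Sum>t\<in>?I. \<Sum>s\<in>?I. (?w s * c s) * ?w t) = L b n \<omega> * S n \<omega>"
    unfolding L S sum_product by (rule sum.swap)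
  also have "(\<Sum>t\<in>?I. \<Sum>s\<in>?I. ?w s * (?w t * c t)) = L b n \<omega> * S n \<omega>"
    unfolding L S sum_product by (intro sum.cong refl) (simp add: mult.commute)
  also have "(\<Sum>t\<in>?I. \<Sum>s\<in>?I. ?w s * ?w t) = (S n \<omega>)\<^sup>2"
    unfolding S power2_eq_square sum_product by (rule sum.swap)
  finally show ?thesis unfolding A2_def c_def by simp
qed

text \<open>The product of \<open>L\<close> and \<open>S\<close> is bounded by Cauchy-Schwarz; the
  diagonal terms have order n b, with 3 = 2 + 1 from the centred projection and from the
  mean.\<close>

lemma remainder_bound:
  assumes b: "0 < b" and n: "0 < n"
  shows "integrable M (\<lambda>\<omega>. T b n \<omega> - 2 * Q b n \<omega> - \<mu> b * (S n \<omega>)\<^sup>2)"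
    and "expectation (\<lambda>\<omega>. \<bar>T b n \<omega> - 2 * Q b n \<omega> - \<mu> b * (S n \<omega>)\<^sup>2\<bar>)
       \<le> 2 * Bf * b * sqrt (real n * \<Gamma> * V n) + 3 * Bf * b * (real n * \<Gamma>)"
proof -
  let ?D = "\<lambda>\<omega>. \<Sum>t\<in>{1..n}. (wt \<omega> t)\<^sup>2 * (g b (X t \<omega>) - \<mu> b)"
  have D: "\<bar>?D \<omega>\<bar> \<le> Bf * b * A2 n \<omega>" for \<omega>
  proof -
    have "\<bar>?D \<omega>\<bar> \<le> (\<Sum>t\<in>{1..n}. \<bar>(wt \<omega> t)\<^sup>2 * (g b (X t \<omega>) - \<mu> b)\<bar>)" by (rule sum_abs)
    also have "\<dots> \<le> (\<Sum>t\<in>{1..n}. (wt \<omega> t)\<^sup>2 * (Bf * b))"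
      by (intro sum_mono) (auto simp: abs_mult intro!: mult_left_mono g_centered[OF b])
    finally show ?thesis by (simp add: A2_def sum_distrib_left mult.commute)
  qed
  have iD: "integrable M ?D"
    by (rule Bochner_Integration.integrable_bound[OF integrable_mult_right[OF A2_moment(1), of "Bf * b" n]])
       (use D b Bf_nonneg A_nonneg in \<open>auto simp: abs_mult simp del: One_nat_def\<close>)
  have iLS: "integrable M (\<lambda>\<omega>. L b n \<omega> * S n \<omega>)"
    by (rule expectation_abs_mult_le(1)) (use L_second_moment[OF b n] S_second_moment in auto)
  have eq: "T b n \<omega> - 2 * Q b n \<omega> - \<mu> b * (S n \<omega>)\<^sup>2 = 2 * (L b n \<omega> * S n \<omega>) - 2 * ?D \<omega> - \<mu> b * A2 n \<omega>" for \<omega>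
    unfolding T_decomposition by simp
  show I: "integrable M (\<lambda>\<omega>. T b n \<omega> - 2 * Q b n \<omega> - \<mu> b * (S n \<omega>)\<^sup>2)"
    unfolding eq using iD iLS A2_moment(1)[of n] by (simp del: One_nat_def)
  have "expectation (\<lambda>\<omega>. \<bar>T b n \<omega> - 2 * Q b n \<omega> - \<mu> b * (S n \<omega>)\<^sup>2\<bar>)
    \<le> expectation (\<lambda>\<omega>. 2 * \<bar>L b n \<omega> * S n \<omega>\<bar> + 3 * Bf * b * A2 n \<omega>)"
  proof (rule integral_mono)
    show "integrable M (\<lambda>\<omega>. \<bar>T b n \<omega> - 2 * Q b n \<omega> - \<mu> b * (S n \<omega>)\<^sup>2\<bar>)" using I by (rule integrable_abs)
    show "integrable M (\<lambda>\<omega>. 2 * \<bar>L b n \<omega> * S n \<omega>\<bar> + 3 * Bf * b * A2 n \<omega>)" using iLS A2_moment(1)[of n] by simp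
    fix \<omega>
    have "\<mu> b * A2 n \<omega> \<le> Bf * b * A2 n \<omega>" "0 \<le> \<mu> b * A2 n \<omega>"
      using \<mu>_bounds[OF b] A_nonneg[of n \<omega>] by (auto intro!: mult_right_mono)
    then show "\<bar>T b n \<omega> - 2 * Q b n \<omega> - \<mu> b * (S n \<omega>)\<^sup>2\<bar> \<le> 2 * \<bar>L b n \<omega> * S n \<omega>\<bar> + 3 * Bf * b * A2 n \<omega>"
      unfolding eq using D[of \<omega>] by linarith
  qed
  also have "\<dots> = 2 * expectation (\<lambda>\<omega>. \<bar>L b n \<omega> * S n \<omega>\<bar>) + 3 * Bf * b * (real n * \<Gamma>)"
    using iLS A2_moment[of n] by simp
  also have "expectation (\<lambda>\<omega>. \<bar>L b n \<omega> * S n \<omega>\<bar>) \<le> sqrt (expectation (\<lambda>\<omega>. (L b n \<omega>)\<^sup>2)) * sqrt (V n)"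
    using expectation_abs_mult_le(2)[of "L b n" "S n"] L_second_moment[OF b n] S_second_moment[of n] by simp
  also have "\<dots> \<le> sqrt ((Bf * b)\<^sup>2 * (real n * \<Gamma>)) * sqrt (V n)"
    using V_nonneg[of n] by (intro mult_right_mono real_sqrt_le_mono L_second_moment b n) auto
  also have "\<dots> = Bf * b * sqrt (real n * \<Gamma> * V n)"
    using Bf_nonneg b by (simp add: real_sqrt_mult)
  finally show "expectation (\<lambda>\<omega>. \<bar>T b n \<omega> - 2 * Q b n \<omega> - \<mu> b * (S n \<omega>)\<^sup>2\<bar>)
       \<le> 2 * Bf * b * sqrt (real n * \<Gamma> * V n) + 3 * Bf * b * (real n * \<Gamma>)" by simp
qed

lemma Q_L1:
  assumes "0 < b" "b \<le> 1" "0 < n"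
  shows "integrable M (Q b n)" "expectation (\<lambda>\<omega>. \<bar>Q b n \<omega>\<bar>) \<le> sqrt ((BK + 3 * Bf) * (4 * Bf * b) * ((real n)\<^sup>2 * B4))"
  using expectation_abs_le_sqrt[OF Q_meas Q_second_moment(1)[OF assms]] Q_second_moment(2)[OF assms]
  by (auto intro: order_trans[OF _ real_sqrt_le_mono])

text \<open>Comparing with the square of the standardised sum leaves the choice of normalisation in
  one deterministic term, |\<mu> V / \<sigma> - 1|.\<close>

lemma quadratic_term_approx:
  assumes b: "0 < b" "b \<le> 1" and n: "0 < n" and \<sigma>: "0 < \<sigma>" and V: "0 < V n"
  shows "integrable M (\<lambda>\<omega>. T b n \<omega> / \<sigma> - (S n \<omega>)\<^sup>2 / V n)"
    and "expectation (\<lambda>\<omega>. \<bar>T b n \<omega> / \<sigma> - (S n \<omega>)\<^sup>2 / V n\<bar>)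
      \<le> (2 * Bf * b * sqrt (real n * \<Gamma> * V n) + 3 * Bf * b * (real n * \<Gamma>)
          + 2 * sqrt ((BK + 3 * Bf) * (4 * Bf * b) * ((real n)\<^sup>2 * B4))) / \<sigma> + \<bar>\<mu> b * V n / \<sigma> - 1\<bar>"
proof -
  let ?R = "\<lambda>\<omega>. T b n \<omega> - 2 * Q b n \<omega> - \<mu> b * (S n \<omega>)\<^sup>2"
  note R = remainder_bound[OF b(1) n] and Q = Q_L1[OF b n] and S2 = S_second_moment[of n]
  have eq: "T b n \<omega> / \<sigma> - (S n \<omega>)\<^sup>2 / V n = ?R \<omega> / \<sigma> + 2 * Q b n \<omega> / \<sigma> + (\<mu> b / \<sigma> - 1 / V n) * (S n \<omega>)\<^sup>2" for \<omega>
    using \<sigma> V by (simp add: field_simps)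
  show I: "integrable M (\<lambda>\<omega>. T b n \<omega> / \<sigma> - (S n \<omega>)\<^sup>2 / V n)"
    unfolding eq using R(1) Q(1) S2(1) by simp
  have "expectation (\<lambda>\<omega>. \<bar>T b n \<omega> / \<sigma> - (S n \<omega>)\<^sup>2 / V n\<bar>)
    \<le> expectation (\<lambda>\<omega>. \<bar>?R \<omega>\<bar> / \<sigma> + 2 * \<bar>Q b n \<omega>\<bar> / \<sigma> + \<bar>\<mu> b / \<sigma> - 1 / V n\<bar> * (S n \<omega>)\<^sup>2)"
  proof (rule integral_mono)
    show "integrable M (\<lambda>\<omega>. \<bar>?R \<omega>\<bar> / \<sigma> + 2 * \<bar>Q b n \<omega>\<bar> / \<sigma> + \<bar>\<mu> b / \<sigma> - 1 / V n\<bar> * (S n \<omega>)\<^sup>2)"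
      using integrable_abs[OF R(1)] Q(1) S2(1) by simp
    show "\<bar>T b n \<omega> / \<sigma> - (S n \<omega>)\<^sup>2 / V n\<bar> \<le> \<bar>?R \<omega>\<bar> / \<sigma> + 2 * \<bar>Q b n \<omega>\<bar> / \<sigma> + \<bar>\<mu> b / \<sigma> - 1 / V n\<bar> * (S n \<omega>)\<^sup>2" for \<omega>
    proof -
      have tri: "\<bar>x + y + z\<bar> \<le> \<bar>x\<bar> + \<bar>y\<bar> + \<bar>z\<bar>" for x y z :: real by linarith
      show ?thesis unfolding eq using tri[of "?R \<omega> / \<sigma>" "2 * Q b n \<omega> / \<sigma>" "(\<mu> b / \<sigma> - 1 / V n) * (S n \<omega>)\<^sup>2"] \<sigma>
        by (simp add: abs_mult abs_divide)
    qed
  qed (use I in simp)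
  also have "\<dots> = expectation (\<lambda>\<omega>. \<bar>?R \<omega>\<bar>) / \<sigma> + 2 * expectation (\<lambda>\<omega>. \<bar>Q b n \<omega>\<bar>) / \<sigma> + \<bar>\<mu> b / \<sigma> - 1 / V n\<bar> * V n"
    using integrable_abs[OF R(1)] Q(1) S2 by simp
  also have "\<bar>\<mu> b / \<sigma> - 1 / V n\<bar> * V n = \<bar>(\<mu> b / \<sigma> - 1 / V n) * V n\<bar>" using V by (simp add: abs_mult)
  also have "(\<mu> b / \<sigma> - 1 / V n) * V n = \<mu> b * V n / \<sigma> - 1" using V by (simp add: field_simps)
  finally have "expectation (\<lambda>\<omega>. \<bar>T b n \<omega> / \<sigma> - (S n \<omega>)\<^sup>2 / V n\<bar>)
     \<le> (expectation (\<lambda>\<omega>. \<bar>?R \<omega>\<bar>) + 2 * expectation (\<lambda>\<omega>. \<bar>Q b n \<omega>\<bar>)) / \<sigma> + \<bar>\<mu> b * V n / \<sigma> - 1\<bar>"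
    by (simp add: add_divide_distrib)
  also have "\<dots> \<le> (2 * Bf * b * sqrt (real n * \<Gamma> * V n) + 3 * Bf * b * (real n * \<Gamma>)
          + 2 * sqrt ((BK + 3 * Bf) * (4 * Bf * b) * ((real n)\<^sup>2 * B4))) / \<sigma> + \<bar>\<mu> b * V n / \<sigma> - 1\<bar>"
    using R(2) Q(2) \<sigma> by (intro add_right_mono divide_right_mono add_mono mult_left_mono) auto
  finally show "expectation (\<lambda>\<omega>. \<bar>T b n \<omega> / \<sigma> - (S n \<omega>)\<^sup>2 / V n\<bar>) \<le> \<dots>" .
qed

text \<open>Now the square of the sum belongs to the error. Its mean is at most
  \<open>Bf * b * V n\<close>; divided by n sqrt(b) this has order sqrt(n^(2(1-\<alpha>)) b), which
  is why that quantity must vanish.\<close>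

lemma degenerate_term_approx:
  assumes b: "0 < b" and n: "0 < n" and \<sigma>: "0 < \<sigma>"
  shows "integrable M (\<lambda>\<omega>. T b n \<omega> / \<sigma> - 2 * Q b n \<omega> / \<sigma>)"
    and "expectation (\<lambda>\<omega>. \<bar>T b n \<omega> / \<sigma> - 2 * Q b n \<omega> / \<sigma>\<bar>)
      \<le> (2 * Bf * b * sqrt (real n * \<Gamma> * V n) + 3 * Bf * b * (real n * \<Gamma>) + Bf * b * V n) / \<sigma>"
proof -
  let ?R = "\<lambda>\<omega>. T b n \<omega> - 2 * Q b n \<omega> - \<mu> b * (S n \<omega>)\<^sup>2"
  note R = remainder_bound[OF b(1) n] and S2 = S_second_moment[of n]
  have eq: "T b n \<omega> / \<sigma> - 2 * Q b n \<omega> / \<sigma> = ?R \<omega> / \<sigma> + \<mu> b * (S n \<omega>)\<^sup>2 / \<sigma>" for \<omega>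
    using \<sigma> by (simp add: field_simps)
  show I: "integrable M (\<lambda>\<omega>. T b n \<omega> / \<sigma> - 2 * Q b n \<omega> / \<sigma>)"
    unfolding eq using R(1) S2(1) by simp
  have "expectation (\<lambda>\<omega>. \<bar>T b n \<omega> / \<sigma> - 2 * Q b n \<omega> / \<sigma>\<bar>) \<le> expectation (\<lambda>\<omega>. \<bar>?R \<omega>\<bar> / \<sigma> + \<mu> b * (S n \<omega>)\<^sup>2 / \<sigma>)"
  proof (rule integral_mono)
    show "integrable M (\<lambda>\<omega>. \<bar>?R \<omega>\<bar> / \<sigma> + \<mu> b * (S n \<omega>)\<^sup>2 / \<sigma>)" using integrable_abs[OF R(1)] S2(1) by simp
    have tri: "\<bar>x + y\<bar> \<le> \<bar>x\<bar> + y" if "0 \<le> y" for x y :: real using that by linarith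
    show "\<bar>T b n \<omega> / \<sigma> - 2 * Q b n \<omega> / \<sigma>\<bar> \<le> \<bar>?R \<omega>\<bar> / \<sigma> + \<mu> b * (S n \<omega>)\<^sup>2 / \<sigma>" for \<omega>
      unfolding eq using tri[of "\<mu> b * (S n \<omega>)\<^sup>2 / \<sigma>" "?R \<omega> / \<sigma>"] \<sigma> \<mu>_bounds[OF b] by (simp add: abs_divide)
  qed (use I in simp)
  also have "\<dots> = (expectation (\<lambda>\<omega>. \<bar>?R \<omega>\<bar>) + \<mu> b * V n) / \<sigma>"
    using integrable_abs[OF R(1)] S2 by (simp add: add_divide_distrib)
  also have "\<dots> \<le> (2 * Bf * b * sqrt (real n * \<Gamma> * V n) + 3 * Bf * b * (real n * \<Gamma>) + Bf * b * V n) / \<sigma>"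
    using R(2) \<sigma> \<mu>_bounds[OF b] V_nonneg[of n] by (intro divide_right_mono add_mono mult_right_mono) auto
  finally show "expectation (\<lambda>\<omega>. \<bar>T b n \<omega> / \<sigma> - 2 * Q b n \<omega> / \<sigma>\<bar>) \<le> \<dots>" .
qed

text \<open>Given the errors the exchange bound applies where \<open>A4\<close> is at most m n; the
  trivial bound 2 elsewhere costs 2 B4 / m on average. The random Gaussian exponent is then made
  deterministic: removing the fourth powers costs \<kappa> B4 / n, and replacing \<open>A2\<close>
  by n \<Gamma> costs the L1 error of the law of large numbers.\<close>

lemma quad_char_bound:
  fixes m \<theta> \<delta> b :: real and n :: nat
  assumes b: "0 < b" "b \<le> 1" and n: "0 < n" and \<delta>: "0 < \<delta>" and m: "0 < m"
  defines "kv \<equiv> degenerate_kernel.kernel_var F (H b)"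
    and "rate2 \<equiv> degenerate_kernel.swap_rate2 (BK + 3 * Bf) (4 * Bf * b) \<theta> \<delta> (sqrt m * real n) (m * real n)"
    and "rate4 \<equiv> degenerate_kernel.swap_rate4 (BK + 3 * Bf) (4 * Bf * b) \<theta> \<delta> (sqrt m * real n) (m * real n)"
  defines "\<kappa> \<equiv> \<theta>\<^sup>2 * kv * (real n)\<^sup>2 / 4"
  shows "cmod (expectation (\<lambda>\<omega>. iexp (\<theta> * Q b n \<omega>)) - complex_of_real (exp (- (\<kappa> * \<Gamma>\<^sup>2))))
    \<le> rate2 * (sqrt m * real n) + rate4 * (m * real n) + 2 * B4 / m
       + \<kappa> * B4 / real n + sqrt \<kappa> * expectation (\<lambda>\<omega>. \<bar>A2 n \<omega> / real n - \<Gamma>\<bar>)"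
proof -
  interpret D: degenerate_kernel F "H b" "BK + 3 * Bf" "4 * Bf * b" by (rule H_kernel[OF b])
  interpret P: prob_space "F.iid n" by (rule F.prob_space_iid)
  define \<phi> where "\<phi> \<omega> = (\<integral>x. iexp (\<theta> * quad_form (H b) (wt \<omega>) n x) \<partial>F.iid n)" for \<omega>
  define G where "G \<omega> = exp (- (\<theta>\<^sup>2 * (D.kernel_var * pair_sum (wt \<omega>) n)) / 2)" for \<omega>
  define Bd where "Bd = rate2 * (sqrt m * real n) + rate4 * (m * real n)"
  have kv: "kv = D.kernel_var" "0 \<le> kv" using D.kernel_var_bounds by (auto simp: kv_def)
  have \<kappa>0: "0 \<le> \<kappa>" unfolding \<kappa>_def using kv by simp
  have rates: "0 \<le> rate2" "0 \<le> rate4"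
    unfolding rate2_def rate4_def D.swap_rate2_def D.swap_rate4_def
    using m \<delta> D.C_nonneg Bf_nonneg b by (auto intro!: mult_nonneg_nonneg add_nonneg_nonneg divide_nonneg_pos)
  have ge: "0 \<le> pair_sum w n" for w unfolding pair_sum_def by (auto intro!: sum_nonneg mult_nonneg_nonneg)
  have \<phi>_le: "cmod (\<phi> \<omega>) \<le> 1" for \<omega>
  proof -
    have "cmod (\<phi> \<omega>) \<le> (\<integral>x. 1 \<partial>F.iid n)" unfolding \<phi>_def by (rule order_trans[OF integral_norm_bound]) simp
    then show ?thesis by (simp add: P.prob_space del: One_nat_def)
  qed
  have G_le: "0 \<le> G \<omega>" "G \<omega> \<le> 1" for \<omega>
    unfolding G_def using D.kernel_var_bounds ge[of "wt \<omega>"] by auto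
  have pair_meas: "(\<lambda>w. pair_sum w n) \<in> borel_measurable W" unfolding pair_sum_def by measurable
  have [measurable]: "G \<in> borel_measurable M"
    unfolding G_def[abs_def] using pair_meas by measurable
  have [measurable]: "\<phi> \<in> borel_measurable M"
  proof -
    have [measurable]: "(\<lambda>(\<omega>, x). quad_form (H b) (wt \<omega>) n x) \<in> borel_measurable (M \<Otimes>\<^sub>M F.iid n)"
      unfolding quad_form_def by measurable
    show ?thesis unfolding \<phi>_def[abs_def] by measurable
  qed
  have "expectation (\<lambda>\<omega>. iexp (\<theta> * Q b n \<omega>)) = expectation (\<lambda>\<omega>. (\<lambda>(x, w). iexp (\<theta> * quad_form (H b) w n x)) (Xr n \<omega>, wt \<omega>))"
    unfolding Q_eq by simp
  also have "\<dots> = expectation (\<lambda>\<omega>. \<integral>x. (\<lambda>(x, w). iexp (\<theta> * quad_form (H b) w n x)) (x, wt \<omega>) \<partial>F.iid n)"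
    by (rule transfer_bounded[OF n]) (measurable, auto)
  also have "\<dots> = expectation \<phi>" unfolding \<phi>_def[abs_def] by simp
  finally have E\<phi>: "expectation (\<lambda>\<omega>. iexp (\<theta> * Q b n \<omega>)) = expectation \<phi>" .
  \<comment> \<open>When \<open>A4\<close> exceeds \<open>m n\<close> the second summand is at least the trivial bound 2.\<close>
  have pt1: "cmod (\<phi> \<omega> - complex_of_real (G \<omega>)) \<le> Bd + 2 / (m * real n) * A4 n \<omega>" for \<omega>
  proof (cases "A4 n \<omega> \<le> m * real n")
    case True
    have "(A2 n \<omega>)\<^sup>2 \<le> real n * A4 n \<omega>" by (rule A2_sq_le)
    also have "\<dots> \<le> real n * (m * real n)" using True by (rule mult_left_mono) simp
    also have "\<dots> = (sqrt m * real n)\<^sup>2" using m by (simp add: power_mult_distrib power2_eq_square)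
    finally have A2: "A2 n \<omega> \<le> sqrt m * real n" by (rule power2_le_imp_le) (use m in simp)
    have "cmod (\<phi> \<omega> - complex_of_real (G \<omega>)) \<le> rate2 * A2 n \<omega> + rate4 * A4 n \<omega>"
      unfolding \<phi>_def G_def rate2_def rate4_def A2_def A4_def
      using A2 True \<delta> by (intro D.quad_form_char_approx) (auto simp: A2_def A4_def)
    also have "\<dots> \<le> Bd" unfolding Bd_def using rates A2 True by (intro add_mono mult_left_mono)
    also have "\<dots> \<le> Bd + 2 / (m * real n) * A4 n \<omega>" using m A_nonneg[of n \<omega>] by simp
    finally show ?thesis .
  next
    case False
    have "cmod (\<phi> \<omega> - complex_of_real (G \<omega>)) \<le> cmod (\<phi> \<omega>) + cmod (complex_of_real (G \<omega>))" by (rule norm_triangle_ineq4)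
    also have "\<dots> \<le> 2" using \<phi>_le[of \<omega>] G_le[of \<omega>] by simp
    also have "2 \<le> 2 / (m * real n) * A4 n \<omega>" using False m n by (simp add: field_simps)
    also have "\<dots> \<le> Bd + 2 / (m * real n) * A4 n \<omega>" unfolding Bd_def using rates m by simp
    finally show ?thesis .
  qed
  have pt2: "\<bar>G \<omega> - exp (- (\<kappa> * \<Gamma>\<^sup>2))\<bar> \<le> \<kappa> / (real n)\<^sup>2 * A4 n \<omega> + sqrt \<kappa> * \<bar>A2 n \<omega> / real n - \<Gamma>\<bar>" for \<omega>
  proof -
    let ?a = "A2 n \<omega> / real n"
    have ps: "pair_sum (wt \<omega>) n = ((A2 n \<omega>)\<^sup>2 - A4 n \<omega>) / 2" using pair_sum_wt[of \<omega> n] by simp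
    \<comment> \<open>The 4 in \<kappa> is a 2 from Newton's identity times a 2 from the Gaussian
      exponent.\<close>
    have Gx: "\<theta>\<^sup>2 * (D.kernel_var * pair_sum (wt \<omega>) n) / 2 = \<kappa> * (?a\<^sup>2 - A4 n \<omega> / (real n)\<^sup>2)"
      unfolding ps \<kappa>_def kv(1) using n by (simp add: field_simps power_divide)
    have "0 \<le> \<theta>\<^sup>2 * (D.kernel_var * pair_sum (wt \<omega>) n) / 2"
      using D.kernel_var_bounds ge[of "wt \<omega>"] by simp
    then have x0: "0 \<le> \<kappa> * (?a\<^sup>2 - A4 n \<omega> / (real n)\<^sup>2)" unfolding Gx .
    have y0: "0 \<le> \<kappa> * ?a\<^sup>2" using \<kappa>0 by simp
    have "\<bar>exp (- (\<kappa> * (?a\<^sup>2 - A4 n \<omega> / (real n)\<^sup>2))) - exp (- (\<kappa> * ?a\<^sup>2))\<bar>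
        \<le> \<bar>\<kappa> * (?a\<^sup>2 - A4 n \<omega> / (real n)\<^sup>2) - \<kappa> * ?a\<^sup>2\<bar>" by (rule exp_minus_lipschitz[OF x0 y0])
    also have "\<dots> = \<kappa> / (real n)\<^sup>2 * A4 n \<omega>"
      using \<kappa>0 A_nonneg[of n \<omega>] by (simp add: right_diff_distrib)
    finally have 1: "\<bar>G \<omega> - exp (- (\<kappa> * ?a\<^sup>2))\<bar> \<le> \<kappa> / (real n)\<^sup>2 * A4 n \<omega>"
      unfolding G_def minus_divide_left[symmetric] Gx .
    have sq: "\<kappa> * x\<^sup>2 = (sqrt \<kappa> * x)\<^sup>2" for x using \<kappa>0 by (simp add: power_mult_distrib)
    have "\<bar>exp (- (\<kappa> * ?a\<^sup>2)) - exp (- (\<kappa> * \<Gamma>\<^sup>2))\<bar> \<le> \<bar>sqrt \<kappa> * ?a - sqrt \<kappa> * \<Gamma>\<bar>"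
      unfolding sq using \<kappa>0 A_nonneg[of n \<omega>] Gamma_nonneg by (intro exp_minus_square_lipschitz) auto
    also have "\<dots> = sqrt \<kappa> * \<bar>?a - \<Gamma>\<bar>"
      unfolding right_diff_distrib[symmetric] abs_mult using \<kappa>0 by simp
    finally show ?thesis using 1 by linarith
  qed
  define Z where "Z \<omega> = \<phi> \<omega> - complex_of_real (exp (- (\<kappa> * \<Gamma>\<^sup>2)))" for \<omega>
  define R where "R \<omega> = Bd + 2 / (m * real n) * A4 n \<omega> + \<kappa> / (real n)\<^sup>2 * A4 n \<omega> + sqrt \<kappa> * \<bar>A2 n \<omega> / real n - \<Gamma>\<bar>" for \<omega>
  have ZR: "cmod (Z \<omega>) \<le> R \<omega>" for \<omega>
  proof -
    have "cmod (Z \<omega>) \<le> cmod (\<phi> \<omega> - complex_of_real (G \<omega>)) + cmod (complex_of_real (G \<omega>) - complex_of_real (exp (- (\<kappa> * \<Gamma>\<^sup>2))))"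
      unfolding Z_def using norm_triangle_ineq[of "\<phi> \<omega> - complex_of_real (G \<omega>)" "complex_of_real (G \<omega>) - complex_of_real (exp (- (\<kappa> * \<Gamma>\<^sup>2)))"] by simp
    also have "cmod (complex_of_real (G \<omega>) - complex_of_real (exp (- (\<kappa> * \<Gamma>\<^sup>2)))) = \<bar>G \<omega> - exp (- (\<kappa> * \<Gamma>\<^sup>2))\<bar>"
      unfolding of_real_diff[symmetric] norm_of_real ..
    finally show ?thesis unfolding R_def using pt1[of \<omega>] pt2[of \<omega>] by linarith
  qed
  have I\<phi>: "integrable M \<phi>" by (rule integrable_const_bound[where B=1]) (use \<phi>_le in auto)
  have IR: "integrable M R"
    unfolding R_def[abs_def] using A4_moment(1)[of n] A2_moment(1)[of n] by simp
  have "expectation \<phi> - complex_of_real (exp (- (\<kappa> * \<Gamma>\<^sup>2))) = expectation Z"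
    unfolding Z_def[abs_def] using I\<phi> by (simp add: prob_space)
  also have "cmod \<dots> \<le> expectation R"
    using I\<phi> IR ZR unfolding Z_def[abs_def] by (intro order_trans[OF integral_norm_bound] integral_mono) auto
  also have "\<dots> = Bd + 2 / (m * real n) * expectation (A4 n) + \<kappa> / (real n)\<^sup>2 * expectation (A4 n)
       + sqrt \<kappa> * expectation (\<lambda>\<omega>. \<bar>A2 n \<omega> / real n - \<Gamma>\<bar>)"
    unfolding R_def[abs_def] using A4_moment(1)[of n] A2_moment(1)[of n] by (simp add: prob_space)
  also have "\<dots> \<le> Bd + 2 / (m * real n) * (real n * B4) + \<kappa> / (real n)\<^sup>2 * (real n * B4)
       + sqrt \<kappa> * expectation (\<lambda>\<omega>. \<bar>A2 n \<omega> / real n - \<Gamma>\<bar>)"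
    using m \<kappa>0 by (intro add_mono mult_left_mono A4_moment order_refl) auto
  also have "\<dots> = Bd + 2 * B4 / m + \<kappa> * B4 / real n + sqrt \<kappa> * expectation (\<lambda>\<omega>. \<bar>A2 n \<omega> / real n - \<Gamma>\<bar>)"
    using n m by (simp add: field_simps power2_eq_square)
  finally show ?thesis unfolding E\<phi> Bd_def .
qed

text \<open>With \<theta>^2 of order 1/(n^2 b) and \<open>D\<close> of order b, each contribution
  becomes a constant times n^(-1/2), b^(1/2), \<delta>, 1/n or 1/(n^2 b). For fixed m and \<delta>
  only the term in \<delta> survives the limit.\<close>

lemma swap_rates_scaled:
  fixes m q \<delta> b \<theta> :: real and n :: nat
  assumes b: "0 < b" "b \<le> 1" and n: "0 < n" and \<delta>: "0 < \<delta>" and m: "0 < m" and q: "\<theta>\<^sup>2 = q / ((real n)\<^sup>2 * b)"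
  defines "C \<equiv> BK + 3 * Bf" and "d \<equiv> 4 * Bf"
  shows "degenerate_kernel.swap_rate2 (BK + 3 * Bf) (4 * Bf * b) \<theta> \<delta> (sqrt m * real n) (m * real n) * (sqrt m * real n)
       + degenerate_kernel.swap_rate4 (BK + 3 * Bf) (4 * Bf * b) \<theta> \<delta> (sqrt m * real n) (m * real n) * (m * real n)
      = q * m * C * d / 2 * (1 / sqrt (real n)) + q * m * sqrt (C * d ^ 3) * sqrt b + q * m * C * d / 12 * \<delta>
        + q\<^sup>2 * m\<^sup>2 * C\<^sup>2 * d\<^sup>2 * (1 / 8 + 1 / (4 * \<delta>)) * (1 / real n) + q\<^sup>2 * m\<^sup>2 * C ^ 3 * d / (12 * \<delta>) * (1 / ((real n)\<^sup>2 * b))"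
proof -
  interpret D: degenerate_kernel F "H b" "BK + 3 * Bf" "4 * Bf * b" by (rule H_kernel[OF b])
  have fold: "BK + 3 * Bf = C" "4 * Bf * b = d * b" by (simp_all add: C_def d_def)
  have \<theta>4: "\<theta> ^ 4 = q\<^sup>2 / ((real n) ^ 4 * b\<^sup>2)"
  proof -
    have "\<theta> ^ 4 = (\<theta>\<^sup>2)\<^sup>2" by simp
    also have "\<dots> = q\<^sup>2 / ((real n) ^ 4 * b\<^sup>2)" unfolding q by (simp add: power_divide power_mult_distrib flip: power_mult)
    finally show ?thesis .
  qed
  have s1: "sqrt (m * real n) = sqrt m * sqrt (real n)" by (rule real_sqrt_mult)
  have s2: "sqrt (C * (d * b) ^ 3) = sqrt (C * d ^ 3) * (b * sqrt b)"
  proof -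
    have eq: "C * (d * b) ^ 3 = C * d ^ 3 * (b\<^sup>2 * b)" by (simp add: power2_eq_square power3_eq_cube)
    show ?thesis unfolding eq real_sqrt_mult[of "C * d ^ 3"] real_sqrt_mult[of "b\<^sup>2"] using b(1) by simp
  qed
  \<comment> \<open>Writing m and n as squares of positive numbers turns identities with square
    roots into rational ones.\<close>
  define sM sN where "sM = sqrt m" and "sN = sqrt (real n)"
  have pos: "0 < sM" "0 < sN" using m n by (auto simp: sM_def sN_def)
  have mm: "m = sM * sM" "real n = sN * sN" using m by (auto simp: sM_def sN_def)
  have r2: "\<theta>\<^sup>2 * ((sqrt (m * real n) * (C * (d * b)) + 2 * (sqrt m * real n) * sqrt (C * (d * b) ^ 3)) / 2
        + \<delta> * (sqrt m * real n * (C * (d * b))) / 12) * (sqrt m * real n)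
      = q * m * C * d / 2 * (1 / sqrt (real n)) + q * m * sqrt (C * d ^ 3) * sqrt b + q * m * C * d / 12 * \<delta>"
    unfolding q s1 s2 sM_def[symmetric] sN_def[symmetric] unfolding mm
    using pos b(1) by (simp add: field_simps power2_eq_square)
  have r4: "\<theta> ^ 4 * ((sqrt m * real n * (C * (d * b)))\<^sup>2 / 8
        + (3 * (sqrt m * real n * (C * (d * b)))\<^sup>2 + m * real n * (C ^ 3 * (d * b))) / (12 * \<delta>)) * (m * real n)
      = q\<^sup>2 * m\<^sup>2 * C\<^sup>2 * d\<^sup>2 * (1 / 8 + 1 / (4 * \<delta>)) * (1 / real n) + q\<^sup>2 * m\<^sup>2 * C ^ 3 * d / (12 * \<delta>) * (1 / ((real n)\<^sup>2 * b))"
    unfolding \<theta>4 sM_def[symmetric] unfolding mm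
    using pos b(1) \<delta> by (simp add: field_simps power2_eq_square power3_eq_cube power4_eq_xxxx)
  show ?thesis
    unfolding D.swap_rate2_def D.swap_rate4_def unfolding fold r2 r4 by simp
qed

text \<open>The choices are nested: given \<epsilon>, m makes the Markov term small, then \<delta>
  makes the surviving exchange error small, and finally n is taken large. The constant
  \<open>A\<close> is 4 (square of 2 in \<open>2 * Q\<close>) times \<Gamma>^2 / 2 (limit of
  \<open>pair_sum\<close> over n^2) times the limit of the kernel variance over h.\<close>

lemma degenerate_clt:
  assumes h: "\<And>n. 0 < h n" "h \<longlonglongrightarrow> 0" and nh: "filterlim (\<lambda>n. real n * h n) at_top sequentially"
    and \<Gamma>: "0 < \<Gamma>"
  defines "A \<equiv> 2 * \<Gamma>\<^sup>2 * (\<integral>x. (K x)\<^sup>2 \<partial>lborel) * (\<integral>y. (f y)\<^sup>2 \<partial>lborel)"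
  shows "(\<lambda>n. expectation (\<lambda>\<omega>. iexp (u * (2 * Q (h n) n \<omega> / sqrt ((real n)\<^sup>2 * h n * A)))))
           \<longlonglongrightarrow> complex_of_real (exp (- (u\<^sup>2) / 2))"
proof -
  have A: "0 < A" unfolding A_def using \<Gamma> f_sq_pos K_sq_pos by simp
  define \<theta> where "\<theta> n = u * 2 / sqrt ((real n)\<^sup>2 * h n * A)" for n
  define q where "q = 4 * u\<^sup>2 / A"
  have \<theta>2: "(\<theta> n)\<^sup>2 = q / ((real n)\<^sup>2 * h n)" for n
    unfolding \<theta>_def q_def using A h(1)[of n] by (simp add: power_divide power_mult_distrib mult_ac)
  define kv where "kv n = degenerate_kernel.kernel_var F (H (h n))" for n
  define \<kappa> where "\<kappa> n = (\<theta> n)\<^sup>2 * kv n * (real n)\<^sup>2 / 4" for n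
  have \<kappa>_lim: "\<kappa> \<longlonglongrightarrow> u\<^sup>2 / (2 * \<Gamma>\<^sup>2)"
  proof -
    have "(\<lambda>n. u\<^sup>2 / A * (kv n / h n)) \<longlonglongrightarrow> u\<^sup>2 / A * ((\<integral>x. (K x)\<^sup>2 \<partial>lborel) * (\<integral>y. (f y)\<^sup>2 \<partial>lborel))"
      unfolding kv_def by (intro tendsto_mult_left kernel_var_limit h)
    also have "u\<^sup>2 / A * ((\<integral>x. (K x)\<^sup>2 \<partial>lborel) * (\<integral>y. (f y)\<^sup>2 \<partial>lborel)) = u\<^sup>2 / (2 * \<Gamma>\<^sup>2)"
      unfolding A_def using \<Gamma> f_sq_pos K_sq_pos by simp
    finally show ?thesis
    proof (rule Lim_transform_eventually)
      show "eventually (\<lambda>n. u\<^sup>2 / A * (kv n / h n) = \<kappa> n) sequentially"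
        using eventually_gt_at_top[of 0]
      proof eventually_elim
        case (elim n)
        then show ?case unfolding \<kappa>_def \<theta>2 q_def using h(1)[of n] A by (simp add: field_simps)
      qed
    qed
  qed
  have LLN: "(\<lambda>n. expectation (\<lambda>\<omega>. \<bar>A2 n \<omega> / real n - \<Gamma>\<bar>)) \<longlonglongrightarrow> 0"
    unfolding A2_def wt_def by (rule e_LLN)
  have n2h: "(\<lambda>n. 1 / ((real n)\<^sup>2 * h n)) \<longlonglongrightarrow> 0"
  proof -
    have "filterlim (\<lambda>n. real n * (real n * h n)) at_top sequentially"
      by (intro filterlim_at_top_mult_at_top filterlim_real_sequentially nh)
    then show ?thesis
      by (intro tendsto_divide_0[OF tendsto_const] filterlim_at_top_imp_at_infinity) (simp add: power2_eq_square mult.assoc)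
  qed
  define C d where "C = BK + 3 * Bf" and "d = 4 * Bf"
  define Bd where "Bd \<delta> m n = q * m * C * d / 2 * (1 / sqrt (real n)) + q * m * sqrt (C * d ^ 3) * sqrt (h n) + q * m * C * d / 12 * \<delta>
        + q\<^sup>2 * m\<^sup>2 * C\<^sup>2 * d\<^sup>2 * (1 / 8 + 1 / (4 * \<delta>)) * (1 / real n) + q\<^sup>2 * m\<^sup>2 * C ^ 3 * d / (12 * \<delta>) * (1 / ((real n)\<^sup>2 * h n))"
    for \<delta> m n
  define E where "E n = \<kappa> n * B4 / real n + sqrt (\<kappa> n) * expectation (\<lambda>\<omega>. \<bar>A2 n \<omega> / real n - \<Gamma>\<bar>)" for n
  let ?\<chi> = "\<lambda>n. expectation (\<lambda>\<omega>. iexp (\<theta> n * Q (h n) n \<omega>))"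
  let ?G = "\<lambda>n. complex_of_real (exp (- (\<kappa> n * \<Gamma>\<^sup>2)))"
  have bound: "eventually (\<lambda>n. cmod (?\<chi> n - ?G n) \<le> Bd \<delta> m n + 2 * B4 / m + E n) sequentially"
    if \<delta>: "0 < \<delta>" and m: "0 < m" for \<delta> m
  proof -
    have "eventually (\<lambda>n. h n < 1) sequentially" using h(2) by (intro order_tendstoD(2)) auto
    then show ?thesis using eventually_gt_at_top[of 0]
    proof eventually_elim
      case (elim n)
      then have hn: "h n \<le> 1" and n: "0 < n" by auto
      show ?case
        using quad_char_bound[OF h(1) hn n \<delta> m, of "\<theta> n"]
        unfolding swap_rates_scaled[OF h(1) hn n \<delta> m \<theta>2] Bd_def C_def d_def E_def \<kappa>_def kv_def by (simp add: add.assoc)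
    qed
  qed
  have Bd_lim: "(\<lambda>n. Bd \<delta> m n) \<longlonglongrightarrow> q * m * C * d / 12 * \<delta>" for \<delta> m
  proof -
    have "(\<lambda>n. 1 / sqrt (real n)) \<longlonglongrightarrow> 0"
      by (intro tendsto_divide_0[OF tendsto_const] filterlim_at_top_imp_at_infinity filterlim_compose[OF sqrt_at_top filterlim_real_sequentially])
    moreover have "(\<lambda>n. sqrt (h n)) \<longlonglongrightarrow> 0" using tendsto_real_sqrt[OF h(2)] by simp
    ultimately have "(\<lambda>n. Bd \<delta> m n) \<longlonglongrightarrow> q * m * C * d / 2 * 0 + q * m * sqrt (C * d ^ 3) * 0 + q * m * C * d / 12 * \<delta>
        + q\<^sup>2 * m\<^sup>2 * C\<^sup>2 * d\<^sup>2 * (1 / 8 + 1 / (4 * \<delta>)) * 0 + q\<^sup>2 * m\<^sup>2 * C ^ 3 * d / (12 * \<delta>) * 0"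
      unfolding Bd_def by (intro tendsto_add tendsto_mult_left tendsto_const lim_1_over_n n2h)
    then show ?thesis by simp
  qed
  have E_lim: "E \<longlonglongrightarrow> 0"
  proof -
    have "(\<lambda>n. \<kappa> n * B4 * (1 / real n) + sqrt (\<kappa> n) * expectation (\<lambda>\<omega>. \<bar>A2 n \<omega> / real n - \<Gamma>\<bar>))
      \<longlonglongrightarrow> u\<^sup>2 / (2 * \<Gamma>\<^sup>2) * B4 * 0 + sqrt (u\<^sup>2 / (2 * \<Gamma>\<^sup>2)) * 0"
      by (intro tendsto_add tendsto_mult tendsto_real_sqrt \<kappa>_lim tendsto_const lim_1_over_n LLN)
    then show ?thesis unfolding E_def[abs_def] by simp
  qed
  have "(\<lambda>n. ?\<chi> n - ?G n) \<longlonglongrightarrow> 0"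
  proof (rule tendstoI)
    fix \<epsilon> :: real assume \<epsilon>: "0 < \<epsilon>"
    \<comment> \<open>The 8 brings \<open>2 * B4 / m\<close> below a quarter of \<epsilon>, and the
      added 1 keeps m positive if \<open>B4\<close> vanishes.\<close>
    define m where "m = 8 * B4 / \<epsilon> + 1"
    have m: "0 < m" unfolding m_def using \<epsilon> B4_nonneg by (simp add: add_nonneg_pos)
    have mB: "2 * B4 / m \<le> \<epsilon> / 4"
    proof -
      have "8 * B4 \<le> \<epsilon> * m" unfolding m_def using \<epsilon> by (simp add: field_simps)
      then show ?thesis using m by (simp add: field_simps)
    qed
    define k where "k = q * m * C * d / 12"
    \<comment> \<open>Adding 1 avoids a division by zero when \<open>k\<close> vanishes.\<close>
    define \<delta> where "\<delta> = \<epsilon> / (4 * (\<bar>k\<bar> + 1))"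
    have \<delta>: "0 < \<delta>" unfolding \<delta>_def using \<epsilon> by simp
    have "k * \<delta> \<le> \<bar>k\<bar> * \<delta>" using \<delta> by (intro mult_right_mono) auto
    also have "\<dots> \<le> (\<bar>k\<bar> + 1) * \<delta>" using \<delta> by (intro mult_right_mono) auto
    also have "\<dots> = \<epsilon> / 4" unfolding \<delta>_def by (simp add: field_simps add_eq_0_iff)
    finally have "k * \<delta> < \<epsilon> / 2" using \<epsilon> by linarith
    then have "eventually (\<lambda>n. Bd \<delta> m n < \<epsilon> / 2) sequentially"
      using Bd_lim[of \<delta> m] unfolding k_def by (intro order_tendstoD(2)) auto
    moreover have "eventually (\<lambda>n. E n < \<epsilon> / 4) sequentially"
      using E_lim \<epsilon> by (intro order_tendstoD(2)) auto
    ultimately show "eventually (\<lambda>n. dist (?\<chi> n - ?G n) 0 < \<epsilon>) sequentially"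
      using bound[OF \<delta> m]
    proof eventually_elim
      case (elim n)
      have "cmod (?\<chi> n - ?G n) < \<epsilon>" using elim mB by linarith
      then show ?case by (simp add: dist_norm)
    qed
  qed
  moreover have "?G \<longlonglongrightarrow> complex_of_real (exp (- (u\<^sup>2 / (2 * \<Gamma>\<^sup>2) * \<Gamma>\<^sup>2)))"
    by (intro tendsto_intros \<kappa>_lim)
  ultimately have "(\<lambda>n. (?\<chi> n - ?G n) + ?G n) \<longlonglongrightarrow> 0 + complex_of_real (exp (- (u\<^sup>2 / (2 * \<Gamma>\<^sup>2) * \<Gamma>\<^sup>2)))"
    by (rule tendsto_add)
  then have "?\<chi> \<longlonglongrightarrow> complex_of_real (exp (- (u\<^sup>2) / 2))" using \<Gamma> by simp
  then show ?thesis unfolding \<theta>_def by (simp add: mult.assoc)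
qed

section \<open>Limit laws of the normalised double sum\<close>

lemma char_distr_eq:
  assumes [measurable]: "Y \<in> borel_measurable M"
  shows "char (distr M borel Y) u = expectation (\<lambda>\<omega>. iexp (u * Y \<omega>))"
  unfolding char_def by (subst integral_distr) auto

lemma real_distribution_distr_rv: "Y \<in> borel_measurable M \<Longrightarrow> real_distribution (distr M borel Y)"
  by (rule real_distribution_distr) simp

text \<open>The ratio n / V n bounds the largest squared coefficient relative to the variance, up to
  \<Gamma>; when it vanishes no single innovation matters.\<close>

lemma S_clt:
  assumes r: "(\<lambda>n. real n / V n) \<longlonglongrightarrow> 0" and V: "eventually (\<lambda>n. 0 < V n) sequentially" and \<Gamma>: "0 < \<Gamma>"
  shows "weak_conv_m (\<lambda>n. distr M borel (\<lambda>\<omega>. S n \<omega> / sqrt (V n))) std_normal_distribution"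
proof (rule levy_continuity)
  show "real_distribution (distr M borel (\<lambda>\<omega>. S n \<omega> / sqrt (V n)))" for n
    by (rule real_distribution_distr_rv) measurable
  show "real_distribution std_normal_distribution" by (rule real_dist_normal_dist)
  fix u
  let ?r = "\<lambda>n. real n / V n * \<Gamma>"
  have "(\<lambda>n. char (distr M borel (\<lambda>\<omega>. S n \<omega> / sqrt (V n))) u - complex_of_real (exp (- (u\<^sup>2) / 2))) \<longlonglongrightarrow> 0"
  proof (rule Lim_null_comparison)
    show "eventually (\<lambda>n. norm (char (distr M borel (\<lambda>\<omega>. S n \<omega> / sqrt (V n))) u - complex_of_real (exp (- (u\<^sup>2) / 2)))
        \<le> u ^ 4 * ?r n / 8 + (sqrt (?r n) * u\<^sup>2 + u ^ 4 * m4 * sqrt (?r n)) / 12) sequentially"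
      using V eventually_gt_at_top[of 0]
    proof eventually_elim
      case (elim n)
      let ?\<theta> = "u / sqrt (V n)"
      \<comment> \<open>The square root balances the second-moment part, proportional to \<delta>,
        against the fourth-moment part, proportional to r / \<delta>.\<close>
      define \<delta> where "\<delta> = sqrt (?r n)"
      have rp: "0 < ?r n" using elim \<Gamma> by simp
      have "\<delta>\<^sup>2 = ?r n" unfolding \<delta>_def by (rule real_sqrt_pow2) (use rp in linarith)
      then have \<delta>: "0 < \<delta>" "\<delta> * \<delta> = ?r n" using rp by (simp_all only: \<delta>_def power2_eq_square real_sqrt_gt_0_iff)
      have t2: "?\<theta>\<^sup>2 = u\<^sup>2 / V n" using elim by (simp add: power_divide)
      have t4: "?\<theta> ^ 4 = u ^ 4 / (V n)\<^sup>2"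
      proof -
        have "?\<theta> ^ 4 = (?\<theta>\<^sup>2)\<^sup>2" by (simp flip: power_mult)
        then show ?thesis unfolding t2 by (simp add: power_divide flip: power_mult)
      qed
      have "char (distr M borel (\<lambda>\<omega>. S n \<omega> / sqrt (V n))) u = expectation (\<lambda>\<omega>. iexp (?\<theta> * S n \<omega>))"
        by (subst char_distr_eq) auto
      moreover have "exp (- (?\<theta>\<^sup>2 * V n) / 2) = exp (- (u\<^sup>2) / 2)" unfolding t2 using elim by simp
      ultimately have "norm (char (distr M borel (\<lambda>\<omega>. S n \<omega> / sqrt (V n))) u - complex_of_real (exp (- (u\<^sup>2) / 2)))
         \<le> V n * (?\<theta> ^ 4 * (real n * \<Gamma>) / 8 + (\<delta> * ?\<theta>\<^sup>2 + ?\<theta> ^ 4 * (real n * \<Gamma>) * m4 / \<delta>) / 12)"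
        using S_char_approx[OF \<delta>(1), of ?\<theta> n] by simp
      also have "\<dots> = u ^ 4 * ?r n / 8 + (\<delta> * u\<^sup>2 + u ^ 4 * m4 * (?r n / \<delta>)) / 12"
        unfolding t2 t4 using elim \<delta>(1) by (simp add: field_simps power2_eq_square)
      also have "?r n / \<delta> = \<delta>" unfolding \<delta>(2)[symmetric] using \<delta>(1) by simp
      finally show ?case unfolding \<delta>_def .
    qed
    have r0: "?r \<longlonglongrightarrow> 0" using tendsto_mult_left_zero[OF r] by simp
    have "(\<lambda>n. u ^ 4 * ?r n / 8 + (sqrt (?r n) * u\<^sup>2 + u ^ 4 * m4 * sqrt (?r n)) / 12)
       \<longlonglongrightarrow> u ^ 4 * 0 / 8 + (sqrt 0 * u\<^sup>2 + u ^ 4 * m4 * sqrt 0) / 12"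
      by (intro tendsto_add tendsto_divide tendsto_mult tendsto_const r0 tendsto_real_sqrt) auto
    then show "(\<lambda>n. u ^ 4 * ?r n / 8 + (sqrt (?r n) * u\<^sup>2 + u ^ 4 * m4 * sqrt (?r n)) / 12) \<longlonglongrightarrow> 0" by simp
  qed
  then show "(\<lambda>n. char (distr M borel (\<lambda>\<omega>. S n \<omega> / sqrt (V n))) u) \<longlonglongrightarrow> char std_normal_distribution u"
    unfolding char_std_normal_distribution by (rule LIM_zero_cancel)
qed

text \<open>Slutsky's lemma in L1 form. The estimate is required only eventually, since small
  bandwidths and positive variances are available only for large n.\<close>

lemma weak_conv_of_L1_approx:
  fixes Y :: "nat \<Rightarrow> 'w \<Rightarrow> real" and Z :: "nat \<Rightarrow> 'w \<Rightarrow> real"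
  assumes Ym[measurable]: "\<And>n. Y n \<in> borel_measurable M" and Zm[measurable]: "\<And>n. Z n \<in> borel_measurable M"
    and N: "real_distribution N"
    and Z: "\<And>u. (\<lambda>n. expectation (\<lambda>\<omega>. iexp (u * Z n \<omega>))) \<longlonglongrightarrow> char N u"
    and I: "eventually (\<lambda>n. integrable M (\<lambda>\<omega>. Y n \<omega> - Z n \<omega>)
              \<and> expectation (\<lambda>\<omega>. \<bar>Y n \<omega> - Z n \<omega>\<bar>) \<le> E n) sequentially"
    and E: "E \<longlonglongrightarrow> 0"
  shows "weak_conv_m (\<lambda>n. distr M borel (Y n)) N"
proof (rule levy_continuity[OF _ N])
  show "real_distribution (distr M borel (Y n))" for n by (rule real_distribution_distr_rv) measurable
  fix u
  have "(\<lambda>n. expectation (\<lambda>\<omega>. iexp (u * Y n \<omega>)) - expectation (\<lambda>\<omega>. iexp (u * Z n \<omega>))) \<longlonglongrightarrow> 0"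
  proof (rule Lim_null_comparison)
    show "eventually (\<lambda>n. norm (expectation (\<lambda>\<omega>. iexp (u * Y n \<omega>)) - expectation (\<lambda>\<omega>. iexp (u * Z n \<omega>))) \<le> \<bar>u\<bar> * E n) sequentially"
      using I
    proof eventually_elim
      case (elim n)
      then have "norm (expectation (\<lambda>\<omega>. iexp (u * Y n \<omega>)) - expectation (\<lambda>\<omega>. iexp (u * Z n \<omega>)))
          \<le> \<bar>u\<bar> * expectation (\<lambda>\<omega>. \<bar>Y n \<omega> - Z n \<omega>\<bar>)"
        by (intro expectation_iexp_diff_le Ym Zm) auto
      also have "\<dots> \<le> \<bar>u\<bar> * E n" using elim by (intro mult_left_mono) auto
      finally show ?case .
    qed
    show "(\<lambda>n. \<bar>u\<bar> * E n) \<longlonglongrightarrow> 0" using tendsto_mult_right_zero[OF E] by simp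
  qed
  from tendsto_add[OF this Z[of u]]
  show "(\<lambda>n. char (distr M borel (Y n)) u) \<longlonglongrightarrow> char N u"
    by (simp add: char_distr_eq)
qed

lemma V_scaled:
  assumes \<alpha>: "0 < \<alpha>" "\<alpha> < 1" and v: "(\<lambda>n. V n / real n powr (2 - \<alpha>)) \<longlonglongrightarrow> c" and c: "0 < c"
  shows "eventually (\<lambda>n. 0 < V n) sequentially" "(\<lambda>n. real n / V n) \<longlonglongrightarrow> 0"
proof -
  have ev: "eventually (\<lambda>n. 0 < V n / real n powr (2 - \<alpha>)) sequentially" using order_tendstoD(1)[OF v c] .
  then show V: "eventually (\<lambda>n. 0 < V n) sequentially"
    by eventually_elim (metis divide_le_0_iff not_less powr_ge_zero)
  have "(\<lambda>n. real n powr (\<alpha> - 1) / (V n / real n powr (2 - \<alpha>))) \<longlonglongrightarrow> 0 / c"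
    using \<alpha> c by (intro tendsto_divide v) (real_asymp, simp)
  then have "(\<lambda>n. real n powr (\<alpha> - 1) / (V n / real n powr (2 - \<alpha>))) \<longlonglongrightarrow> 0" by simp
  then show "(\<lambda>n. real n / V n) \<longlonglongrightarrow> 0"
  proof (rule Lim_transform_eventually)
    show "eventually (\<lambda>n. real n powr (\<alpha> - 1) / (V n / real n powr (2 - \<alpha>)) = real n / V n) sequentially"
      using eventually_gt_at_top[of 0] by eventually_elim (simp flip: powr_add)
  qed
qed

text \<open>The double sum is close in L1 to the square of the standardised sum of the errors, which
  is asymptotically the square of a standard normal variable.\<close>

theorem chi_square_limit:
  assumes h: "\<And>n. 0 < h n" "h \<longlonglongrightarrow> 0" and \<alpha>: "0 < \<alpha>" "\<alpha> < 1"
    and v: "(\<lambda>n. V n / real n powr (2 - \<alpha>)) \<longlonglongrightarrow> c" and c: "0 < c"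
    and \<Gamma>: "0 < \<Gamma>" and top: "filterlim (\<lambda>n. real n powr (2 * (1 - \<alpha>)) * h n) at_top sequentially"
  defines "A \<equiv> c * (\<integral>y. (f y)\<^sup>2 \<partial>lborel)"
  shows "weak_conv_m (\<lambda>n. distr M borel (\<lambda>\<omega>. T (h n) n \<omega> / (real n powr (2 - \<alpha>) * h n * A))) chi2_1"
proof -
  have A: "0 < A" unfolding A_def using c f_sq_pos by simp
  note V = V_scaled[OF \<alpha> v c]
  define p where "p n = real n powr (1 - \<alpha>)" for n
  define vv where "vv n = V n / real n powr (2 - \<alpha>)" for n
  have np: "real n powr (2 - \<alpha>) = real n * p n" if "0 < n" for n
    using that unfolding p_def by (simp add: powr_diff powr_add powr_numeral power2_eq_square)
  have p2: "real n powr (2 * (1 - \<alpha>)) = (p n)\<^sup>2" for n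
    unfolding p_def by (simp add: power2_eq_square flip: powr_add)
  have p_top: "filterlim p at_top sequentially" unfolding p_def using \<alpha> by real_asymp
  \<comment> \<open>In order: the product of \<open>L\<close> and \<open>S\<close>, the diagonal
    terms, the degenerate form \<open>Q\<close>, and the normalisation. The third vanishes because
    n^(2(1-\<alpha>)) h tends to infinity.\<close>
  define E where "E n = 2 * Bf / A * sqrt (\<Gamma> * vv n) * (1 / sqrt (p n)) + 3 * Bf * \<Gamma> / A * (1 / p n)
      + 2 * sqrt ((BK + 3 * Bf) * (4 * Bf) * B4) / A * (1 / sqrt ((p n)\<^sup>2 * h n)) + \<bar>\<mu> (h n) / h n * vv n / A - 1\<bar>" for n
  show ?thesis
  proof (rule weak_conv_of_L1_approx[where Z="\<lambda>n \<omega>. (S n \<omega>)\<^sup>2 / V n" and E=E])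
    interpret N: real_distribution std_normal_distribution by (rule real_dist_normal_dist)
    show "real_distribution chi2_1"
      unfolding chi2_1_def std_normal_def by (rule N.real_distribution_distr) simp
    fix u
    \<comment> \<open>The characteristic function of a square is the integral of z |-> exp(i u z^2),
      a bounded continuous test function for the weak convergence of the sum itself.\<close>
    have conv: "(\<lambda>n. integral\<^sup>L (distr M borel (\<lambda>\<omega>. S n \<omega> / sqrt (V n))) (\<lambda>z. iexp (u * z\<^sup>2)))
       \<longlonglongrightarrow> integral\<^sup>L std_normal_distribution (\<lambda>z. iexp (u * z\<^sup>2))"
      by (rule weak_conv_imp_integral_bdd_continuous_conv[where B=1, OF _ _ S_clt[OF V(2,1) \<Gamma>]])
         (auto intro!: real_distribution_distr_rv real_dist_normal_dist continuous_intros)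
    have "integral\<^sup>L std_normal_distribution (\<lambda>z. iexp (u * z\<^sup>2)) = char chi2_1 u"
      unfolding chi2_1_def std_normal_def char_def by (subst integral_distr) auto
    moreover have "integral\<^sup>L (distr M borel (\<lambda>\<omega>. S n \<omega> / sqrt (V n))) (\<lambda>z. iexp (u * z\<^sup>2)) = expectation (\<lambda>\<omega>. iexp (u * ((S n \<omega>)\<^sup>2 / V n)))" for n
      using V_nonneg[of n] by (subst integral_distr) (auto simp: power_divide)
    ultimately show "(\<lambda>n. expectation (\<lambda>\<omega>. iexp (u * ((S n \<omega>)\<^sup>2 / V n)))) \<longlonglongrightarrow> char chi2_1 u"
      using conv by simp
  next
    have "eventually (\<lambda>n. h n < 1) sequentially" using h(2) by (intro order_tendstoD(2)) auto
    then show "eventually (\<lambda>n. integrable M (\<lambda>\<omega>. T (h n) n \<omega> / (real n powr (2 - \<alpha>) * h n * A) - (S n \<omega>)\<^sup>2 / V n)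
        \<and> expectation (\<lambda>\<omega>. \<bar>T (h n) n \<omega> / (real n powr (2 - \<alpha>) * h n * A) - (S n \<omega>)\<^sup>2 / V n\<bar>) \<le> E n) sequentially"
      using V(1) eventually_gt_at_top[of 0]
    proof eventually_elim
      case (elim n)
      define x where "x = real n"
      have x: "0 < x" using elim by (simp add: x_def)
      have pp: "0 < p n" unfolding p_def using elim by simp
      have hn: "0 < h n" "h n \<le> 1" using h(1)[of n] elim by auto
      have \<sigma>: "0 < real n powr (2 - \<alpha>) * h n * A" using elim hn A by simp
      have \<sigma>e: "x powr (2 - \<alpha>) * h n * A = x * p n * h n * A" using np elim by (simp add: x_def)
      have Vn: "V n = vv n * (x * p n)" unfolding vv_def using np[of n] elim pp x by (simp add: x_def)
      note Q = quadratic_term_approx[OF hn elim(3) \<sigma> elim(2)]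
      have s1: "sqrt (x * \<Gamma> * (vv n * (x * p n))) = x * sqrt (\<Gamma> * vv n) * sqrt (p n)"
      proof -
        have "x * \<Gamma> * (vv n * (x * p n)) = x\<^sup>2 * ((\<Gamma> * vv n) * p n)" by (simp add: power2_eq_square algebra_simps)
        then show ?thesis using x by (simp add: real_sqrt_mult)
      qed
      have s2: "sqrt ((BK + 3 * Bf) * (4 * Bf * h n) * (x\<^sup>2 * B4)) = sqrt ((BK + 3 * Bf) * (4 * Bf) * B4) * x * sqrt (h n)"
      proof -
        have "(BK + 3 * Bf) * (4 * Bf * h n) * (x\<^sup>2 * B4) = ((BK + 3 * Bf) * (4 * Bf) * B4) * (x\<^sup>2 * h n)" by (simp add: algebra_simps)
        then have "sqrt ((BK + 3 * Bf) * (4 * Bf * h n) * (x\<^sup>2 * B4)) = sqrt ((BK + 3 * Bf) * (4 * Bf) * B4) * sqrt (x\<^sup>2 * h n)"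
          by (simp only: real_sqrt_mult)
        then show ?thesis using x by (simp add: real_sqrt_mult)
      qed
      have s3: "sqrt ((p n)\<^sup>2 * h n) = p n * sqrt (h n)" using pp by (simp add: real_sqrt_mult)
      define sp sh where "sp = sqrt (p n)" and "sh = sqrt (h n)"
      have sps: "0 < sp" "0 < sh" "p n = sp * sp" "h n = sh * sh" using pp hn by (auto simp: sp_def sh_def)
      define G1 G2 where "G1 = sqrt (\<Gamma> * vv n)" and "G2 = sqrt ((BK + 3 * Bf) * (4 * Bf) * B4)"
      have e1: "2 * Bf * h n * (x * G1 * sp) / (x * p n * h n * A) = 2 * Bf / A * G1 * (1 / sp)"
        using x sps A by (simp add: field_simps)
      have e2: "3 * Bf * h n * (x * \<Gamma>) / (x * p n * h n * A) = 3 * Bf * \<Gamma> / A * (1 / p n)"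
        using x sps A by (simp add: field_simps)
      have e3: "2 * (G2 * x * sh) / (x * p n * h n * A) = 2 * G2 / A * (1 / (p n * sh))"
        using x sps A by (simp add: field_simps)
      have e4: "\<mu> (h n) * (vv n * (x * p n)) / (x * p n * h n * A) = \<mu> (h n) / h n * vv n / A"
        using x sps A by (simp add: field_simps)
      have "expectation (\<lambda>\<omega>. \<bar>T (h n) n \<omega> / (real n powr (2 - \<alpha>) * h n * A) - (S n \<omega>)\<^sup>2 / V n\<bar>)
        \<le> (2 * Bf * h n * (x * G1 * sp) + 3 * Bf * h n * (x * \<Gamma>) + 2 * (G2 * x * sh)) / (x * p n * h n * A)
           + \<bar>\<mu> (h n) * (vv n * (x * p n)) / (x * p n * h n * A) - 1\<bar>"
        using Q(2) unfolding x_def[symmetric] \<sigma>e Vn s1 s2 G1_def[symmetric] G2_def[symmetric] sp_def[symmetric] sh_def[symmetric] .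
      also have "\<dots> = E n"
        unfolding add_divide_distrib e1 e2 e3 e4 E_def s3 G1_def[symmetric] G2_def[symmetric] sp_def[symmetric] sh_def[symmetric] ..
      finally show ?case using Q(1) by simp
    qed
    show "E \<longlonglongrightarrow> 0"
    proof -
      have vv: "vv \<longlonglongrightarrow> c" unfolding vv_def by (rule v)
      have l1: "(\<lambda>n. 1 / sqrt (p n)) \<longlonglongrightarrow> 0" "(\<lambda>n. 1 / p n) \<longlonglongrightarrow> 0" "(\<lambda>n. 1 / sqrt ((p n)\<^sup>2 * h n)) \<longlonglongrightarrow> 0"
        using p_top top unfolding p2
        by (auto intro!: tendsto_divide_0[OF tendsto_const] filterlim_at_top_imp_at_infinity filterlim_compose[OF sqrt_at_top])
      have "E \<longlonglongrightarrow> 2 * Bf / A * sqrt (\<Gamma> * c) * 0 + 3 * Bf * \<Gamma> / A * 0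
          + 2 * sqrt ((BK + 3 * Bf) * (4 * Bf) * B4) / A * 0 + \<bar>(\<integral>y. (f y)\<^sup>2 \<partial>lborel) * c / A - 1\<bar>"
        unfolding E_def[abs_def]
      proof (intro tendsto_add tendsto_mult tendsto_real_sqrt tendsto_const vv l1 tendsto_rabs tendsto_diff)
        show "(\<lambda>n. \<mu> (h n) / h n * vv n / A) \<longlonglongrightarrow> (\<integral>y. (f y)\<^sup>2 \<partial>lborel) * c / A"
          using A by (intro tendsto_divide tendsto_mult vv \<mu>_limit h tendsto_const) auto
      qed
      also have "(\<integral>y. (f y)\<^sup>2 \<partial>lborel) * c / A = 1" unfolding A_def using c f_sq_pos by simp
      finally show ?thesis by simp
    qed
  qed measurable
qed

text \<open>The degenerate form supplies the limit, and the other terms of the decomposition,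
  including the square of the sum of the errors, vanish in L1 after division by n sqrt(h).\<close>

theorem normal_limit:
  assumes h: "\<And>n. 0 < h n" and \<alpha>: "0 < \<alpha>" "\<alpha> < 1"
    and v: "(\<lambda>n. V n / real n powr (2 - \<alpha>)) \<longlonglongrightarrow> c" and c: "0 < c"
    and \<Gamma>: "0 < \<Gamma>" and zero: "(\<lambda>n. real n powr (2 * (1 - \<alpha>)) * h n) \<longlonglongrightarrow> 0"
    and nh: "filterlim (\<lambda>n. real n * h n) at_top sequentially"
  defines "A \<equiv> 2 * \<Gamma>\<^sup>2 * (\<integral>x. (K x)\<^sup>2 \<partial>lborel) * (\<integral>y. (f y)\<^sup>2 \<partial>lborel)"
  shows "weak_conv_m (\<lambda>n. distr M borel (\<lambda>\<omega>. T (h n) n \<omega> / sqrt ((real n)\<^sup>2 * h n * A))) std_normal_distribution"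
proof -
  have A: "0 < A" unfolding A_def using \<Gamma> f_sq_pos K_sq_pos by simp
  define p where "p n = real n powr (1 - \<alpha>)" for n
  define vv where "vv n = V n / real n powr (2 - \<alpha>)" for n
  have np: "real n powr (2 - \<alpha>) = real n * p n" if "0 < n" for n
    using that unfolding p_def by (simp add: powr_diff powr_add powr_numeral power2_eq_square)
  have p2: "real n powr (2 * (1 - \<alpha>)) = (p n)\<^sup>2" for n
    unfolding p_def by (simp add: power2_eq_square flip: powr_add)
  have p1: "1 \<le> p n" if "0 < n" for n unfolding p_def using that \<alpha> by (intro ge_one_powr_ge_zero) auto
  have z2: "(\<lambda>n. (p n)\<^sup>2 * h n) \<longlonglongrightarrow> 0" using zero unfolding p2 .
  \<comment> \<open>That the bandwidth vanishes is a consequence: the factor n^(2(1-\<alpha>)) is at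
    least one.\<close>
  have h0: "h \<longlonglongrightarrow> 0"
  proof (rule Lim_null_comparison[OF _ z2])
    show "eventually (\<lambda>n. norm (h n) \<le> (p n)\<^sup>2 * h n) sequentially"
      using eventually_gt_at_top[of 0]
    proof eventually_elim
      case (elim n)
      then show ?case using p1[of n] h[of n] one_le_power[of "p n" 2] by (simp add: mult_right_mono[of 1])
    qed
  qed
  have z1: "(\<lambda>n. p n * h n) \<longlonglongrightarrow> 0"
  proof (rule Lim_null_comparison[OF _ z2])
    show "eventually (\<lambda>n. norm (p n * h n) \<le> (p n)\<^sup>2 * h n) sequentially"
      using eventually_gt_at_top[of 0]
    proof eventually_elim
      case (elim n)
      then have "p n \<le> (p n)\<^sup>2" using p1[of n] by (simp add: power2_eq_square)
      then show ?case using p1[of n] elim h[of n] by (simp add: mult_right_mono abs_mult)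
    qed
  qed
  \<comment> \<open>In order: the product of \<open>L\<close> and \<open>S\<close>, the diagonal
    terms, and the square of the sum, each reduced to a vanishing power of n times h.\<close>
  define E where "E n = 2 * Bf / sqrt A * sqrt (\<Gamma> * vv n) * sqrt (p n * h n) + 3 * Bf * \<Gamma> / sqrt A * sqrt (h n)
      + Bf / sqrt A * vv n * sqrt ((p n)\<^sup>2 * h n)" for n
  show ?thesis
  proof (rule weak_conv_of_L1_approx[where Z="\<lambda>n \<omega>. 2 * Q (h n) n \<omega> / sqrt ((real n)\<^sup>2 * h n * A)" and E=E])
    show "real_distribution std_normal_distribution" by (rule real_dist_normal_dist)
    fix u
    show "(\<lambda>n. expectation (\<lambda>\<omega>. iexp (u * (2 * Q (h n) n \<omega> / sqrt ((real n)\<^sup>2 * h n * A))))) \<longlonglongrightarrow> char std_normal_distribution u"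
      unfolding char_std_normal_distribution A_def by (rule degenerate_clt[OF h h0 nh \<Gamma>])
  next
    show "eventually (\<lambda>n. integrable M (\<lambda>\<omega>. T (h n) n \<omega> / sqrt ((real n)\<^sup>2 * h n * A) - 2 * Q (h n) n \<omega> / sqrt ((real n)\<^sup>2 * h n * A))
        \<and> expectation (\<lambda>\<omega>. \<bar>T (h n) n \<omega> / sqrt ((real n)\<^sup>2 * h n * A) - 2 * Q (h n) n \<omega> / sqrt ((real n)\<^sup>2 * h n * A)\<bar>) \<le> E n) sequentially"
      using V_scaled(1)[OF \<alpha> v c] eventually_gt_at_top[of 0]
    proof eventually_elim
      case (elim n)
      define x where "x = real n"
      have x: "0 < x" using elim by (simp add: x_def)
      have pp: "0 < p n" using p1 elim by (meson less_le_trans zero_less_one)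
      have hn: "0 < h n" by (rule h)
      have \<sigma>: "0 < sqrt ((real n)\<^sup>2 * h n * A)" using elim hn A by simp
      have \<sigma>e: "sqrt (x\<^sup>2 * h n * A) = x * sqrt (h n) * sqrt A" using x by (simp add: real_sqrt_mult)
      have Vn: "V n = vv n * (x * p n)" unfolding vv_def using np[of n] elim pp x by (simp add: x_def)
      note D = degenerate_term_approx[OF hn elim(2) \<sigma>]
      have s1: "sqrt (x * \<Gamma> * (vv n * (x * p n))) = x * sqrt (\<Gamma> * vv n) * sqrt (p n)"
      proof -
        have "x * \<Gamma> * (vv n * (x * p n)) = x\<^sup>2 * ((\<Gamma> * vv n) * p n)" by (simp add: power2_eq_square algebra_simps)
        then show ?thesis using x by (simp add: real_sqrt_mult)
      qed
      have s2: "sqrt (p n * h n) = sqrt (p n) * sqrt (h n)" by (rule real_sqrt_mult)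
      have s3: "sqrt ((p n)\<^sup>2 * h n) = p n * sqrt (h n)" using pp by (simp add: real_sqrt_mult)
      define sp sh sA where "sp = sqrt (p n)" and "sh = sqrt (h n)" and "sA = sqrt A"
      have sps: "0 < sp" "0 < sh" "0 < sA" "h n = sh * sh" using pp hn A by (auto simp: sp_def sh_def sA_def)
      define G1 where "G1 = sqrt (\<Gamma> * vv n)"
      have e1: "2 * Bf * h n * (x * G1 * sp) / (x * sh * sA) = 2 * Bf / sA * G1 * (sp * sh)"
        using x sps by (simp add: field_simps)
      have e2: "3 * Bf * h n * (x * \<Gamma>) / (x * sh * sA) = 3 * Bf * \<Gamma> / sA * sh"
        using x sps by (simp add: field_simps)
      have e3: "Bf * h n * (vv n * (x * p n)) / (x * sh * sA) = Bf / sA * vv n * (p n * sh)"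
        using x sps by (simp add: field_simps)
      have "expectation (\<lambda>\<omega>. \<bar>T (h n) n \<omega> / sqrt ((real n)\<^sup>2 * h n * A) - 2 * Q (h n) n \<omega> / sqrt ((real n)\<^sup>2 * h n * A)\<bar>)
        \<le> (2 * Bf * h n * (x * G1 * sp) + 3 * Bf * h n * (x * \<Gamma>) + Bf * h n * (vv n * (x * p n))) / (x * sh * sA)"
        using D(2) unfolding x_def[symmetric] \<sigma>e Vn s1 G1_def[symmetric] sp_def[symmetric] sh_def[symmetric] sA_def[symmetric] .
      also have "\<dots> = E n"
        unfolding add_divide_distrib e1 e2 e3 E_def s2 s3 G1_def[symmetric] sp_def[symmetric] sh_def[symmetric] sA_def[symmetric] ..
      finally show ?case using D(1) by simp
    qed
    show "E \<longlonglongrightarrow> 0"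
    proof -
      have vv: "vv \<longlonglongrightarrow> c" unfolding vv_def by (rule v)
      have "E \<longlonglongrightarrow> 2 * Bf / sqrt A * sqrt (\<Gamma> * c) * sqrt 0 + 3 * Bf * \<Gamma> / sqrt A * sqrt 0 + Bf / sqrt A * c * sqrt 0"
        unfolding E_def[abs_def]
        by (intro tendsto_add tendsto_mult tendsto_real_sqrt tendsto_const vv h0 z1 z2)
      then show ?thesis by simp
    qed
  qed measurable
qed

end

theorem theorem2p3:
  fixes M :: "'w measure"
    and \<xi> :: "int \<Rightarrow> 'w \<Rightarrow> real" and \<psi> :: "int \<Rightarrow> real"
    and e :: "int \<Rightarrow> 'w \<Rightarrow> real"
    and X :: "nat \<Rightarrow> 'w \<Rightarrow> real" and f :: "real \<Rightarrow> real"
    and K :: "real \<Rightarrow> real" and h :: "nat \<Rightarrow> real"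
    and \<alpha> \<eta> :: real
  assumes P: "prob_space M"
    (* innovations xi: i.i.d., mean 0, variance 1, finite sixth moment *)
    and xi_rv: "\<And>j. \<xi> j \<in> borel_measurable M"
    and xi_indep: "prob_space.indep_vars M (\<lambda>_. borel) \<xi> UNIV"
    and xi_id: "\<And>j. distr M borel (\<xi> j) = distr M borel (\<xi> 0)"
    and xi_mean: "(\<integral>\<omega>. \<xi> 0 \<omega> \<partial>M) = 0"
    and xi_var: "(\<integral>\<omega>. (\<xi> 0 \<omega>)^2 \<partial>M) = 1"
    and xi_m6: "integrable M (\<lambda>\<omega>. (\<xi> 0 \<omega>) ^ 6)"
    (* square summable coefficients *)
    and psi_sq: "(\<lambda>j. (\<psi> j)^2) summable_on UNIV"
    (* linear process e_t = sum_j psi_j xi_(t-j) *)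
    and e_rv: "\<And>t. e t \<in> borel_measurable M"
    and e_def: "\<And>t. AE \<omega> in M. (\<lambda>N. \<Sum>j\<in>{- int N..int N}. \<psi> j * \<xi> (t - j) \<omega>)
                                  \<longlonglongrightarrow> e t \<omega>"
    (* long memory: gamma(k) ~ eta k^(-alpha) *)
    and alpha: "0 < \<alpha>" "\<alpha> < 1" and eta: "0 < \<eta>"
    and gamma_asym: "(\<lambda>k::nat. lp_gamma \<psi> (int k)) \<sim>[at_top] (\<lambda>k. \<eta> * real k powr (- \<alpha>))"
    (* design X_t: i.i.d. with bounded uniformly continuous density f, independent of e *)
    and X_rv: "\<And>t. X t \<in> borel_measurable M"
    and X_indep: "prob_space.indep_vars M (\<lambda>_. borel) X UNIV"
    and f_nonneg: "\<And>x. 0 \<le> f x"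
    and X_dens: "\<And>t. distributed M lborel (X t) (\<lambda>x. ennreal (f x))"
    and f_bdd: "bounded (range f)"
    and f_uc: "uniformly_continuous_on UNIV f"
    and Xe_indep: "prob_space.indep_var M (PiM UNIV (\<lambda>_. borel)) (\<lambda>\<omega> t. X t \<omega>)
                                         (PiM UNIV (\<lambda>_. borel)) (\<lambda>\<omega> (s::int). e s \<omega>)"
    (* existence of estimators of lambda = (alpha, eta) with rate w_n *)
    and estim: "\<exists>(lt :: nat \<Rightarrow> 'w \<Rightarrow> real \<times> real) (w :: nat \<Rightarrow> real).
                  (\<forall>n. lt n \<in> borel_measurable M) \<and> (\<forall>n. 0 < w n) \<and>
                  filterlim (\<lambda>n. w n / ln (real n)) at_top sequentially \<and>
                  bigO_P M (\<lambda>n \<omega>. norm (lt n \<omega> - (\<alpha>, \<eta>))) (\<lambda>n. 1 / w n)"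
    (* kernel K: bounded symmetric probability density with tail condition *)
    and K_meas: "K \<in> borel_measurable borel"
    and K_nonneg: "\<And>x. 0 \<le> K x"
    and K_int: "integrable lborel K"
    and K_one: "(\<integral>x. K x \<partial>lborel) = 1"
    and K_bdd: "bounded (range K)"
    and K_sym: "\<And>x. K (- x) = K x"
    and K_tail: "1/2 < \<alpha> \<Longrightarrow> \<exists>\<beta>. 0 < \<beta> \<and> \<beta> < \<alpha> - 1/2 \<and>
                   K \<in> O[at_infinity](\<lambda>x. 1 / (1 + \<bar>x\<bar> powr (1 - \<beta>)))"
    and h_pos: "\<And>n. 0 < h n"
  defines "T \<equiv> \<lambda>n \<omega>. \<Sum>t\<in>{1..n}. \<Sum>s\<in>{1..n} - {t}.
                     e (int s) \<omega> * K ((X s \<omega> - X t \<omega>) / h n) * e (int t) \<omega>"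
    and "A1sq \<equiv> 2 * (lp_gamma \<psi> 0)^2 * (\<integral>x. (K x)^2 \<partial>lborel) * (\<integral>y. (f y)^2 \<partial>lborel)"
    and "A2 \<equiv> 2 * \<eta> / ((1 - \<alpha>) * (2 - \<alpha>)) * (\<integral>y. (f y)^2 \<partial>lborel)"
  shows "((\<lambda>n. real n powr (2 * (1 - \<alpha>)) * h n) \<longlonglongrightarrow> 0 \<and>
           filterlim (\<lambda>n. real n * h n) at_top sequentially \<longrightarrow>
           weak_conv_m (\<lambda>n. distr M borel
               (\<lambda>\<omega>. T n \<omega> / sqrt ((real n)^2 * h n * A1sq))) std_normal)
       \<and> (h \<longlonglongrightarrow> 0 \<and>
           filterlim (\<lambda>n. real n powr (2 * (1 - \<alpha>)) * h n) at_top sequentially \<longrightarrow>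
           weak_conv_m (\<lambda>n. distr M borel
               (\<lambda>\<omega>. T n \<omega> / (real n powr (2 - \<alpha>) * h n * A2))) chi2_1)"
proof -
  interpret M: prob_space M by (rule P)
  have bdd: "\<exists>B. \<forall>x. k x \<le> B" if "bounded (range k)" for k :: "real \<Rightarrow> real"
    using that unfolding bounded_iff by (metis abs_le_D1 rangeI real_norm_def)
  obtain Bf where Bf: "\<And>x. f x \<le> Bf" using bdd[OF f_bdd] by blast
  obtain BK where BK: "\<And>x. K x \<le> BK" using bdd[OF K_bdd] by blast
  have distr: "distr M lborel (X 0) = density lborel (\<lambda>x. ennreal (f x))"
    by (rule distributed_distr_eq_density[OF X_dens])
  \<comment> \<open>The moment bounds for linear forms work with fourth powers, which the sixth
    moment dominates.\<close>
  have xi4: "integrable M (\<lambda>\<omega>. \<xi> 0 \<omega> ^ 4)"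
  proof (rule Bochner_Integration.integrable_bound)
    show "integrable M (\<lambda>\<omega>. 1 + \<xi> 0 \<omega> ^ 6)" using xi_m6 by simp
    have "x ^ 4 \<le> 1 + x ^ 6" for x :: real
    proof (cases "\<bar>x\<bar> \<le> 1")
      case True
      then have "\<bar>x\<bar> ^ 4 \<le> 1" by (rule power_le_one[OF abs_ge_zero])
      moreover have "0 \<le> x ^ 6" "\<bar>x\<bar> ^ 4 = x ^ 4" by (simp_all add: power_even_abs)
      ultimately show ?thesis by linarith
    next
      case False
      then have "\<bar>x\<bar> ^ 4 \<le> \<bar>x\<bar> ^ 6" by (intro power_increasing) auto
      then show ?thesis by (simp add: power_even_abs)
    qed
    then show "AE \<omega> in M. norm (\<xi> 0 \<omega> ^ 4) \<le> norm (1 + \<xi> 0 \<omega> ^ 6)"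
      by (auto intro: order_trans[OF _ abs_ge_self])
  qed (use xi_rv in measurable)
  have fp: "prob_space (density lborel (\<lambda>x. ennreal (f x)))"
    unfolding distr[symmetric] using X_rv by (intro M.prob_space_distr) simp
  have fc: "continuous_on UNIV f" using f_uc by (rule uniformly_continuous_imp_continuous)
  interpret R: kernel_regression M \<xi> \<psi> e f K Bf BK X
    by (intro kernel_regression.intro linear_process.intro linear_process_axioms.intro smoothing.intro
          kernel_regression_axioms.intro) fact+
  have \<gamma>_lim: "(\<lambda>k. lp_gamma \<psi> (int k) / real k powr (- \<alpha>)) \<longlonglongrightarrow> \<eta>"
  proof -
    \<comment> \<open>Asymptotic equivalence reads 0/0 as 1, so the plain quotient is recovered
      where the denominator is nonzero, here for k > 0.\<close>
    have "(\<lambda>k. lp_gamma \<psi> (int k) / (\<eta> * real k powr (- \<alpha>))) \<longlonglongrightarrow> 1"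
      by (rule asymp_equivD_strong[OF gamma_asym])
         (use eta in \<open>auto intro!: eventually_mono[OF eventually_gt_at_top[of 0]]\<close>)
    from tendsto_mult_left[OF this, of \<eta>] show ?thesis using eta by simp
  qed
  have v: "(\<lambda>n. R.V n / real n powr (2 - \<alpha>)) \<longlonglongrightarrow> 2 * \<eta> / ((1 - \<alpha>) * (2 - \<alpha>))"
    unfolding R.V_def by (rule toeplitz_sum_asymptotics[OF R.lp_gamma_minus alpha \<gamma>_lim])
  have c: "0 < 2 * \<eta> / ((1 - \<alpha>) * (2 - \<alpha>))" using alpha eta by simp
  \<comment> \<open>If the variance were zero, all coefficients and hence all covariances would
    vanish, against the positive constant \<eta>.\<close>
  have \<Gamma>: "0 < R.\<Gamma>"
  proof (rule ccontr)
    assume "\<not> 0 < R.\<Gamma>"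
    then have "R.\<Gamma> = 0" using R.Gamma_nonneg by simp
    then have "(\<psi> j)\<^sup>2 \<le> 0" for j using R.sum_psi_sq_le[of "{j}"] by simp
    then have "\<psi> j = 0" for j by simp
    then have "lp_gamma \<psi> k = 0" for k by (simp add: lp_gamma_def)
    then have "(\<lambda>k::nat. 0) \<longlonglongrightarrow> \<eta>" using \<gamma>_lim by simp
    then show False using eta by (simp add: LIMSEQ_const_iff)
  qed
  have T: "T n = R.T (h n) n" for n
    unfolding T_def R.T_def ..
  show ?thesis
    unfolding T A1sq_def A2_def R.lp_gamma_0 std_normal_def
    using R.normal_limit[of h, OF h_pos alpha v c \<Gamma>] R.chi_square_limit[of h, OF h_pos _ alpha v c \<Gamma>] by blast
qed

end
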